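(* Let $(\mathcal M,\tau)$ be a finite von Neumann algebra. Then $(\mathcal M,\tau)$ satisfies the weak Dixmier property if and only if $\mathcal M$ satisfies one of the following conditions: 1. $\mathcal M$ is finite dimensional (hence atomic) and for every two non-zero minimal projections $E,F\in\mathcal M$, $\tau(E)=\tau(F)$; or equivalently, $(\mathcal M,\tau)$ can be identified as a von Neumann subalgebra of $(M_n(\mathbb C),\tau_n)$ that contains all diagonal matrices; 2. $\mathcal M$ is diffuse.
   Context: A finite von Neumann algebra $(\mathcal M,\tau)$ means a von Neumann algebra $\mathcal M$ with a faithful normal tracial state $\tau$; identifications are trace-preserving, and $\tau_n$ is the normalized trace on $M_n(\mathbb C)$. Positive operators $S,T\in\mathcal M$ are equi-measurable if $\tau(S^n)=\tau(T^n)$ for all $n=0,1,2,\dots$. $(\mathcal M,\tau)$ satisfies the weak Dixmier property if for every positive $T\in\mathcal M$, $\tau(T)1$ is in the operator norm closure of the convex hull of the set of (positive) $S\in\mathcal M$ that are equi-measurable with $T$. $\mathcal M$ is diffuse if it has no minimal projections. *)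

theory Defs
  imports
    "HOL-Analysis.Bounded_Linear_Function"
    "HOL-Analysis.Convex"
    "HOL-Library.Complex_Order"
    "Jordan_Normal_Form.Schur_Decomposition"
begin

section \<open>Complex Hilbert spaces and their operators\<close>

text \<open>
  The complex inner product is linear in its first argument.  Positive definiteness, the norm and
  the topology are inherited from the real inner product, which is the real part of the complex
  one.
\<close>

class complex_hilbert = real_inner + complete_space +
  fixes scaleC :: "complex \<Rightarrow> 'a \<Rightarrow> 'a"
    and cinner :: "'a \<Rightarrow> 'a \<Rightarrow> complex"
  assumes scaleC_add_right: "scaleC c (x + y) = scaleC c x + scaleC c y"
    and scaleC_add_left: "scaleC (c + d) x = scaleC c x + scaleC d x"
    and scaleC_scaleC: "scaleC c (scaleC d x) = scaleC (c * d) x"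
    and scaleC_of_real: "scaleC (complex_of_real r) x = r *\<^sub>R x"
    and cinner_add_left: "cinner (x + y) z = cinner x z + cinner y z"
    and cinner_scaleC_left: "cinner (scaleC c x) y = c * cinner x y"
    and cinner_commute: "cinner x y = cnj (cinner y x)"
    and inner_eq_Re_cinner: "inner x y = Re (cinner x y)"

lemma cinner_scaleC_right:
  fixes x y :: "'h::complex_hilbert"
  shows "cinner x (scaleC c y) = cnj c * cinner x y"
  by (metis cinner_commute cinner_scaleC_left complex_cnj_cnj complex_cnj_mult)

lemma norm_scaleC:
  fixes x :: "'h::complex_hilbert"
  shows "norm (scaleC c x) = cmod c * norm x"
proof -
  have "cinner (scaleC c x) (scaleC c x) = complex_of_real ((cmod c)\<^sup>2) * cinner x x"
    by (simp add: cinner_scaleC_left cinner_scaleC_right complex_norm_square mult.assoc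
        del: of_real_power)
  then have "(norm (scaleC c x))\<^sup>2 = (cmod c * norm x)\<^sup>2"
    by (simp add: power2_norm_eq_inner inner_eq_Re_cinner power_mult_distrib
        del: of_real_power)
  then show ?thesis
    by (simp add: power2_eq_iff_nonneg)
qed

text \<open>
  The bounded operators are the complex-linear elements of \<^typ>\<open>'h \<Rightarrow>\<^sub>L 'h\<close>; the operator norm, the
  norm topology and the strong operator topology are those of the library.
\<close>

definition complex_linear :: "('h::complex_hilbert \<Rightarrow>\<^sub>L 'h) \<Rightarrow> bool" where
  "complex_linear A \<longleftrightarrow> (\<forall>c x. A (scaleC c x) = scaleC c (A x))"

lift_definition op_scaleC ::
    "complex \<Rightarrow> ('h::complex_hilbert \<Rightarrow>\<^sub>L 'h) \<Rightarrow> ('h \<Rightarrow>\<^sub>L 'h)" is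
  "\<lambda>c A x. scaleC c (A x)"
proof -
  fix c and f :: "'h \<Rightarrow> 'h"
  assume f: "bounded_linear f"
  have "bounded_linear (scaleC c :: 'h \<Rightarrow> 'h)"
  proof (rule bounded_linear_intro)
    show "scaleC c (r *\<^sub>R x) = r *\<^sub>R scaleC c x" for r and x :: 'h
      by (simp add: scaleC_of_real[symmetric] scaleC_scaleC mult.commute)
    show "norm (scaleC c x) \<le> norm x * cmod c" for x :: 'h
      by (simp add: norm_scaleC mult.commute)
  qed (rule scaleC_add_right)
  from bounded_linear_compose[OF this f]
  show "bounded_linear (\<lambda>x. scaleC c (f x))" .
qed

definition op_pow :: "('h::complex_hilbert \<Rightarrow>\<^sub>L 'h) \<Rightarrow> nat \<Rightarrow> ('h \<Rightarrow>\<^sub>L 'h)" where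
  "op_pow A n = ((\<lambda>B. A o\<^sub>L B) ^^ n) id_blinfun"

text \<open>\<open>is_adjoint A B\<close> says \<open>B = A\<^sup>*\<close>; such a \<open>B\<close> exists and is unique.\<close>

definition is_adjoint ::
    "('h::complex_hilbert \<Rightarrow>\<^sub>L 'h) \<Rightarrow> ('h \<Rightarrow>\<^sub>L 'h) \<Rightarrow> bool" where
  "is_adjoint A B \<longleftrightarrow> (\<forall>x y. cinner (A x) y = cinner x (B y))"

text \<open>
  In the order on \<^typ>\<open>complex\<close>, \<open>0 \<le> z\<close> means that \<open>z\<close> is real and nonnegative.
\<close>

definition positive_op :: "('h::complex_hilbert \<Rightarrow>\<^sub>L 'h) \<Rightarrow> bool" where
  "positive_op A \<longleftrightarrow> (\<forall>x. 0 \<le> cinner (A x) x)"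

definition op_le :: "('h::complex_hilbert \<Rightarrow>\<^sub>L 'h) \<Rightarrow> ('h \<Rightarrow>\<^sub>L 'h) \<Rightarrow> bool" where
  "op_le A B \<longleftrightarrow> positive_op (B - A)"


section \<open>Finite von Neumann algebras\<close>

definition von_neumann_algebra :: "('h::complex_hilbert \<Rightarrow>\<^sub>L 'h) set \<Rightarrow> bool" where
  "von_neumann_algebra M \<longleftrightarrow>
     (\<forall>A\<in>M. complex_linear A) \<and>
     id_blinfun \<in> M \<and>
     (\<forall>A\<in>M. \<forall>B\<in>M. A + B \<in> M) \<and>
     (\<forall>c. \<forall>A\<in>M. op_scaleC c A \<in> M) \<and>
     (\<forall>A\<in>M. \<forall>B\<in>M. A o\<^sub>L B \<in> M) \<and>
     (\<forall>A\<in>M. \<exists>B\<in>M. is_adjoint A B) \<and>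
     closedin strong_operator_topology M"

text \<open>\<open>S\<close> is the supremum of \<open>D\<close> within the self-adjoint part of \<open>M\<close>.\<close>

definition is_op_sup ::
    "('h::complex_hilbert \<Rightarrow>\<^sub>L 'h) set \<Rightarrow> ('h \<Rightarrow>\<^sub>L 'h) set \<Rightarrow> ('h \<Rightarrow>\<^sub>L 'h) \<Rightarrow> bool" where
  "is_op_sup M D S \<longleftrightarrow>
     S \<in> M \<and> is_adjoint S S \<and> (\<forall>A\<in>D. op_le A S) \<and>
     (\<forall>B\<in>M. is_adjoint B B \<and> (\<forall>A\<in>D. op_le A B) \<longrightarrow> op_le S B)"

text \<open>
  Functionals on \<open>M\<close> are total functions whose values off \<open>M\<close> are irrelevant.  Normality is
  compatibility with suprema of bounded increasing nets, here given as upward directed sets.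
\<close>

definition normal_on ::
    "('h::complex_hilbert \<Rightarrow>\<^sub>L 'h) set \<Rightarrow> (('h \<Rightarrow>\<^sub>L 'h) \<Rightarrow> complex) \<Rightarrow> bool" where
  "normal_on M \<tau> \<longleftrightarrow>
     (\<forall>D S. D \<noteq> {} \<and> D \<subseteq> {A\<in>M. is_adjoint A A} \<and>
        (\<forall>A\<in>D. \<forall>B\<in>D. \<exists>C\<in>D. op_le A C \<and> op_le B C) \<and> is_op_sup M D S \<longrightarrow>
        Re (\<tau> S) = (SUP A\<in>D. Re (\<tau> A)))"

definition state_on ::
    "('h::complex_hilbert \<Rightarrow>\<^sub>L 'h) set \<Rightarrow> (('h \<Rightarrow>\<^sub>L 'h) \<Rightarrow> complex) \<Rightarrow> bool" where
  "state_on M \<tau> \<longleftrightarrow>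
     (\<forall>A\<in>M. \<forall>B\<in>M. \<tau> (A + B) = \<tau> A + \<tau> B) \<and>
     (\<forall>c. \<forall>A\<in>M. \<tau> (op_scaleC c A) = c * \<tau> A) \<and>
     (\<forall>A\<in>M. positive_op A \<longrightarrow> 0 \<le> \<tau> A) \<and>
     \<tau> id_blinfun = 1"

definition finite_von_neumann_algebra ::
    "('h::complex_hilbert \<Rightarrow>\<^sub>L 'h) set \<Rightarrow> (('h \<Rightarrow>\<^sub>L 'h) \<Rightarrow> complex) \<Rightarrow> bool" where
  "finite_von_neumann_algebra M \<tau> \<longleftrightarrow>
     von_neumann_algebra M \<and> state_on M \<tau> \<and> normal_on M \<tau> \<and>
     (\<forall>A\<in>M. \<forall>B\<in>M. \<tau> (A o\<^sub>L B) = \<tau> (B o\<^sub>L A)) \<and>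
     (\<forall>A\<in>M. positive_op A \<and> \<tau> A = 0 \<longrightarrow> A = 0)"


section \<open>The weak Dixmier property\<close>

definition equi_measurable ::
    "(('h::complex_hilbert \<Rightarrow>\<^sub>L 'h) \<Rightarrow> complex) \<Rightarrow> ('h \<Rightarrow>\<^sub>L 'h) \<Rightarrow> ('h \<Rightarrow>\<^sub>L 'h) \<Rightarrow> bool" where
  "equi_measurable \<tau> S T \<longleftrightarrow> (\<forall>n. \<tau> (op_pow S n) = \<tau> (op_pow T n))"

definition weak_Dixmier_property ::
    "('h::complex_hilbert \<Rightarrow>\<^sub>L 'h) set \<Rightarrow> (('h \<Rightarrow>\<^sub>L 'h) \<Rightarrow> complex) \<Rightarrow> bool" where
  "weak_Dixmier_property M \<tau> \<longleftrightarrow>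
     (\<forall>T\<in>M. positive_op T \<longrightarrow>
        op_scaleC (\<tau> T) id_blinfun
          \<in> closure (convex hull {S\<in>M. positive_op S \<and> equi_measurable \<tau> S T}))"


section \<open>Projections, finite dimension, diffuseness\<close>

definition projection_in ::
    "('h::complex_hilbert \<Rightarrow>\<^sub>L 'h) set \<Rightarrow> ('h \<Rightarrow>\<^sub>L 'h) \<Rightarrow> bool" where
  "projection_in M E \<longleftrightarrow> E \<in> M \<and> is_adjoint E E \<and> E o\<^sub>L E = E"

definition minimal_projection ::
    "('h::complex_hilbert \<Rightarrow>\<^sub>L 'h) set \<Rightarrow> ('h \<Rightarrow>\<^sub>L 'h) \<Rightarrow> bool" where
  "minimal_projection M E \<longleftrightarrow>
     projection_in M E \<and> E \<noteq> 0 \<and>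
     (\<forall>F. projection_in M F \<and> op_le F E \<longrightarrow> F = 0 \<or> F = E)"

definition diffuse :: "('h::complex_hilbert \<Rightarrow>\<^sub>L 'h) set \<Rightarrow> bool" where
  "diffuse M \<longleftrightarrow> \<not> (\<exists>E. minimal_projection M E)"

definition atomic :: "('h::complex_hilbert \<Rightarrow>\<^sub>L 'h) set \<Rightarrow> bool" where
  "atomic M \<longleftrightarrow>
     (\<forall>F. projection_in M F \<and> F \<noteq> 0 \<longrightarrow> (\<exists>E. minimal_projection M E \<and> op_le E F))"

definition finite_dimensional :: "('h::complex_hilbert \<Rightarrow>\<^sub>L 'h) set \<Rightarrow> bool" where
  "finite_dimensional M \<longleftrightarrow>
     (\<exists>B. finite B \<and> B \<subseteq> M \<and> (\<forall>A\<in>M. \<exists>c. A = (\<Sum>b\<in>B. op_scaleC (c b) b)))"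


section \<open>Subalgebras of the full matrix algebra\<close>

definition normalized_trace :: "nat \<Rightarrow> complex mat \<Rightarrow> complex" where
  "normalized_trace n A = (\<Sum>i<n. A $$ (i, i)) / of_nat n"

text \<open>
  In finite dimension the strong operator topology on matrices is entrywise convergence, which is
  metrizable, so sequences suffice for closedness.
\<close>

definition matrix_von_neumann_algebra :: "nat \<Rightarrow> complex mat set \<Rightarrow> bool" where
  "matrix_von_neumann_algebra n N \<longleftrightarrow>
     N \<subseteq> carrier_mat n n \<and>
     1\<^sub>m n \<in> N \<and>
     (\<forall>A\<in>N. \<forall>B\<in>N. A + B \<in> N) \<and>
     (\<forall>c. \<forall>A\<in>N. c \<cdot>\<^sub>m A \<in> N) \<and>
     (\<forall>A\<in>N. \<forall>B\<in>N. A * B \<in> N) \<and>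
     (\<forall>A\<in>N. mat_adjoint A \<in> N) \<and>
     (\<forall>X. \<forall>A\<in>carrier_mat n n.
        (\<forall>k. X k \<in> N) \<and>
        (\<forall>i<n. \<forall>j<n. (\<lambda>k. X k $$ (i, j)) \<longlonglongrightarrow> A $$ (i, j)) \<longrightarrow> A \<in> N)"

definition trace_preserving_isomorphism ::
    "('h::complex_hilbert \<Rightarrow>\<^sub>L 'h) set \<Rightarrow> (('h \<Rightarrow>\<^sub>L 'h) \<Rightarrow> complex) \<Rightarrow>
     nat \<Rightarrow> complex mat set \<Rightarrow> (('h \<Rightarrow>\<^sub>L 'h) \<Rightarrow> complex mat) \<Rightarrow> bool" where
  "trace_preserving_isomorphism M \<tau> n N \<Phi> \<longleftrightarrow>
     bij_betw \<Phi> M N \<and>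
     \<Phi> id_blinfun = 1\<^sub>m n \<and>
     (\<forall>A\<in>M. \<forall>B\<in>M. \<Phi> (A + B) = \<Phi> A + \<Phi> B) \<and>
     (\<forall>c. \<forall>A\<in>M. \<Phi> (op_scaleC c A) = c \<cdot>\<^sub>m \<Phi> A) \<and>
     (\<forall>A\<in>M. \<forall>B\<in>M. \<Phi> (A o\<^sub>L B) = \<Phi> A * \<Phi> B) \<and>
     (\<forall>A\<in>M. \<forall>B\<in>M. is_adjoint A B \<longrightarrow> \<Phi> B = mat_adjoint (\<Phi> A)) \<and>
     (\<forall>A\<in>M. normalized_trace n (\<Phi> A) = \<tau> A)"

end

theory Submission
  imports Defs
begin

text \<open>
  Let \<open>M\<close> carry the faithful normal tracial state \<open>\<tau>\<close>.

  \<^bold>\<open>Necessity.\<close> Suppose that \<open>E\<close> is a minimal projection and \<open>P\<close> a projection with \<open>\<tau> P < \<tau> E\<close>.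
  Minimality gives \<open>E P E = r E\<close>, and if \<open>r \<noteq> 0\<close> then \<open>P E P / r\<close> is a projection below \<open>P\<close> with the
  trace of \<open>E\<close>, which is too large; so \<open>E P = 0\<close>.  Any positive operator equi-measurable with a projection \<open>F\<close>
  is a projection of the same trace.  If \<open>0 < \<tau> F < \<tau> E\<close>, then \<open>E\<close> therefore annihilates the closed convex
  hull of all positive operators equi-measurable with \<open>F\<close>, and this hull cannot contain \<open>\<tau> F\<close>.  Under the weak
  Dixmier property the trace of a minimal projection is thus the least trace of any nonzero projection
  (\<open>weak_Dixmier_trace_gap\<close>).  All minimal projections then have equal trace, orthogonal families are
  bounded in size, \<open>1\<close> is a finite sum of minimal projections, and \<open>M\<close> is finite dimensional because
  every corner \<open>E M F\<close> between minimal projections is at most one-dimensional.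

  \<^bold>\<open>Sufficiency, finite dimension.\<close> A positive \<open>T\<close> is \<open>\<Sum> r i e i\<close> with orthogonal minimal \<open>e i\<close> of trace
  \<open>1/n\<close>.  Rotating the eigenvalues cyclically gives \<open>n\<close> equi-measurable operators whose average is exactly
  \<open>\<tau> T\<close> (\<open>weak_Dixmier_equal_minimal_traces\<close>).

  \<^bold>\<open>Sufficiency, diffuse case.\<close> The same rotation works approximately; let \<open>0 \<le> T \<le> 1\<close>.  By normality a diffuse algebra has
  below each projection subprojections of every smaller trace.  Bisecting the spectrum of \<open>T\<close> again and
  again produces a binary tree of projections, and \<open>T\<close> is the norm limit of the dyadic step operators of
  this tree.  The moments of \<open>T\<close> depend only on the traces along the tree, so any tree with the same traces
  yields an equi-measurable operator (\<open>tree_equi_measurable\<close>).  Lay the traces of the tree out as nested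
  subintervals of \<open>[0,1]\<close>, cut \<open>[0,1]\<close> into \<open>n\<close> equal cells, and realise the part of the tree in the
  \<open>l\<close>-th cell by a tree below the \<open>i\<close>-th of \<open>n\<close> orthogonal projections of trace \<open>1/n\<close>.  For every cyclic
  shift \<open>k\<close> the blocks with \<open>l = i + k\<close> form a tree with the right traces.  At a fixed level the average over
  \<open>k\<close> of the step operators differs from a scalar only through the at most two cells that each interval
  cuts, which becomes negligible as \<open>n\<close> grows (\<open>rotation_average\<close>).

  \<^bold>\<open>Matrices.\<close> Minimal projections of trace \<open>1/n\<close> adding up to \<open>1\<close>, joined by partial isometries, form a
  block system of matrix units, which realises \<open>M\<close> as the matrices vanishing off the blocks
  (\<open>matrix_realization\<close>).  Conversely the diagonal matrix units pull back to such minimal projections.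

  The only spectral theory used is a projection in \<open>M\<close> that separates the positive from the negative part
  of a self-adjoint element (\<open>spectral_split\<close>).
\<close>

section \<open>Operators on a complex Hilbert space\<close>

subclass (in complex_hilbert) banach ..

notation blinfun_compose (infixl "\<cdot>" 70)

named_theorems op_simps

lemma op_assoc [op_simps]: "(A \<cdot> B) \<cdot> C = A \<cdot> (B \<cdot> C)"
  by (rule blinfun_eqI) simp

lemmas [op_simps] =
  bounded_bilinear.add_left[OF bounded_bilinear_blinfun_compose]
  bounded_bilinear.add_right[OF bounded_bilinear_blinfun_compose]
  bounded_bilinear.diff_left[OF bounded_bilinear_blinfun_compose]
  bounded_bilinear.diff_right[OF bounded_bilinear_blinfun_compose]
  bounded_bilinear.minus_left[OF bounded_bilinear_blinfun_compose]
  bounded_bilinear.minus_right[OF bounded_bilinear_blinfun_compose]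
  bounded_bilinear.scaleR_left[OF bounded_bilinear_blinfun_compose]
  bounded_bilinear.scaleR_right[OF bounded_bilinear_blinfun_compose]

lemmas op_sum_left = bounded_bilinear.sum_left[OF bounded_bilinear_blinfun_compose]
lemmas op_sum_right = bounded_bilinear.sum_right[OF bounded_bilinear_blinfun_compose]
lemmas tendsto_compose_op = bounded_bilinear.tendsto[OF bounded_bilinear_blinfun_compose]

lemma op_id_left [simp]: "id_blinfun \<cdot> A = A" and op_id_right [simp]: "A \<cdot> id_blinfun = A"
  by (auto intro: blinfun_eqI)

lemma op_commute_apply: "A \<cdot> B = B \<cdot> A \<Longrightarrow> A (B x) = B (A x)"
  using blinfun_apply_blinfun_compose[of A B x] blinfun_apply_blinfun_compose[of B A x] by simp

lemma cinner_add_right: "cinner x (y + z) = cinner x y + cinner x (z :: 'h::complex_hilbert)"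
  by (metis cinner_add_left cinner_commute complex_cnj_add)

lemma cinner_minus_left: "cinner (- x) y = - cinner (x :: 'h::complex_hilbert) y"
proof -
  have "cinner (scaleC (complex_of_real (-1)) x) y = - cinner x y"
    by (subst cinner_scaleC_left) simp
  then show ?thesis by (simp only: scaleC_of_real) simp
qed

lemma cinner_minus_right: "cinner x (- y) = - cinner (x :: 'h::complex_hilbert) y"
  by (metis cinner_minus_left cinner_commute complex_cnj_minus)

lemma cinner_diff_left: "cinner (x - y) z = cinner x z - cinner y (z :: 'h::complex_hilbert)"
  using cinner_add_left[of x "- y" z] by (simp add: cinner_minus_left)

lemma cinner_diff_right: "cinner z (x - y) = cinner z x - cinner z (y :: 'h::complex_hilbert)"
  using cinner_add_right[of z x "- y"] by (simp add: cinner_minus_right)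

lemma Im_cinner: "Im (cinner x y) = inner x (scaleC \<i> (y :: 'h::complex_hilbert))"
  by (simp add: inner_eq_Re_cinner cinner_scaleC_right)

lemma cinner_eqI:
  fixes x y :: "'h::complex_hilbert"
  assumes "\<And>z. cinner x z = cinner y z"
  shows "x = y"
  using assms by (metis (no_types, lifting) inner_eq_Re_cinner vector_eq_rdot)

lemma scaleC_zero_left [simp]: "scaleC 0 (x :: 'h::complex_hilbert) = 0"
  using scaleC_of_real[of 0 x] by simp

lemma scaleC_one [simp]: "scaleC 1 (x :: 'h::complex_hilbert) = x"
  using scaleC_of_real[of 1 x] by simp

lemma scaleC_zero_right [simp]: "scaleC c (0 :: 'h::complex_hilbert) = 0"
  using scaleC_add_right[of c 0 0] by simp

lemma scaleC_minus_right: "scaleC c (- x) = - scaleC c (x :: 'h::complex_hilbert)"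
  using scaleC_add_right[of c x "- x"] by (simp add: eq_neg_iff_add_eq_0 add.commute)

lemma scaleC_diff_right: "scaleC c (x - y) = scaleC c x - scaleC c (y :: 'h::complex_hilbert)"
  using scaleC_add_right[of c x "- y"] by (simp add: scaleC_minus_right)

lemma op_scaleC_apply [simp]: "op_scaleC c A x = scaleC c (A x)"
  by (simp add: op_scaleC.rep_eq)

lemma op_scaleC_of_real: "op_scaleC (complex_of_real r) A = r *\<^sub>R A"
  by (rule blinfun_eqI) (simp add: scaleC_of_real blinfun.bilinear_simps)

lemma op_scaleC_simps:
  "op_scaleC 0 A = 0" "op_scaleC 1 A = A" "op_scaleC c 0 = 0"
  "op_scaleC c (A + B) = op_scaleC c A + op_scaleC c B"
  "op_scaleC c (A - B) = op_scaleC c A - op_scaleC c B"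
  "op_scaleC (c + d) A = op_scaleC c A + op_scaleC d A"
  "op_scaleC c (op_scaleC d A) = op_scaleC (c * d) A"
  "op_scaleC c A \<cdot> B = op_scaleC c (A \<cdot> B)"
  by (rule blinfun_eqI; simp add: blinfun.bilinear_simps scaleC_add_right scaleC_diff_right
        scaleC_add_left scaleC_scaleC)+

lemma op_scaleC_minus: "op_scaleC (- c) A = - op_scaleC c A"
  using op_scaleC_simps(6)[of c "- c" A] by (simp add: op_scaleC_simps eq_neg_iff_add_eq_0 add.commute)

lemma op_scaleC_sum_left: "op_scaleC (\<Sum>i\<in>I. c i) A = (\<Sum>i\<in>I. op_scaleC (c i) A)"
  by (induction I rule: infinite_finite_induct) (auto simp: op_scaleC_simps)

lemma op_scaleC_right: "complex_linear A \<Longrightarrow> A \<cdot> op_scaleC c B = op_scaleC c (A \<cdot> B)"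
  by (rule blinfun_eqI) (simp add: complex_linear_def)

section \<open>Adjoints, positivity and norms\<close>

lemma is_adjoint_linear: "is_adjoint A B \<Longrightarrow> complex_linear A"
  unfolding is_adjoint_def complex_linear_def
  by (intro allI cinner_eqI) (simp add: cinner_scaleC_left)

lemma is_adjoint_sym: "is_adjoint A B \<Longrightarrow> is_adjoint B A"
  unfolding is_adjoint_def by (metis cinner_commute)

lemma is_adjoint_unique: "is_adjoint A B \<Longrightarrow> is_adjoint A C \<Longrightarrow> B = C"
  by (intro blinfun_eqI cinner_eqI) (metis is_adjoint_def is_adjoint_sym)

lemma is_adjoint_inner: "is_adjoint A B \<Longrightarrow> inner (A x) y = inner x (B y)"
  by (simp add: is_adjoint_def inner_eq_Re_cinner)

text \<open>
  The imaginary part of the complex inner product is its real part after multiplication of one vector by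
  \<open>\<i>\<close>, so complex linearity upgrades the real adjoint relation to the complex one.
\<close>

lemma is_adjointI_inner:
  fixes A B :: "'h::complex_hilbert \<Rightarrow>\<^sub>L 'h"
  assumes "complex_linear B" "\<And>x y. inner (A x) y = inner x (B y)"
  shows "is_adjoint A B"
  unfolding is_adjoint_def
proof (intro allI complex_eqI)
  fix x y
  show "Re (cinner (A x) y) = Re (cinner x (B y))"
    using assms(2) by (simp add: inner_eq_Re_cinner)
  show "Im (cinner (A x) y) = Im (cinner x (B y))"
    using assms by (simp add: Im_cinner complex_linear_def)
qed

lemma is_adjoint_add: "is_adjoint A A' \<Longrightarrow> is_adjoint B B' \<Longrightarrow> is_adjoint (A + B) (A' + B')"
  by (simp add: is_adjoint_def blinfun.bilinear_simps cinner_add_left cinner_add_right)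

lemma is_adjoint_diff: "is_adjoint A A' \<Longrightarrow> is_adjoint B B' \<Longrightarrow> is_adjoint (A - B) (A' - B')"
  by (simp add: is_adjoint_def blinfun.bilinear_simps cinner_diff_left cinner_diff_right)

lemma is_adjoint_compose: "is_adjoint A A' \<Longrightarrow> is_adjoint B B' \<Longrightarrow> is_adjoint (A \<cdot> B) (B' \<cdot> A')"
  by (simp add: is_adjoint_def)

lemma is_adjoint_scaleC: "is_adjoint A A' \<Longrightarrow> is_adjoint (op_scaleC c A) (op_scaleC (cnj c) A')"
  by (simp add: is_adjoint_def cinner_scaleC_left cinner_scaleC_right)

lemma is_adjoint_scaleR: "is_adjoint A A' \<Longrightarrow> is_adjoint (r *\<^sub>R A) (r *\<^sub>R A')"
  using is_adjoint_scaleC[of A A' "complex_of_real r"] by (simp add: op_scaleC_of_real)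

lemma is_adjoint_id [simp]: "is_adjoint id_blinfun id_blinfun"
  by (simp add: is_adjoint_def)

lemma is_adjoint_zero [simp]: "is_adjoint 0 0"
  using is_adjoint_scaleR[OF is_adjoint_id, of 0] by simp

lemma is_adjoint_sum:
  "(\<And>i. i \<in> I \<Longrightarrow> is_adjoint (A i) (B i)) \<Longrightarrow> is_adjoint (\<Sum>i\<in>I. A i) (\<Sum>i\<in>I. B i)"
  by (induction I rule: infinite_finite_induct) (auto intro: is_adjoint_add)

lemmas is_adjoint_intros = is_adjoint_add is_adjoint_diff is_adjoint_compose is_adjoint_scaleR
  is_adjoint_id is_adjoint_zero is_adjoint_sum

text \<open>
  Testing against all pairs of vectors turns an identity between polynomials in operators into linear
  arithmetic over real inner products.
\<close>

lemma op_eq_innerI: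
  fixes A B :: "'h::real_inner \<Rightarrow>\<^sub>L 'h"
  assumes "\<And>x z. inner (A x) z = inner (B x) z"
  shows "A = B"
  using assms by (metis blinfun_eqI vector_eq_rdot)

lemmas op_inner_simps = blinfun.bilinear_simps inner_add_left inner_add_right inner_diff_left
  inner_diff_right

lemma positive_op_iff:
  assumes "is_adjoint A A"
  shows "positive_op A \<longleftrightarrow> (\<forall>x. 0 \<le> inner (A x) x)"
proof -
  have "Im (cinner (A x) x) = 0" for x
  proof -
    have "cinner (A x) x = cnj (cinner (A x) x)"
      using assms cinner_commute[of "A x" x] by (simp add: is_adjoint_def)
    then show ?thesis by (metis complex_cnj_cancel_iff complex_cnj Im_complex_of_real
      add.inverse_inverse neg_equal_zero complex.sel(2) complex_surj)
  qed
  then show ?thesis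
    by (simp add: positive_op_def less_eq_complex_def inner_eq_Re_cinner)
qed

text \<open>
  Polarization: replacing \<open>y\<close> by \<open>\<i> y\<close> changes the sign of one of the two mixed terms.  Over the reals the
  claim fails for rotations.
\<close>

lemma quadratic_form_eq_0:
  fixes D :: "'h::complex_hilbert \<Rightarrow>\<^sub>L 'h"
  assumes "complex_linear D" "\<And>x. cinner (D x) x = 0"
  shows "D = 0"
proof (intro blinfun_eqI cinner_eqI)
  fix x y
  have *: "cinner (D u) v + cinner (D v) u = 0" for u v
    using assms(2)[of "u + v"] assms(2)[of u] assms(2)[of v]
    by (simp add: blinfun.bilinear_simps cinner_add_left cinner_add_right add.commute)
  have "cinner (D x) (scaleC \<i> y) + cinner (D (scaleC \<i> y)) x = 0"
    by (rule *)
  then have "\<i> * (cinner (D y) x - cinner (D x) y) = 0"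
    using assms(1) by (simp add: complex_linear_def cinner_scaleC_left cinner_scaleC_right algebra_simps)
  with *[of x y] have "cinner (D x) y = 0"
    by simp
  then show "cinner (D x) y = cinner ((0 :: 'h \<Rightarrow>\<^sub>L 'h) x) y"
    by (metis assms(2) blinfun.zero_left mult_eq_0_iff scaleC_zero_left cinner_scaleC_left)
qed

lemma positive_op_selfadjoint:
  assumes "is_adjoint A B" "positive_op A"
  shows "is_adjoint A A"
proof -
  have "A - B = 0"
  proof (rule quadratic_form_eq_0)
    show "complex_linear (A - B)"
      using is_adjoint_linear[OF assms(1)] is_adjoint_linear[OF is_adjoint_sym[OF assms(1)]]
      by (simp add: complex_linear_def blinfun.bilinear_simps scaleC_diff_right)
    fix x
    have "cinner (B x) x = cnj (cinner (A x) x)"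
      using assms(1) cinner_commute[of x "B x"] by (simp add: is_adjoint_def)
    moreover have "cnj (cinner (A x) x) = cinner (A x) x"
      using assms(2) by (auto simp: positive_op_def less_eq_complex_def complex_eq_iff)
    ultimately show "cinner ((A - B) x) x = 0"
      by (simp add: blinfun.bilinear_simps cinner_diff_left)
  qed
  with assms(1) show ?thesis by simp
qed

text \<open>
  Polarization and the parallelogram law bound \<open>\<langle>A u, v\<rangle>\<close> by \<open>c (|u|^2 + |v|^2) / 2\<close>; the best choice of \<open>v\<close> is
  the multiple of \<open>A x\<close> that has the same norm as \<open>x\<close>.
\<close>

lemma norm_selfadjoint_le:
  assumes A: "is_adjoint A A" and c: "\<And>x. \<bar>inner (A x) x\<bar> \<le> c * (norm x)\<^sup>2" "0 \<le> c"
  shows "norm A \<le> c"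
proof (rule norm_blinfun_bound[OF c(2)])
  fix x
  have bilin: "2 * inner (A u) v \<le> c * ((norm u)\<^sup>2 + (norm v)\<^sup>2)" for u v
  proof -
    have "4 * inner (A u) v = inner (A (u + v)) (u + v) - inner (A (u - v)) (u - v)"
      using is_adjoint_inner[OF A, of u v]
      by (simp add: blinfun.bilinear_simps inner_add_left inner_add_right inner_diff_left
          inner_diff_right inner_commute)
    also have "\<dots> \<le> c * (norm (u + v))\<^sup>2 + c * (norm (u - v))\<^sup>2"
      using c(1)[of "u + v"] c(1)[of "u - v"] by linarith
    also have "\<dots> = c * (2 * ((norm u)\<^sup>2 + (norm v)\<^sup>2))"
      by (simp add: power2_norm_eq_inner inner_add_left inner_add_right inner_diff_left
          inner_diff_right inner_commute algebra_simps)
    also have "\<dots> = 2 * (c * ((norm u)\<^sup>2 + (norm v)\<^sup>2))" by simp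
    finally show ?thesis by linarith
  qed
  show "norm (A x) \<le> c * norm x"
  proof (cases "A x = 0 \<or> x = 0")
    case False
    define s where "s = norm x / norm (A x)"
    have s: "s > 0" "norm (s *\<^sub>R A x) = norm x" using False by (auto simp: s_def)
    have "2 * (s * (norm (A x))\<^sup>2) \<le> c * (2 * (norm x)\<^sup>2)"
      using bilin[of x "s *\<^sub>R A x"] s by (simp add: power2_norm_eq_inner)
    moreover have "s * (norm (A x))\<^sup>2 = norm x * norm (A x)"
      using False by (simp add: s_def power2_eq_square)
    ultimately have "norm x * norm (A x) \<le> c * (norm x)\<^sup>2"
      by linarith
    then have "norm x * norm (A x) \<le> norm x * (c * norm x)"
      by (simp add: power2_eq_square algebra_simps)
    then show ?thesis using False by (simp add: mult_le_cancel_left_pos)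
  qed (use c(2) in auto)
qed

lemma inner_op_bound:
  fixes A :: "'a::real_inner \<Rightarrow>\<^sub>L 'a"
  shows "\<bar>inner (A x) x\<bar> \<le> norm A * (norm x)\<^sup>2"
proof -
  have "\<bar>inner (A x) x\<bar> \<le> norm (A x) * norm x" by (rule Cauchy_Schwarz_ineq2)
  also have "\<dots> \<le> norm A * norm x * norm x"
    by (rule mult_right_mono[OF norm_blinfun]) simp
  finally show ?thesis by (simp add: power2_eq_square mult.assoc)
qed

lemma op_pow_0 [simp]: "op_pow A 0 = id_blinfun"
  by (simp add: op_pow_def)

lemma op_pow_Suc [simp]: "op_pow A (Suc n) = A \<cdot> op_pow A n"
  by (simp add: op_pow_def)

lemma op_pow_add: "op_pow A (m + n) = op_pow A m \<cdot> op_pow A n"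
  by (induction m) (auto simp: op_assoc)

lemma op_pow_commute: "B \<cdot> A = A \<cdot> B \<Longrightarrow> B \<cdot> op_pow A n = op_pow A n \<cdot> B"
proof (induction n)
  case (Suc n)
  have "B \<cdot> (A \<cdot> op_pow A n) = A \<cdot> (B \<cdot> op_pow A n)"
    by (metis op_assoc Suc.prems)
  then show ?case using Suc by (simp add: op_assoc)
qed simp

lemma is_adjoint_pow: "is_adjoint A A \<Longrightarrow> is_adjoint (op_pow A n) (op_pow A n)"
proof (induction n)
  case (Suc n)
  then show ?case
    using is_adjoint_compose[of A A "op_pow A n" "op_pow A n"] op_pow_commute[of A A n] by simp
qed simp

lemma tendsto_op_pow:
  fixes X :: "_ \<Rightarrow> ('h::complex_hilbert \<Rightarrow>\<^sub>L 'h)"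
  shows "(X \<longlongrightarrow> A) F \<Longrightarrow> ((\<lambda>m. op_pow (X m) n) \<longlongrightarrow> op_pow A n) F"
  by (induction n) (auto intro!: tendsto_compose_op)

section \<open>Star-algebras closed under strong limits of sequences\<close>

text \<open>
  Strong closedness is stated for sequences because all limits below are limits of sequences, and because
  uniqueness of such limits shows at once that commutants inherit it.
\<close>

locale star_algebra =
  fixes M :: "('h::complex_hilbert \<Rightarrow>\<^sub>L 'h) set"
  assumes linear: "A \<in> M \<Longrightarrow> complex_linear A"
    and id_closed [simp]: "id_blinfun \<in> M"
    and add_closed: "A \<in> M \<Longrightarrow> B \<in> M \<Longrightarrow> A + B \<in> M"
    and scaleC_closed: "A \<in> M \<Longrightarrow> op_scaleC c A \<in> M"
    and compose_closed: "A \<in> M \<Longrightarrow> B \<in> M \<Longrightarrow> A \<cdot> B \<in> M"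
    and adjoint_exists: "A \<in> M \<Longrightarrow> \<exists>B\<in>M. is_adjoint A B"
    and limit_closed: "(\<And>n. X n \<in> M) \<Longrightarrow> (\<And>x. (\<lambda>n::nat. blinfun_apply (X n) x) \<longlonglongrightarrow> A x) \<Longrightarrow> A \<in> M"
begin

lemma scaleR_closed: "A \<in> M \<Longrightarrow> r *\<^sub>R A \<in> M"
  using scaleC_closed[of A "complex_of_real r"] by (simp add: op_scaleC_of_real)

lemma zero_closed [simp]: "0 \<in> M"
  using scaleR_closed[OF id_closed, of 0] by simp

lemma diff_closed: "A \<in> M \<Longrightarrow> B \<in> M \<Longrightarrow> A - B \<in> M"
  using add_closed[of A "(-1) *\<^sub>R B"] scaleR_closed[of B "-1"] by simp

lemma sum_closed: "(\<And>i. i \<in> I \<Longrightarrow> A i \<in> M) \<Longrightarrow> (\<Sum>i\<in>I. A i) \<in> M"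
  by (induction I rule: infinite_finite_induct) (auto intro: add_closed)

lemma pow_closed: "A \<in> M \<Longrightarrow> op_pow A n \<in> M"
  by (induction n) (auto intro: compose_closed)

lemmas closed_intros = add_closed diff_closed scaleR_closed compose_closed scaleC_closed sum_closed
  id_closed zero_closed pow_closed

lemma positive_selfadjoint: "A \<in> M \<Longrightarrow> positive_op A \<Longrightarrow> is_adjoint A A"
  using adjoint_exists positive_op_selfadjoint by blast

lemma norm_limit_closed:
  assumes "\<And>n. X n \<in> M" "X \<longlonglongrightarrow> A" shows "A \<in> M"
  by (rule limit_closed[of X]) (auto intro!: tendsto_intros assms)

lemma strong_limit:
  assumes X: "\<And>n. X n \<in> M" and bound: "\<And>n. norm (X n) \<le> c"
    and Cauchy: "\<And>x. Cauchy (\<lambda>n. X n x)"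
  obtains A where "A \<in> M" "\<And>x. (\<lambda>n. X n x) \<longlonglongrightarrow> A x" "norm A \<le> c"
proof -
  define f where "f x = lim (\<lambda>n. X n x)" for x
  have f: "(\<lambda>n. X n x) \<longlonglongrightarrow> f x" for x
    unfolding f_def using Cauchy[of x] by (simp add: Cauchy_convergent_iff convergent_LIMSEQ_iff)
  have f_norm: "norm (f x) \<le> norm x * c" for x
  proof (rule LIMSEQ_le_const2[OF tendsto_norm[OF f]])
    show "\<exists>N. \<forall>n\<ge>N. norm (X n x) \<le> norm x * c"
      using order_trans[OF norm_blinfun mult_right_mono[OF bound]]
      by (metis mult.commute norm_ge_zero)
  qed
  have "bounded_linear f"
  proof (rule bounded_linear_intro)
    show "f (x + y) = f x + f y" for x y
      using tendsto_add[OF f f, of x y] f[of "x + y"] LIMSEQ_unique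
      by (simp add: blinfun.add_right) blast
    show "f (r *\<^sub>R x) = r *\<^sub>R f x" for r x
      using tendsto_scaleR[OF tendsto_const f, of r x] f[of "r *\<^sub>R x"] LIMSEQ_unique
      by (simp add: blinfun.scaleR_right) blast
  qed (rule f_norm)
  then have app: "Blinfun f x = f x" for x by (simp add: bounded_linear_Blinfun_apply)
  have c: "c \<ge> 0" using bound[of 0] norm_ge_zero order_trans by blast
  show thesis
  proof (rule that[of "Blinfun f"])
    show "Blinfun f \<in> M" by (rule limit_closed[of X]) (auto simp: app f X)
    show "norm (Blinfun f) \<le> c"
      by (rule norm_blinfun_bound[OF c]) (metis app f_norm mult.commute)
  qed (simp add: app f)
qed

end

lemma strong_limit_apply:
  fixes X :: "nat \<Rightarrow> ('h::complex_hilbert \<Rightarrow>\<^sub>L 'h)"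
  assumes X: "\<And>x. (\<lambda>n. X n x) \<longlonglongrightarrow> A x" and bound: "\<And>n. norm (X n) \<le> c"
    and y: "y \<longlonglongrightarrow> z"
  shows "(\<lambda>n. X n (y n)) \<longlonglongrightarrow> A z"
proof -
  have "(\<lambda>n. X n (y n - z)) \<longlonglongrightarrow> 0"
  proof (rule Lim_null_comparison)
    show "\<forall>\<^sub>F n in sequentially. norm (X n (y n - z)) \<le> c * norm (y n - z)"
      by (intro always_eventually allI order_trans[OF norm_blinfun] mult_right_mono bound) simp
    show "(\<lambda>n. c * norm (y n - z)) \<longlonglongrightarrow> 0"
      using y by (auto intro!: tendsto_eq_intros simp: LIM_zero)
  qed
  from tendsto_add[OF this X[of z]] show ?thesis
    by (simp add: blinfun.diff_right)
qed

section \<open>Spectral projections\<close>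

text \<open>
  Both the sign iteration below and increasing sequences of projections converge strongly for this reason:
  the squared norms increase and control the squared distances.
\<close>

lemma Cauchy_increasing_norms:
  fixes f :: "nat \<Rightarrow> 'a::real_normed_vector"
  assumes diff: "\<And>m n. n \<le> m \<Longrightarrow> (norm (f m - f n))\<^sup>2 \<le> (norm (f m))\<^sup>2 - (norm (f n))\<^sup>2"
    and bound: "\<And>n. norm (f n) \<le> c"
  shows "Cauchy f"
proof (rule metric_CauchyI)
  fix e :: real assume "0 < e"
  have "incseq (\<lambda>n. (norm (f n))\<^sup>2)"
    unfolding incseq_def
  proof (intro allI impI)
    fix n m :: nat assume "n \<le> m"
    from diff[OF this] zero_le_power2[of "norm (f m - f n)"]
    show "(norm (f n))\<^sup>2 \<le> (norm (f m))\<^sup>2" by linarith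
  qed
  then have "convergent (\<lambda>n. (norm (f n))\<^sup>2)"
    using incseq_convergent[of "\<lambda>n. (norm (f n))\<^sup>2" "c\<^sup>2"] power_mono[OF bound norm_ge_zero, of _ 2]
    unfolding convergent_def by blast
  then have "Cauchy (\<lambda>n. (norm (f n))\<^sup>2)"
    by (rule convergent_Cauchy)
  then obtain N where N: "\<And>m n. m \<ge> N \<Longrightarrow> n \<ge> N \<Longrightarrow>
      dist ((norm (f m))\<^sup>2) ((norm (f n))\<^sup>2) < e\<^sup>2"
    using metric_CauchyD[of _ "e\<^sup>2"] \<open>0 < e\<close> by (metis zero_less_power)
  have le: "dist (f m) (f n) < e" if "m \<ge> N" "n \<ge> N" "n \<le> m" for m n
  proof -
    have "(norm (f m - f n))\<^sup>2 < e\<^sup>2"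
      using diff[OF that(3)] N[OF that(1,2)] by (simp add: dist_real_def)
    then show ?thesis
      using \<open>0 < e\<close> by (simp add: dist_norm power2_less_imp_less)
  qed
  have "dist (f m) (f n) < e" if "m \<ge> N" "n \<ge> N" for m n
    using le[OF that] le[OF that(2,1)] nle_le[of m n] by (auto simp: dist_commute)
  then show "\<exists>N. \<forall>m\<ge>N. \<forall>n\<ge>N. dist (f m) (f n) < e" by blast
qed

text \<open>
  The polynomials in \<open>W\<close> with nonnegative coefficients.  They are closed under products and positive when
  \<open>W\<close> is, which avoids the general fact that commuting positive operators have a positive product.
\<close>

inductive_set polynomial_cone :: "('h::complex_hilbert \<Rightarrow>\<^sub>L 'h) \<Rightarrow> ('h \<Rightarrow>\<^sub>L 'h) set" for W where
  pow: "op_pow W n \<in> polynomial_cone W"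
| add: "A \<in> polynomial_cone W \<Longrightarrow> B \<in> polynomial_cone W \<Longrightarrow> A + B \<in> polynomial_cone W"
| scale: "A \<in> polynomial_cone W \<Longrightarrow> 0 \<le> r \<Longrightarrow> r *\<^sub>R A \<in> polynomial_cone W"

lemma polynomial_cone_id: "id_blinfun \<in> polynomial_cone W"
  using polynomial_cone.pow[of W 0] by simp

lemma polynomial_cone_self: "W \<in> polynomial_cone W"
  using polynomial_cone.pow[of W 1] by simp

lemma polynomial_cone_commute:
  "A \<in> polynomial_cone W \<Longrightarrow> B \<cdot> W = W \<cdot> B \<Longrightarrow> B \<cdot> A = A \<cdot> B"
  by (induction rule: polynomial_cone.induct) (auto simp: op_simps op_pow_commute)

lemma polynomial_cone_compose:
  assumes "A \<in> polynomial_cone W" "B \<in> polynomial_cone W"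
  shows "A \<cdot> B \<in> polynomial_cone W"
  using assms
proof (induction arbitrary: B rule: polynomial_cone.induct)
  case (pow n)
  from pow show ?case
    by (induction rule: polynomial_cone.induct)
       (auto simp: op_simps op_pow_add[symmetric] intro: polynomial_cone.intros)
qed (auto simp: op_simps intro: polynomial_cone.intros)

text \<open>
  Even powers are squares, and odd powers are \<open>W\<close> conjugated by a power of \<open>W\<close>.
\<close>

lemma pow_positive:
  assumes W: "is_adjoint W W" "\<And>x. 0 \<le> inner (W x) x"
  shows "0 \<le> inner (op_pow W n x) x"
proof (induction n arbitrary: x rule: induct_nat_012)
  case (ge2 n)
  have "inner (op_pow W (Suc (Suc n)) x) x = inner (op_pow W n (W x)) (W x)"
  proof -
    have "op_pow W (Suc (Suc n)) = W \<cdot> (op_pow W n \<cdot> W)"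
      using op_pow_commute[of W W n] by (simp add: op_assoc)
    then show ?thesis using is_adjoint_inner[OF W(1)] by simp
  qed
  then show ?case using ge2 by simp
qed (use W in auto)

lemma polynomial_cone_positive:
  assumes "A \<in> polynomial_cone W" "is_adjoint W W" "\<And>x. 0 \<le> inner (W x) x"
  shows "0 \<le> inner (A x) x"
  using assms(1) by (induction rule: polynomial_cone.induct)
    (auto simp: op_inner_simps pow_positive[OF assms(2,3)])

text \<open>
  The Newton--Schulz iteration \<open>a \<mapsto> a (3 - a^2) / 2\<close>.  On \<open>[-1, 1]\<close> it preserves signs, increases \<open>a^2\<close>, and
  has the fixed points \<open>-1, 0, 1\<close>; its limit is the sign of the starting operator.
\<close>

primrec sign_iterate :: "('h::complex_hilbert \<Rightarrow>\<^sub>L 'h) \<Rightarrow> nat \<Rightarrow> ('h \<Rightarrow>\<^sub>L 'h)" where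
  "sign_iterate A 0 = A"
| "sign_iterate A (Suc n) = (1/2) *\<^sub>R (3 *\<^sub>R sign_iterate A n
     - sign_iterate A n \<cdot> sign_iterate A n \<cdot> sign_iterate A n)"

lemma sign_iterate_adjoint:
  "is_adjoint A A \<Longrightarrow> is_adjoint (sign_iterate A n) (sign_iterate A n)"
proof (induction n)
  case (Suc n)
  let ?S = "sign_iterate A n"
  have "is_adjoint (?S \<cdot> ?S \<cdot> ?S) (?S \<cdot> (?S \<cdot> ?S))"
    using Suc by (intro is_adjoint_intros) auto
  then show ?case using Suc by (auto simp: op_assoc intro!: is_adjoint_intros)
qed simp

lemma sign_iterate_commute: "B \<cdot> A = A \<cdot> B \<Longrightarrow> B \<cdot> sign_iterate A n = sign_iterate A n \<cdot> B"
proof (induction n)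
  case (Suc n)
  let ?S = "sign_iterate A n"
  have BS: "B (?S x) = ?S (B x)" for x
    using Suc.IH[OF Suc.prems] by (metis blinfun_apply_blinfun_compose)
  show ?case
    by (rule blinfun_eqI) (simp add: BS blinfun.bilinear_simps)
qed simp

text \<open>
  With \<open>w = 1 - a^2\<close> one step of the iteration sends \<open>w\<close> to \<open>w^2 (3 + w) / 4\<close>, whose coefficients are
  nonnegative.
\<close>

lemma sign_iterate_defect:
  "id_blinfun - sign_iterate A n \<cdot> sign_iterate A n \<in> polynomial_cone (id_blinfun - A \<cdot> A)"
proof (induction n)
  case (Suc n)
  define S where "S = sign_iterate A n"
  define W where "W = id_blinfun - S \<cdot> S"
  have W: "W \<in> polynomial_cone (id_blinfun - A \<cdot> A)"
    using Suc by (simp add: W_def S_def)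
  have "id_blinfun - sign_iterate A (Suc n) \<cdot> sign_iterate A (Suc n)
      = (1/4) *\<^sub>R (W \<cdot> W \<cdot> (3 *\<^sub>R id_blinfun + W))"
    by (rule op_eq_innerI) (simp add: W_def S_def[symmetric] op_inner_simps; argo)
  moreover have "\<dots> \<in> polynomial_cone (id_blinfun - A \<cdot> A)"
    by (intro polynomial_cone.scale polynomial_cone_compose polynomial_cone.add W
        polynomial_cone_id) auto
  ultimately show ?case by simp
qed (use polynomial_cone_self in auto)

text \<open>
  The step factor \<open>(3 - a^2) / 2\<close> equals \<open>1 + w / 2\<close>, so later iterates arise from earlier ones by
  multiplication with factors at least \<open>1\<close>.
\<close>

lemma sign_iterate_factor:
  assumes "n \<le> m"
  shows "\<exists>D\<in>polynomial_cone (id_blinfun - A \<cdot> A).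
    sign_iterate A m = sign_iterate A n \<cdot> (id_blinfun + D)"
  using assms
proof (induction rule: dec_induct)
  case base
  have "0 \<in> polynomial_cone (id_blinfun - A \<cdot> A)"
    using polynomial_cone.scale[OF polynomial_cone_id, of 0] by simp
  then show ?case by (intro bexI[of _ 0]) auto
next
  case (step m)
  then obtain D where D: "D \<in> polynomial_cone (id_blinfun - A \<cdot> A)"
    "sign_iterate A m = sign_iterate A n \<cdot> (id_blinfun + D)" by blast
  define C where "C = (1/2) *\<^sub>R (id_blinfun - sign_iterate A m \<cdot> sign_iterate A m)"
  have C: "C \<in> polynomial_cone (id_blinfun - A \<cdot> A)"
    unfolding C_def by (intro polynomial_cone.scale sign_iterate_defect) simp
  have "sign_iterate A (Suc m) = sign_iterate A m \<cdot> (id_blinfun + C)"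
    by (rule op_eq_innerI) (simp add: C_def op_inner_simps; argo)
  also have "\<dots> = sign_iterate A n \<cdot> (id_blinfun + (D + C + D \<cdot> C))"
    by (simp only: D(2)) (simp add: op_simps)
  finally show ?case
    using D(1) C by (blast intro: polynomial_cone.add polynomial_cone_compose)
qed

lemma polynomial_cone_shift:
  assumes "is_adjoint S S" "S \<cdot> A = A \<cdot> S" "D \<in> polynomial_cone (id_blinfun - A \<cdot> A)"
  shows "inner (S (S (D x))) x = inner (D (S x)) (S x)"
proof -
  have "S \<cdot> (A \<cdot> A) = (A \<cdot> A) \<cdot> S"
    using assms(2) by (metis op_assoc)
  then have "S \<cdot> D = D \<cdot> S"
    by (intro polynomial_cone_commute[OF assms(3)]) (simp add: op_simps)
  then have "S (D x) = D (S x)"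
    by (metis blinfun_apply_blinfun_compose)
  then show ?thesis using is_adjoint_inner[OF assms(1)] by metis
qed


text \<open>
  For \<open>n \<le> m\<close> the factorization gives \<open>S n (S m) \<ge> (S n)^2\<close>, hence
  \<open>|S m x - S n x|^2 \<le> |S m x|^2 - |S n x|^2\<close>, and the iterates converge strongly to some \<open>V\<close>.  The fixed
  point equation becomes \<open>V^3 = V\<close>, and the norms of \<open>S n x\<close> grow from \<open>|A x|\<close> to \<open>|V x|\<close>, so that \<open>V\<close> vanishes
  only where \<open>A\<close> does.
\<close>

lemma (in star_algebra) sign_operator:
  assumes A: "A \<in> M" "is_adjoint A A" "norm A \<le> 1"
  obtains V where "V \<in> M" "is_adjoint V V" "V \<cdot> V \<cdot> V = V"
    "\<And>B. B \<cdot> A = A \<cdot> B \<Longrightarrow> B \<cdot> V = V \<cdot> B"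
    "\<And>x. 0 \<le> inner (A (V x)) x" "\<And>x. V x = 0 \<Longrightarrow> A x = 0"
proof -
  define S where "S = sign_iterate A"
  let ?K = "polynomial_cone (id_blinfun - A \<cdot> A)"
  have S_M: "S n \<in> M" for n
    unfolding S_def by (induction n) (auto intro!: closed_intros A(1))
  have S_Suc: "S (Suc n) x = (1/2) *\<^sub>R (3 *\<^sub>R S n x - S n (S n (S n x)))" for n x
    by (simp add: S_def blinfun.bilinear_simps)
  have S_adj: "is_adjoint (S n) (S n)" for n
    unfolding S_def by (rule sign_iterate_adjoint[OF A(2)])
  have S_comm: "S n \<cdot> A = A \<cdot> S n" for n
    using sign_iterate_commute[of A A n] by (simp add: S_def)
  have K_pos: "0 \<le> inner (D x) x" if "D \<in> ?K" for D x
  proof (rule polynomial_cone_positive[OF that])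
    show "is_adjoint (id_blinfun - A \<cdot> A) (id_blinfun - A \<cdot> A)"
      by (intro is_adjoint_intros A)
    fix x
    have "norm (A x) \<le> norm x"
      using order_trans[OF norm_blinfun mult_right_mono[OF A(3)]] by simp
    then show "0 \<le> inner ((id_blinfun - A \<cdot> A) x) x"
      by (simp add: op_inner_simps is_adjoint_inner[OF A(2)] flip: power2_norm_eq_inner)
  qed
  have S_norm: "norm (S n x) \<le> norm x" for n x
  proof -
    have "0 \<le> inner ((id_blinfun - S n \<cdot> S n) x) x"
      using K_pos[OF sign_iterate_defect] by (simp add: S_def)
    then have "(norm (S n x))\<^sup>2 \<le> (norm x)\<^sup>2"
      by (simp add: op_inner_simps is_adjoint_inner[OF S_adj] power2_norm_eq_inner)
    then show ?thesis by simp
  qed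
  then have S_bound: "norm (S n) \<le> 1" for n
    by (intro norm_blinfun_bound) auto
  have diff_bound: "(norm (S m x - S n x))\<^sup>2 \<le> (norm (S m x))\<^sup>2 - (norm (S n x))\<^sup>2"
    if "n \<le> m" for n m x
  proof -
    obtain D where D: "D \<in> ?K" "S m = S n \<cdot> (id_blinfun + D)"
      using sign_iterate_factor[OF \<open>n \<le> m\<close>] unfolding S_def by blast
    have "inner (S n (S m x)) x = inner (S n (S n x)) x + inner (S n (S n (D x))) x"
      by (simp add: D(2) op_inner_simps)
    also have "\<dots> = (norm (S n x))\<^sup>2 + inner (D (S n x)) (S n x)"
      using polynomial_cone_shift[OF S_adj S_comm D(1)]
      by (simp add: is_adjoint_inner[OF S_adj] power2_norm_eq_inner)
    finally have "(norm (S n x))\<^sup>2 \<le> inner (S m x) (S n x)"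
      using K_pos[OF D(1)] is_adjoint_inner[OF S_adj, of n "S m x" x] by simp
    then show ?thesis
      by (simp add: power2_norm_eq_inner op_inner_simps inner_commute)
  qed
  have "Cauchy (\<lambda>n. S n x)" for x
    by (rule Cauchy_increasing_norms[OF diff_bound S_norm])
  from strong_limit[of S 1, OF S_M S_bound this]
  obtain V where V: "V \<in> M" "\<And>x. (\<lambda>n. S n x) \<longlonglongrightarrow> V x" "norm V \<le> 1" by blast
  show thesis
  proof (rule that[OF V(1)])
    show "is_adjoint V V"
    proof (rule is_adjointI_inner[OF linear[OF V(1)]])
      fix x y
      have "(\<lambda>n. inner (S n x) y) \<longlonglongrightarrow> inner (V x) y" "(\<lambda>n. inner x (S n y)) \<longlonglongrightarrow> inner x (V y)"
        by (intro tendsto_intros V(2))+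
      then show "inner (V x) y = inner x (V y)"
        using LIMSEQ_unique unfolding is_adjoint_inner[OF S_adj] by blast
    qed
    show "V \<cdot> V \<cdot> V = V"
    proof (rule blinfun_eqI)
      fix x
      have "(\<lambda>n. S (Suc n) x) \<longlonglongrightarrow> (1/2) *\<^sub>R (3 *\<^sub>R V x - V (V (V x)))"
        unfolding S_Suc by (intro tendsto_intros strong_limit_apply[OF V(2) S_bound])
      moreover have "(\<lambda>n. S (Suc n) x) \<longlonglongrightarrow> V x"
        using V(2) by (rule LIMSEQ_Suc)
      ultimately have "V x = (1/2) *\<^sub>R (3 *\<^sub>R V x - V (V (V x)))"
        by (rule LIMSEQ_unique[rotated])
      then have eq: "inner (V x) z = inner ((1/2) *\<^sub>R (3 *\<^sub>R V x - V (V (V x)))) z" for z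
        by (rule arg_cong)
      have "inner (V (V (V x))) z = inner (V x) z" for z
        using eq[of z] by (simp add: op_inner_simps)
      then show "(V \<cdot> V \<cdot> V) x = V x"
        using vector_eq_rdot[of "V (V (V x))" "V x"] by simp
    qed
    show "B \<cdot> V = V \<cdot> B" if "B \<cdot> A = A \<cdot> B" for B
    proof (rule blinfun_eqI)
      fix x
      have "(\<lambda>n. B (S n x)) \<longlonglongrightarrow> B (V x)"
        by (intro tendsto_intros V(2))
      moreover have "B (S n x) = S n (B x)" for n
        using sign_iterate_commute[OF that] unfolding S_def by (metis blinfun_apply_blinfun_compose)
      ultimately show "(B \<cdot> V) x = (V \<cdot> B) x"
        using LIMSEQ_unique[OF _ V(2)] by simp
    qed
    show "0 \<le> inner (A (V x)) x" for x
    proof (rule LIMSEQ_le_const)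
      show "(\<lambda>n. inner (A (S n x)) x) \<longlonglongrightarrow> inner (A (V x)) x"
        by (intro tendsto_intros V(2))
      have "0 \<le> inner (A (S n x)) x" for n
      proof -
        obtain D where D: "D \<in> ?K" "S n = A \<cdot> (id_blinfun + D)"
          using sign_iterate_factor[of 0 n A] unfolding S_def by auto
        have "inner (A (S n x)) x = (norm (A x))\<^sup>2 + inner (D (A x)) (A x)"
          using polynomial_cone_shift[OF A(2) refl D(1)]
          by (simp add: D(2) op_inner_simps is_adjoint_inner[OF A(2)] power2_norm_eq_inner)
        then show ?thesis using K_pos[OF D(1)] by simp
      qed
      then show "\<exists>N. \<forall>n\<ge>N. 0 \<le> inner (A (S n x)) x" by blast
    qed
    show "A x = 0" if "V x = 0" for x
    proof -
      have "(norm (S 0 x))\<^sup>2 \<le> (norm (S n x))\<^sup>2" for n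
        using diff_bound[of 0 n x] zero_le_power2[of "norm (S n x - S 0 x)"] by linarith
      then have "norm (S 0 x) \<le> norm (S n x)" for n
        by (rule power2_le_imp_le) simp
      then have "norm (A x) \<le> norm (S n x)" for n
        by (simp add: S_def)
      moreover have "(\<lambda>n. norm (S n x)) \<longlonglongrightarrow> norm (V x)"
        by (intro tendsto_intros V(2))
      ultimately have "norm (A x) \<le> norm (V x)"
        by (intro LIMSEQ_le_const) auto
      with that show ?thesis by simp
    qed
  qed
qed

text \<open>
  From the sign \<open>V\<close> of \<open>T\<close> the projection onto the eigenspace \<open>V = 1\<close> is \<open>(V^2 + V) / 2\<close>.  On its complement a
  vector splits into a part with \<open>V = -1\<close> and a part in the common kernel of \<open>V\<close> and \<open>T\<close>.
\<close>

theorem (in star_algebra) spectral_split: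
  assumes T: "T \<in> M" "is_adjoint T T"
  obtains E where "projection_in M E" "\<And>B. B \<cdot> T = T \<cdot> B \<Longrightarrow> B \<cdot> E = E \<cdot> B"
    "\<And>x. 0 \<le> inner (T (E x)) (E x)" "\<And>x. inner (T (x - E x)) (x - E x) \<le> 0"
proof -
  \<comment> \<open>The sign iteration starts from a contraction; adding \<open>1\<close> covers \<open>T = 0\<close>.\<close>
  define r where "r = 1 / (norm T + 1)"
  have p: "0 < norm T + 1"
    using norm_ge_zero[of T] by linarith
  have r: "r > 0"
    using p by (simp add: r_def)
  have "r * norm T = norm T / (norm T + 1)"
    by (simp add: r_def)
  also have "\<dots> \<le> 1"
    using p by (subst divide_le_eq_1_pos) auto
  finally have r_le: "r * norm T \<le> 1" .
  define A where "A = r *\<^sub>R T"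
  have A: "A \<in> M" "is_adjoint A A" "norm A \<le> 1"
    using r r_le by (auto simp: A_def intro: scaleR_closed T is_adjoint_scaleR)
  obtain V where V: "V \<in> M" "is_adjoint V V" "V \<cdot> V \<cdot> V = V"
    "\<And>B. B \<cdot> A = A \<cdot> B \<Longrightarrow> B \<cdot> V = V \<cdot> B"
    "\<And>x. 0 \<le> inner (A (V x)) x" "\<And>x. V x = 0 \<Longrightarrow> A x = 0"
    using sign_operator[OF A] by blast
  have V3: "V (V (V x)) = V x" for x
    using V(3) by (metis blinfun_apply_blinfun_compose)
  define E where "E = (1/2) *\<^sub>R (V \<cdot> V + V)"
  have E: "E x = (1/2) *\<^sub>R (V (V x) + V x)" for x
    by (simp add: E_def op_inner_simps)
  have VE: "V (E x) = E x" for x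
    by (simp add: E op_inner_simps V3 add.commute)
  have "E \<cdot> E = E"
    by (rule blinfun_eqI) (simp add: E[of "E _"] VE flip: scaleR_2)
  show thesis
  proof (rule that[of E])
    show "projection_in M E"
      unfolding projection_in_def using \<open>E \<cdot> E = E\<close>
      by (auto simp: E_def intro!: closed_intros V is_adjoint_intros)
    show "B \<cdot> E = E \<cdot> B" if "B \<cdot> T = T \<cdot> B" for B
    proof -
      have c: "B \<cdot> V = V \<cdot> B" using that by (intro V(4)) (simp add: A_def op_simps)
      then have "B (V x) = V (B x)" for x by (metis blinfun_apply_blinfun_compose)
      then show ?thesis
        by (intro blinfun_eqI) (simp add: E blinfun.bilinear_simps)
    qed
    show "0 \<le> inner (T (E x)) (E x)" for x
      using V(5)[of "E x"] r by (simp add: VE A_def op_inner_simps zero_le_mult_iff)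
    show "inner (T (x - E x)) (x - E x) \<le> 0" for x
    proof -
      define e z where "e = (1/2) *\<^sub>R (V (V x) - V x)" and "z = x - V (V x)"
      have x: "x - E x = e + z"
        by (rule vector_eq_rdot[THEN iffD1], rule allI) (simp add: e_def z_def E op_inner_simps; argo)
      have "V z = 0" "V e = - e"
        by (simp_all add: z_def e_def op_inner_simps V3 algebra_simps)
      then have Az: "A z = 0" using V(6) by blast
      have "inner (A (e + z)) (e + z) = inner (A e) e"
        using is_adjoint_inner[OF A(2), of e z] by (simp add: op_inner_simps Az)
      also have "\<dots> \<le> 0"
        using V(5)[of e] by (simp add: \<open>V e = - e\<close> op_inner_simps)
      finally have "r * inner (T (e + z)) (e + z) \<le> 0"
        by (simp add: A_def blinfun.scaleR_left)
      then show ?thesis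
        using r unfolding x by (simp only: mult_le_0_iff) auto
    qed
  qed
qed

section \<open>Projections and minimal projections\<close>

lemma adjoint_square: "is_adjoint w w' \<Longrightarrow> inner ((w' \<cdot> w) x) x = (norm (w x))\<^sup>2"
  using is_adjoint_inner[OF is_adjoint_sym, of w w' "w x" x] by (simp add: power2_norm_eq_inner)

lemma adjoint_square_eq_0: "is_adjoint w w' \<Longrightarrow> w' \<cdot> w = 0 \<Longrightarrow> w = 0"
  using adjoint_square[of w w'] by (auto intro: blinfun_eqI)

context star_algebra begin

lemma projectionD:
  assumes "projection_in M E"
  shows "E \<in> M" "is_adjoint E E" "E \<cdot> E = E" "E \<cdot> (E \<cdot> A) = E \<cdot> A" "E (E x) = E x"
    "inner (E x) x = (norm (E x))\<^sup>2"
proof -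
  show *: "E \<in> M" "is_adjoint E E" "E \<cdot> E = E"
    using assms by (auto simp: projection_in_def)
  then show "E \<cdot> (E \<cdot> A) = E \<cdot> A" "E (E x) = E x"
    by (metis op_assoc) (metis * blinfun_apply_blinfun_compose)
  then show "inner (E x) x = (norm (E x))\<^sup>2"
    using is_adjoint_inner[OF *(2)] by (metis power2_norm_eq_inner)
qed

lemma projection_id [simp]: "projection_in M id_blinfun"
  by (simp add: projection_in_def)

lemma projection_0 [simp]: "projection_in M 0"
  by (simp add: projection_in_def)

lemma compose_adjoint_eq:
  assumes "is_adjoint A A" "is_adjoint B B" "is_adjoint C C" "A \<cdot> B = C"
  shows "B \<cdot> A = C"
  using assms is_adjoint_compose[of A A B B] is_adjoint_unique by metis

lemma projection_sub_commute:
  assumes "projection_in M E" "projection_in M F"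
  shows "E \<cdot> F = F \<Longrightarrow> F \<cdot> E = F" "F \<cdot> E = F \<Longrightarrow> E \<cdot> F = F"
    "E \<cdot> F = 0 \<Longrightarrow> F \<cdot> E = 0"
  using assms by (auto intro: compose_adjoint_eq simp: projection_in_def)

lemma op_le_projection_iff:
  assumes E: "projection_in M E" and F: "projection_in M F"
  shows "op_le F E \<longleftrightarrow> E \<cdot> F = F"
proof -
  have adj: "is_adjoint (E - F) (E - F)"
    using E F by (auto simp: projection_in_def intro: is_adjoint_diff)
  show ?thesis
  proof
    assume "op_le F E"
    then have le: "inner (F x) x \<le> inner (E x) x" for x
      using adj by (simp add: op_le_def positive_op_iff blinfun.diff_left inner_diff_left)
    have "F (x - E x) = 0" for x
    proof -
      have "E (x - E x) = 0" by (simp add: blinfun.diff_right projectionD(5)[OF E])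
      then show ?thesis
        using le[of "x - E x"] projectionD(6)[OF F, of "x - E x"] by simp
    qed
    then have "F \<cdot> E = F"
      by (intro blinfun_eqI) (simp add: blinfun.diff_right)
    then show "E \<cdot> F = F" using projection_sub_commute[OF E F] by blast
  next
    assume EF: "E \<cdot> F = F"
    then have FE: "F \<cdot> E = F" using projection_sub_commute[OF E F] by blast
    have sq: "(E - F) \<cdot> (E - F) = E - F"
      by (simp add: op_simps EF FE projectionD(3)[OF E] projectionD(3)[OF F])
    have "0 \<le> inner ((E - F) x) x" for x
      using adjoint_square[OF adj, of x] unfolding sq by (metis zero_le_power2)
    then show "op_le F E" unfolding op_le_def positive_op_iff[OF adj] by blast
  qed
qed

lemma projection_diff:
  assumes "projection_in M E" "projection_in M F" "E \<cdot> F = F"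
  shows "projection_in M (E - F)"
  using projectionD[OF assms(1)] projectionD[OF assms(2)]
    projection_sub_commute(1)[OF assms] assms(3) unfolding projection_in_def
  by (auto simp: op_simps intro: diff_closed is_adjoint_diff)

lemma projection_add:
  assumes "projection_in M E" "projection_in M F" "E \<cdot> F = 0"
  shows "projection_in M (E + F)"
  using projectionD[OF assms(1)] projectionD[OF assms(2)]
    projection_sub_commute(3)[OF assms] assms(3) unfolding projection_in_def
  by (auto simp: op_simps intro: add_closed is_adjoint_add)

lemma projection_compose:
  assumes "projection_in M E" "projection_in M F" "E \<cdot> F = F \<cdot> E"
  shows "projection_in M (E \<cdot> F)"
proof -
  have "(E \<cdot> F) \<cdot> (E \<cdot> F) = E \<cdot> (F \<cdot> E) \<cdot> F" by (simp only: op_assoc)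
  also have "\<dots> = E \<cdot> (E \<cdot> F) \<cdot> F" by (simp only: assms(3))
  also have "\<dots> = E \<cdot> F"
    by (simp only: op_assoc projectionD(3,4)[OF assms(1)] projectionD(3,4)[OF assms(2)])
  finally have "(E \<cdot> F) \<cdot> (E \<cdot> F) = E \<cdot> F" .
  moreover have "is_adjoint (E \<cdot> F) (E \<cdot> F)"
    using is_adjoint_compose[OF projectionD(2)[OF assms(1)] projectionD(2)[OF assms(2)]]
    by (simp only: assms(3))
  ultimately show ?thesis
    using compose_closed[OF projectionD(1)[OF assms(1)] projectionD(1)[OF assms(2)]]
    by (simp add: projection_in_def)
qed

lemma minimal_projectionD:
  assumes "minimal_projection M E"
  shows "projection_in M E" "E \<noteq> 0"
    "\<And>F. projection_in M F \<Longrightarrow> E \<cdot> F = F \<Longrightarrow> F = 0 \<or> F = E"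
  using assms op_le_projection_iff unfolding minimal_projection_def by blast+

text \<open>
  A spectral projection of the compression \<open>E A E\<close> at any level \<open>l\<close> commutes with \<open>E\<close>, so by minimality it
  contains \<open>E\<close> or is orthogonal to it: the quadratic form of \<open>A\<close> on the range of \<open>E\<close> is on one side of every \<open>l\<close>,
  hence constant.
\<close>

lemma minimal_compress_selfadjoint:
  assumes E: "minimal_projection M E" and A: "A \<in> M" "is_adjoint A A"
  shows "\<exists>r. E \<cdot> A \<cdot> E = r *\<^sub>R E"
proof -
  note EP = projectionD[OF minimal_projectionD(1)[OF E]]
  define T where "T = E \<cdot> A \<cdot> E"
  have T: "T \<in> M" unfolding T_def by (intro closed_intros A EP)
  have T_adj: "is_adjoint T T"
    using is_adjoint_compose[OF is_adjoint_compose[OF EP(2) A(2)] EP(2)] by (simp add: T_def op_assoc)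
  have TE: "T \<cdot> E = T" "E \<cdot> T = T" by (simp_all add: T_def op_assoc EP)
  have dich: "(\<forall>x. l * (norm (E x))\<^sup>2 \<le> inner (T (E x)) (E x)) \<or>
      (\<forall>x. inner (T (E x)) (E x) \<le> l * (norm (E x))\<^sup>2)" for l
  proof -
    define R where "R = T - l *\<^sub>R id_blinfun"
    have "R \<in> M" "is_adjoint R R"
      unfolding R_def by (intro closed_intros T is_adjoint_intros T_adj)+
    from spectral_split[OF this] obtain G where G: "projection_in M G"
      "\<And>B. B \<cdot> R = R \<cdot> B \<Longrightarrow> B \<cdot> G = G \<cdot> B"
      "\<And>x. 0 \<le> inner (R (G x)) (G x)" "\<And>x. inner (R (x - G x)) (x - G x) \<le> 0" by metis
    have EG: "E \<cdot> G = G \<cdot> E"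
      by (rule G(2)) (simp add: R_def op_simps TE)
    have "E \<cdot> G = 0 \<or> E \<cdot> G = E"
      by (intro minimal_projectionD(3)[OF E] projection_compose[OF minimal_projectionD(1)[OF E] G(1) EG])
         (simp add: EP)
    then show ?thesis
    proof
      assume "E \<cdot> G = 0"
      then have "G (E x) = 0" for x by (metis EG blinfun_apply_blinfun_compose blinfun.zero_left)
      then show ?thesis
        using G(4)[of "E _"] by (simp add: R_def blinfun.bilinear_simps inner_diff_left power2_norm_eq_inner)
    next
      assume "E \<cdot> G = E"
      then have "G (E x) = E x" for x by (metis EG blinfun_apply_blinfun_compose)
      then show ?thesis
        using G(3)[of "E _"] by (simp add: R_def blinfun.bilinear_simps inner_diff_left power2_norm_eq_inner)
    qed
  qed
  obtain x0 where x0: "E x0 \<noteq> 0"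
    using minimal_projectionD(2)[OF E] by (metis blinfun_eqI blinfun.zero_left)
  \<comment> \<open>The Rayleigh quotients of \<open>T\<close> on the range of \<open>E\<close>; two different values would straddle their mean.\<close>
  define q where "q x = inner (T (E x)) (E x) / (norm (E x))\<^sup>2" for x
  have q: "inner (T (E x)) (E x) = q x * (norm (E x))\<^sup>2" for x
    by (simp add: q_def)
  have const: "q x = q y" if "E x \<noteq> 0" "E y \<noteq> 0" for x y
  proof (rule ccontr)
    assume "q x \<noteq> q y"
    define l where "l = (q x + q y) / 2"
    have "(l \<le> q x \<and> l \<le> q y) \<or> (q x \<le> l \<and> q y \<le> l)"
      using dich[of l] that unfolding q by (auto simp: mult_le_cancel_right)
    with \<open>q x \<noteq> q y\<close> show False by (auto simp: l_def field_simps)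
  qed
  define r where "r = q x0"
  have form: "inner (T x) x = r * (norm (E x))\<^sup>2" for x
  proof -
    have "inner (T x) x = inner (T (E x)) (E x)"
      using is_adjoint_inner[OF EP(2), of "T (E x)" x] TE by (metis blinfun_apply_blinfun_compose)
    then show ?thesis
      using const[of x x0] x0 q[of x] by (cases "E x = 0") (auto simp: r_def)
  qed
  have "norm (T - r *\<^sub>R E) \<le> 0"
  proof (rule norm_selfadjoint_le)
    show "is_adjoint (T - r *\<^sub>R E) (T - r *\<^sub>R E)"
      by (intro is_adjoint_intros T_adj EP)
    show "\<bar>inner ((T - r *\<^sub>R E) x) x\<bar> \<le> 0 * (norm x)\<^sup>2" for x
      by (simp add: blinfun.bilinear_simps inner_diff_left form EP(6))
  qed simp
  then have "T = r *\<^sub>R E" by simp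
  then show ?thesis by (auto simp: T_def)
qed

lemma cartesian_decomposition:
  assumes "A \<in> M"
  obtains H K where "H \<in> M" "K \<in> M" "is_adjoint H H" "is_adjoint K K" "A = H + op_scaleC \<i> K"
proof -
  obtain B where B: "B \<in> M" "is_adjoint A B" using adjoint_exists[OF assms] by blast
  note B' = is_adjoint_sym[OF B(2)]
  define H where "H = op_scaleC (1/2) (A + B)"
  define K where "K = op_scaleC (\<i>/2) (B - A)"
  show thesis
  proof (rule that[of H K])
    show "H \<in> M" "K \<in> M" unfolding H_def K_def by (intro closed_intros assms B)+
    show "is_adjoint H H"
      using is_adjoint_scaleC[OF is_adjoint_add[OF B(2) B'], of "1/2"] by (simp add: H_def add.commute)
    have "op_scaleC (cnj (\<i>/2)) (A - B) = K"
      by (simp add: K_def op_scaleC_minus op_scaleC_simps)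
    then show "is_adjoint K K"
      using is_adjoint_scaleC[OF is_adjoint_diff[OF B' B(2)], of "\<i>/2"] by (simp add: K_def)
    have "\<i> * (\<i> / 2) = - (1 / 2)" by simp
    then have "H + op_scaleC \<i> K = op_scaleC (1/2) A + op_scaleC (1/2) A"
      unfolding H_def K_def op_scaleC_simps by (simp only: op_scaleC_minus) simp
    also have "\<dots> = op_scaleC (1/2 + 1/2) A" by (rule op_scaleC_simps(6)[symmetric])
    finally show "A = H + op_scaleC \<i> K" by (simp add: op_scaleC_simps)
  qed
qed

lemma minimal_compress:
  assumes E: "minimal_projection M E" and A: "A \<in> M"
  obtains c where "E \<cdot> A \<cdot> E = op_scaleC c E"
proof -
  obtain H K where HK: "H \<in> M" "K \<in> M" "is_adjoint H H" "is_adjoint K K" "A = H + op_scaleC \<i> K"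
    using cartesian_decomposition[OF A] by blast
  obtain r s where "E \<cdot> H \<cdot> E = r *\<^sub>R E" "E \<cdot> K \<cdot> E = s *\<^sub>R E"
    using minimal_compress_selfadjoint[OF E] HK by metis
  moreover have "complex_linear E"
    using minimal_projectionD(1)[OF E] linear by (auto simp: projection_in_def)
  ultimately have "E \<cdot> A \<cdot> E = op_scaleC (complex_of_real r + \<i> * complex_of_real s) E"
    by (simp add: HK(5) op_simps op_scaleC_simps op_scaleC_right op_scaleC_of_real[symmetric])
  then show thesis by (rule that)
qed

end

section \<open>Faithful traces\<close>

text \<open>
  Normality is a separate hypothesis where it is used: it gives the traces of limits of increasing
  sequences of projections in the diffuse case.
\<close>

locale tracial_algebra = star_algebra M for M :: "('h::complex_hilbert \<Rightarrow>\<^sub>L 'h) set" +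
  fixes \<tau> :: "('h \<Rightarrow>\<^sub>L 'h) \<Rightarrow> complex"
  assumes trace_add: "A \<in> M \<Longrightarrow> B \<in> M \<Longrightarrow> \<tau> (A + B) = \<tau> A + \<tau> B"
    and trace_scaleC: "A \<in> M \<Longrightarrow> \<tau> (op_scaleC c A) = c * \<tau> A"
    and trace_positive: "A \<in> M \<Longrightarrow> positive_op A \<Longrightarrow> 0 \<le> \<tau> A"
    and trace_id: "\<tau> id_blinfun = 1"
    and trace_commute: "A \<in> M \<Longrightarrow> B \<in> M \<Longrightarrow> \<tau> (A \<cdot> B) = \<tau> (B \<cdot> A)"
    and trace_faithful: "A \<in> M \<Longrightarrow> positive_op A \<Longrightarrow> \<tau> A = 0 \<Longrightarrow> A = 0"
begin

lemma trace_scaleR: "A \<in> M \<Longrightarrow> \<tau> (r *\<^sub>R A) = of_real r * \<tau> A"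
  using trace_scaleC[of A "of_real r"] by (simp add: op_scaleC_of_real)

lemma trace_0 [simp]: "\<tau> 0 = 0"
  using trace_scaleR[OF id_closed, of 0] by simp

lemma trace_diff: "A \<in> M \<Longrightarrow> B \<in> M \<Longrightarrow> \<tau> (A - B) = \<tau> A - \<tau> B"
  using trace_add[of A "(-1) *\<^sub>R B"] scaleR_closed[of B "-1"] trace_scaleR[of B "-1"] by simp

lemma trace_sum: "(\<And>i. i \<in> I \<Longrightarrow> A i \<in> M) \<Longrightarrow> \<tau> (\<Sum>i\<in>I. A i) = (\<Sum>i\<in>I. \<tau> (A i))"
  by (induction I rule: infinite_finite_induct) (auto simp: trace_add sum_closed)

definition tr :: "('h \<Rightarrow>\<^sub>L 'h) \<Rightarrow> real" where "tr A = Re (\<tau> A)"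

lemma tr_simps:
  "A \<in> M \<Longrightarrow> B \<in> M \<Longrightarrow> tr (A + B) = tr A + tr B"
  "A \<in> M \<Longrightarrow> B \<in> M \<Longrightarrow> tr (A - B) = tr A - tr B"
  "A \<in> M \<Longrightarrow> tr (r *\<^sub>R A) = r * tr A"
  "tr 0 = 0" "tr id_blinfun = 1"
  by (simp_all add: tr_def trace_add trace_diff trace_scaleR trace_id)

lemma tr_sum: "(\<And>i. i \<in> I \<Longrightarrow> A i \<in> M) \<Longrightarrow> tr (\<Sum>i\<in>I. A i) = (\<Sum>i\<in>I. tr (A i))"
  by (simp add: tr_def trace_sum)

lemma trace_nonneg_form:
  assumes "A \<in> M" "is_adjoint A A" "\<And>x. 0 \<le> inner (A x) x"
  shows "\<tau> A = of_real (tr A)" "0 \<le> tr A" "tr A = 0 \<Longrightarrow> A = 0"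
proof -
  have p: "positive_op A" using assms by (simp add: positive_op_iff)
  show "\<tau> A = of_real (tr A)" "0 \<le> tr A"
    using trace_positive[OF assms(1) p] by (auto simp: tr_def less_eq_complex_def complex_eq_iff)
  then show "A = 0" if "tr A = 0" using trace_faithful[OF assms(1) p] that by simp
qed

text \<open>
  Adding \<open>A\<close> to, or subtracting it from, its norm times the identity leaves a positive operator.
\<close>

lemma trace_selfadjoint:
  assumes A: "A \<in> M" "is_adjoint A A"
  shows "\<tau> A = of_real (tr A)" "\<bar>tr A\<bar> \<le> norm A"
proof -
  let ?N = "norm A *\<^sub>R id_blinfun"
  have "\<bar>inner (A x) x\<bar> \<le> norm A * inner x x" for x
    using inner_op_bound[of A x] by (simp add: power2_norm_eq_inner)
  then have "0 \<le> norm A * inner x x + inner (A x) x" "0 \<le> norm A * inner x x - inner (A x) x" for x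
    by (smt (verit))+
  then have "0 \<le> inner ((?N + A) x) x" "0 \<le> inner ((?N - A) x) x" for x
    by (simp_all add: blinfun.bilinear_simps inner_add_left inner_diff_left)
  moreover have N: "?N \<in> M" by (intro closed_intros)
  moreover have "?N + A \<in> M" "?N - A \<in> M" by (intro closed_intros A)+
  moreover have "is_adjoint (?N + A) (?N + A)" "is_adjoint (?N - A) (?N - A)"
    by (intro is_adjoint_intros A)+
  ultimately have *: "\<tau> (?N + A) = of_real (tr (?N + A))" "0 \<le> tr (?N + A)" "0 \<le> tr (?N - A)"
    using trace_nonneg_form[of "?N + A"] trace_nonneg_form[of "?N - A"] by blast+
  show "\<tau> A = of_real (tr A)"
    using *(1) N A by (simp add: trace_add tr_simps trace_scaleR trace_id)
  show "\<bar>tr A\<bar> \<le> norm A"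
    using *(2,3) N A by (simp add: tr_simps)
qed

lemma trace_projection:
  assumes "projection_in M E"
  shows "\<tau> E = of_real (tr E)" "0 \<le> tr E" "tr E = 0 \<Longrightarrow> E = 0" "tr E \<le> 1"
proof -
  note E = projectionD[OF assms]
  show "\<tau> E = of_real (tr E)" "0 \<le> tr E" "tr E = 0 \<Longrightarrow> E = 0"
    using trace_nonneg_form[OF E(1,2)] by (simp_all add: E(6))
  have "projection_in M (id_blinfun - E)" using assms by (intro projection_diff) auto
  from projectionD(1,2,6)[OF this] trace_nonneg_form(2)[of "id_blinfun - E"]
  show "tr E \<le> 1" by (simp add: tr_simps E)
qed

lemma trace_adjoint_square:
  assumes "w \<in> M" "w' \<in> M" "is_adjoint w w'"
  shows "\<tau> (w' \<cdot> w) = of_real (tr (w' \<cdot> w))" "0 \<le> tr (w' \<cdot> w)" "tr (w' \<cdot> w) = 0 \<Longrightarrow> w = 0"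
proof -
  have "is_adjoint (w' \<cdot> w) (w' \<cdot> w)"
    using assms is_adjoint_compose is_adjoint_sym by blast
  note * = trace_nonneg_form[OF compose_closed[OF assms(2,1)] this]
  show "\<tau> (w' \<cdot> w) = of_real (tr (w' \<cdot> w))" "0 \<le> tr (w' \<cdot> w)"
    using * adjoint_square[OF assms(3)] by simp_all
  show "w = 0" if "tr (w' \<cdot> w) = 0"
    using *(3)[OF _ that] adjoint_square[OF assms(3)] adjoint_square_eq_0[OF assms(3)] by simp
qed

text \<open>
  For \<open>w = E X F\<close> the operator \<open>w\<^sup>* w\<close> lies in \<open>F M F\<close> and is therefore a multiple of \<open>F\<close>, positive by
  faithfulness; rescaling makes \<open>w\<close> a partial isometry, and its range projection is nonzero below \<open>E\<close>.
\<close>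

lemma minimal_partial_isometry:
  assumes E: "minimal_projection M E" and F: "minimal_projection M F"
    and X: "X \<in> M" "E \<cdot> X \<cdot> F \<noteq> 0"
  obtains v v' where "v \<in> M" "v' \<in> M" "is_adjoint v v'" "v' \<cdot> v = F" "v \<cdot> v' = E"
    "E \<cdot> v = v" "v \<cdot> F = v"
proof -
  note EP = projectionD[OF minimal_projectionD(1)[OF E]]
  note FP = projectionD[OF minimal_projectionD(1)[OF F]]
  obtain X' where X': "X' \<in> M" "is_adjoint X X'" using adjoint_exists[OF X(1)] by blast
  define w w' where "w = E \<cdot> X \<cdot> F" and "w' = F \<cdot> X' \<cdot> E"
  have w: "w \<in> M" "w' \<in> M" unfolding w_def w'_def by (intro closed_intros EP FP X X')+
  have ww': "is_adjoint w w'"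
    using is_adjoint_compose[OF is_adjoint_compose[OF EP(2) X'(2)] FP(2)]
    by (simp add: w_def w'_def op_assoc)
  obtain c where c: "F \<cdot> (X' \<cdot> E \<cdot> X) \<cdot> F = op_scaleC c F"
    using minimal_compress[OF F, of "X' \<cdot> E \<cdot> X"] closed_intros EP(1) X(1) X'(1) by metis
  have w'w: "w' \<cdot> w = op_scaleC c F"
    unfolding c[symmetric] by (simp add: w_def w'_def op_assoc EP)
  have trF: "tr F > 0"
    using trace_projection(2,3)[OF minimal_projectionD(1)[OF F]] minimal_projectionD(2)[OF F]
    by fastforce
  define r where "r = tr (w' \<cdot> w) / tr F"
  have "r > 0"
    using trace_adjoint_square[OF w ww'] X(2) trF unfolding r_def w_def[symmetric]
    by (simp add: less_le) (metis)
  have "c * \<tau> F = of_real (tr (w' \<cdot> w))"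
    using trace_adjoint_square(1)[OF w ww'] FP(1) by (simp add: w'w trace_scaleC)
  then have cr: "c = of_real r"
    using trF trace_projection(1)[OF minimal_projectionD(1)[OF F]]
    by (simp add: r_def field_simps)
  define s where "s = 1 / sqrt r"
  have s: "s * s * r = 1" using \<open>r > 0\<close> by (simp add: s_def)
  define v v' where "v = s *\<^sub>R w" and "v' = s *\<^sub>R w'"
  have v: "v \<in> M" "v' \<in> M" unfolding v_def v'_def by (intro closed_intros w)+
  have vv': "is_adjoint v v'" unfolding v_def v'_def by (rule is_adjoint_scaleR[OF ww'])
  have v'v: "v' \<cdot> v = F"
    using s by (simp add: v_def v'_def op_simps w'w cr op_scaleC_of_real mult.assoc)
  have Ev: "E \<cdot> v = v" and vF: "v \<cdot> F = v" and v'E: "v' \<cdot> E = v'" and Fv': "F \<cdot> v' = v'"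
    by (simp_all add: v_def v'_def w_def w'_def op_simps EP FP)
  have "projection_in M (v \<cdot> v')"
    unfolding projection_in_def
  proof (intro conjI)
    have "v \<cdot> v' \<cdot> (v \<cdot> v') = v \<cdot> (v' \<cdot> v) \<cdot> v'" by (simp add: op_assoc)
    then show "v \<cdot> v' \<cdot> (v \<cdot> v') = v \<cdot> v'" by (simp add: v'v vF)
  qed (use v vv' is_adjoint_compose is_adjoint_sym compose_closed in blast)+
  moreover have "E \<cdot> (v \<cdot> v') = v \<cdot> v'" by (simp add: op_assoc[symmetric] Ev)
  moreover have "v \<cdot> v' \<noteq> 0"
  proof
    assume "v \<cdot> v' = 0"
    then have "v' \<cdot> (v \<cdot> v') \<cdot> v = 0" by simp
    then have "(v' \<cdot> v) \<cdot> (v' \<cdot> v) = 0" by (simp add: op_assoc)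
    then show False using FP(3) minimal_projectionD(2)[OF F] by (simp add: v'v)
  qed
  ultimately have "v \<cdot> v' = E" using minimal_projectionD(3)[OF E] by blast
  then show thesis using that v vv' v'v Ev vF by blast
qed

lemma minimal_trace_eq:
  assumes "minimal_projection M E" "minimal_projection M F" "X \<in> M" "E \<cdot> X \<cdot> F \<noteq> 0"
  shows "\<tau> E = \<tau> F"
  using minimal_partial_isometry[OF assms] trace_commute by metis

text \<open>
  If \<open>v\<close> is a partial isometry from \<open>F\<close> to \<open>E\<close>, then \<open>E Y F = (E Y v\<^sup>* E) v\<close> is a scalar multiple of \<open>v\<close>.
\<close>

lemma minimal_corner:
  assumes E: "minimal_projection M E" and F: "minimal_projection M F"
  shows "\<exists>b\<in>M. \<forall>Y\<in>M. \<exists>c. E \<cdot> Y \<cdot> F = op_scaleC c b"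
proof (cases "\<exists>X\<in>M. E \<cdot> X \<cdot> F \<noteq> 0")
  case True
  then obtain X where X: "X \<in> M" "E \<cdot> X \<cdot> F \<noteq> 0" by blast
  obtain v v' where v: "v \<in> M" "v' \<in> M" "v' \<cdot> v = F" "E \<cdot> v = v"
    using minimal_partial_isometry[OF E F X] by metis
  show ?thesis
  proof (intro bexI[OF _ v(1)] ballI)
    fix Y assume Y: "Y \<in> M"
    have "Y \<cdot> F \<cdot> v' \<in> M"
      using Y v minimal_projectionD(1)[OF F] by (intro closed_intros) (auto simp: projection_in_def)
    from minimal_compress[OF E this] obtain c where c: "E \<cdot> (Y \<cdot> F \<cdot> v') \<cdot> E = op_scaleC c E" .
    have "E \<cdot> Y \<cdot> F = E \<cdot> Y \<cdot> F \<cdot> (v' \<cdot> v)"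
      using projectionD(3)[OF minimal_projectionD(1)[OF F]] by (simp add: v(3) op_assoc)
    also have "\<dots> = (E \<cdot> (Y \<cdot> F \<cdot> v') \<cdot> E) \<cdot> v"
      by (simp add: op_assoc v(4))
    also have "\<dots> = op_scaleC c v"
      by (simp add: c op_scaleC_simps v(4))
    finally show "\<exists>c. E \<cdot> Y \<cdot> F = op_scaleC c v" by blast
  qed
qed (auto intro!: bexI[of _ 0] simp: op_scaleC_simps)

end

section \<open>Orthogonal families of projections and finite dimension\<close>

lemma op_scaleC_sum_image:
  assumes "finite I"
  shows "(\<Sum>p\<in>I. op_scaleC (c p) (b p))
    = (\<Sum>y\<in>b ` I. op_scaleC (\<Sum>p\<in>{p\<in>I. b p = y}. c p) y)"
  by (subst sum.image_gen[OF assms, of _ b]) (auto simp: op_scaleC_sum_left intro!: sum.cong)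

context star_algebra begin

definition orthogonal_projections :: "('h \<Rightarrow>\<^sub>L 'h) set \<Rightarrow> bool" where
  "orthogonal_projections P \<longleftrightarrow> finite P \<and> (\<forall>E\<in>P. projection_in M E \<and> E \<noteq> 0) \<and>
     (\<forall>E\<in>P. \<forall>F\<in>P. E \<noteq> F \<longrightarrow> E \<cdot> F = 0)"

lemma orthogonal_projections_sum:
  assumes "orthogonal_projections P"
  shows "E \<in> P \<Longrightarrow> \<Sum>P \<cdot> E = E" "projection_in M (\<Sum>P)"
proof -
  have *: "\<Sum>P \<cdot> E = E" if "E \<in> P" for E
  proof -
    have "\<Sum>P \<cdot> E = (\<Sum>F\<in>P. if F = E then E else 0)"
      unfolding op_sum_left using assms that
      by (intro sum.cong) (auto simp: orthogonal_projections_def projection_in_def)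
    also have "\<dots> = E" using assms that by (simp add: orthogonal_projections_def)
    finally show ?thesis .
  qed
  then show "E \<in> P \<Longrightarrow> \<Sum>P \<cdot> E = E" .
  have "\<Sum>P \<cdot> \<Sum>P = \<Sum>P"
    by (subst op_sum_right) (simp add: *)
  then show "projection_in M (\<Sum>P)"
    using assms unfolding projection_in_def orthogonal_projections_def
    by (auto intro!: sum_closed is_adjoint_sum)
qed

lemma orthogonal_projections_insert:
  assumes P: "orthogonal_projections P" and G: "projection_in M G" "G \<noteq> 0"
    and orth: "\<And>H. H \<in> P \<Longrightarrow> G \<cdot> H = 0"
  shows "orthogonal_projections (insert G P)" "G \<notin> P"
proof -
  show "G \<notin> P" using orth G projectionD(3)[OF G(1)] by auto
  have "H \<cdot> G = 0" if "H \<in> P" for H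
    using projection_sub_commute(3)[OF G(1) _ orth[OF that]] P that
    by (auto simp: orthogonal_projections_def)
  then show "orthogonal_projections (insert G P)"
    using P G orth by (auto simp: orthogonal_projections_def)
qed

text \<open>
  A family below \<open>F\<close> of greatest cardinality consists of minimal projections, since a member with a proper
  part could be split into two, and it exhausts \<open>F\<close>, since the remainder could be added.
\<close>

lemma minimal_decomposition:
  assumes bound: "\<And>P. orthogonal_projections P \<Longrightarrow> card P \<le> K" and F: "projection_in M F"
  obtains P where "orthogonal_projections P" "\<And>E. E \<in> P \<Longrightarrow> minimal_projection M E" "\<Sum>P = F"
proof -
  define Fam where "Fam P \<longleftrightarrow> orthogonal_projections P \<and> (\<forall>E\<in>P. F \<cdot> E = E)" for P
  have "Fam {}" by (simp add: Fam_def orthogonal_projections_def)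
  moreover have "\<forall>P. Fam P \<longrightarrow> card P < Suc K" using bound by (simp add: Fam_def less_Suc_eq_le)
  ultimately have "\<exists>P. Fam P \<and> (\<forall>Q. Fam Q \<longrightarrow> card Q \<le> card P)"
    by (rule ex_has_greatest_nat)
  then obtain P where P: "Fam P" "\<And>Q. Fam Q \<Longrightarrow> card Q \<le> card P"
    by metis
  have orth: "orthogonal_projections P" and sub: "\<And>E. E \<in> P \<Longrightarrow> F \<cdot> E = E"
    using P(1) by (auto simp: Fam_def)
  have fin: "finite P" using orth by (simp add: orthogonal_projections_def)
  show thesis
  proof (rule that[OF orth])
    fix E assume "E \<in> P"
    then have E: "projection_in M E" "E \<noteq> 0" using orth by (auto simp: orthogonal_projections_def)
    note ED = projectionD[OF E(1)]
    show "minimal_projection M E"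
      unfolding minimal_projection_def
    proof (intro conjI allI impI E)
      fix G assume "projection_in M G \<and> op_le G E"
      then have G: "projection_in M G" "E \<cdot> G = G"
        using op_le_projection_iff[OF E(1)] by auto
      note GD = projectionD[OF G(1)]
      have GE: "G \<cdot> E = G" by (rule projection_sub_commute(1)[OF E(1) G])
      show "G = 0 \<or> G = E"
      proof (rule ccontr)
        assume "\<not> (G = 0 \<or> G = E)"
        then have G0: "G \<noteq> 0" "E - G \<noteq> 0" by auto
        have EH: "E \<cdot> H = 0" if "H \<in> P - {E}" for H
          using orth that \<open>E \<in> P\<close> by (auto simp: orthogonal_projections_def)
        have GH: "G \<cdot> H = 0" if "H \<in> P - {E}" for H
          using EH[OF that] GE by (metis op_assoc blinfun_compose_zero(2))
        have o1: "orthogonal_projections (P - {E})"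
          using orth by (auto simp: orthogonal_projections_def)
        have EG: "projection_in M (E - G)" by (rule projection_diff[OF E(1) G])
        note o2 = orthogonal_projections_insert[OF o1 EG G0(2)]
        have o2': "orthogonal_projections (insert (E - G) (P - {E}))" "E - G \<notin> P - {E}"
          using o2 by (auto simp: op_simps EH GH)
        have GH': "G \<cdot> H = 0" if "H \<in> insert (E - G) (P - {E})" for H
          using that GH by (auto simp: op_simps GE GD)
        note o3 = orthogonal_projections_insert[OF o2'(1) G(1) G0(1) GH']
        have "Fam (insert G (insert (E - G) (P - {E})))"
          unfolding Fam_def
        proof (intro conjI o3 ballI)
          fix H assume "H \<in> insert G (insert (E - G) (P - {E}))"
          moreover have "F \<cdot> G = G" using sub[OF \<open>E \<in> P\<close>] G(2) by (metis op_assoc)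
          ultimately show "F \<cdot> H = H" using sub \<open>E \<in> P\<close> by (auto simp: op_simps)
        qed
        from P(2)[OF this] have "card (insert G (insert (E - G) (P - {E}))) \<le> card P" .
        moreover have "card (insert G (insert (E - G) (P - {E}))) = Suc (Suc (card (P - {E})))"
          using o3(2) o2'(2) fin by simp
        ultimately show False
          using card_Suc_Diff1[OF fin \<open>E \<in> P\<close>] by linarith
      qed
    qed
  next
    show "\<Sum>P = F"
    proof (rule ccontr)
      assume "\<Sum>P \<noteq> F"
      then have R0: "F - \<Sum>P \<noteq> 0" by simp
      have "F \<cdot> \<Sum>P = \<Sum>P" by (subst op_sum_right) (simp add: sub)
      from projection_diff[OF F orthogonal_projections_sum(2)[OF orth] this]
      have R: "projection_in M (F - \<Sum>P)" .
      have "(F - \<Sum>P) \<cdot> H = 0" if "H \<in> P" for H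
        using sub[OF that] orthogonal_projections_sum(1)[OF orth that] by (simp add: op_simps)
      note o = orthogonal_projections_insert[OF orth R R0 this]
      have "Fam (insert (F - \<Sum>P) P)"
        using o(1) sub projectionD(3)[OF F] \<open>F \<cdot> \<Sum>P = \<Sum>P\<close> by (auto simp: Fam_def op_simps)
      from P(2)[OF this] show False using o(2) fin by simp
    qed
  qed
qed

text \<open>
  Orthogonal nonzero projections are linearly independent over the reals, and \<open>M\<close> is the real span of a
  complex spanning set together with its multiples by \<open>\<i>\<close>.
\<close>

lemma finite_dimensional_bound:
  assumes "finite_dimensional M"
  obtains K where "\<And>P. orthogonal_projections P \<Longrightarrow> card P \<le> K"
proof -
  obtain B where B: "finite B" "B \<subseteq> M" "\<And>A. A \<in> M \<Longrightarrow> \<exists>c. A = (\<Sum>b\<in>B. op_scaleC (c b) b)"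
    using assms unfolding finite_dimensional_def by metis
  define B' where "B' = B \<union> op_scaleC \<i> ` B"
  have span: "M \<subseteq> span B'"
  proof
    fix A assume "A \<in> M"
    then obtain c where c: "A = (\<Sum>b\<in>B. op_scaleC (c b) b)" using B(3) by blast
    have "op_scaleC z b \<in> span B'" if "b \<in> B" for z b
    proof -
      have "op_scaleC z b = Re z *\<^sub>R b + Im z *\<^sub>R op_scaleC \<i> b"
        by (simp add: op_scaleC_simps flip: op_scaleC_of_real op_scaleC_simps(6))
           (simp add: mult.commute flip: complex_eq)
      moreover have "b \<in> span B'" "op_scaleC \<i> b \<in> span B'"
        using that by (auto simp: B'_def intro!: span_base)
      ultimately show ?thesis
        by (simp add: span_add span_scale)
    qed
    then show "A \<in> span B'" unfolding c by (rule span_sum)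
  qed
  have "card P \<le> card B'" if P: "orthogonal_projections P" for P
  proof -
    have "independent P"
    proof (rule independent_if_scalars_zero)
      show "finite P" using P by (simp add: orthogonal_projections_def)
      fix u E assume *: "(\<Sum>F\<in>P. u F *\<^sub>R F) = 0" "E \<in> P"
      have "(\<Sum>F\<in>P. u F *\<^sub>R F) \<cdot> E = (\<Sum>F\<in>P. if F = E then u E *\<^sub>R E else 0)"
        unfolding op_sum_left using P \<open>E \<in> P\<close>
        by (intro sum.cong) (auto simp: orthogonal_projections_def projection_in_def op_simps)
      also have "\<dots> = u E *\<^sub>R E" using \<open>finite P\<close> \<open>E \<in> P\<close> by simp
      finally show "u E = 0"
        using * P by (auto simp: orthogonal_projections_def)
    qed
    moreover have "P \<subseteq> span B'"
      using P span by (auto simp: orthogonal_projections_def projection_in_def)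
    ultimately show ?thesis
      using independent_span_bound[of B' P] B(1) by (auto simp: B'_def)
  qed
  then show thesis by (rule that)
qed

lemma finite_dimensional_atomic: "finite_dimensional M \<Longrightarrow> atomic M"
  unfolding atomic_def
proof (intro allI impI)
  fix F assume fd: "finite_dimensional M" and F: "projection_in M F \<and> F \<noteq> 0"
  obtain K where "\<And>P. orthogonal_projections P \<Longrightarrow> card P \<le> K"
    using finite_dimensional_bound[OF fd] by blast
  then obtain P where P: "orthogonal_projections P" "\<And>E. E \<in> P \<Longrightarrow> minimal_projection M E" "\<Sum>P = F"
    using minimal_decomposition[of K F] F by metis
  then have "P \<noteq> {}" using F by auto
  then obtain E where "E \<in> P" by blast
  with P F show "\<exists>E. minimal_projection M E \<and> op_le E F"
    using orthogonal_projections_sum(1)[OF P(1)] op_le_projection_iff minimal_projectionD(1) by blast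
qed

end

context tracial_algebra begin

text \<open>
  The element \<open>A = \<Sum> E A F\<close> is spanned by one operator from each corner \<open>E M F\<close>.  Different corners may
  contribute the same operator, for instance \<open>0\<close>, so their coefficients are collected over the image.
\<close>

lemma finite_dimensionalI:
  assumes "orthogonal_projections P" "\<And>E. E \<in> P \<Longrightarrow> minimal_projection M E" "\<Sum>P = id_blinfun"
  shows "finite_dimensional M"
proof -
  have fin: "finite P" using assms(1) by (simp add: orthogonal_projections_def)
  have "\<forall>p\<in>P \<times> P. \<exists>b. b \<in> M \<and> (\<forall>Y\<in>M. \<exists>c. fst p \<cdot> Y \<cdot> snd p = op_scaleC c b)"
    using minimal_corner assms(2) by (force simp: Bex_def)
  then obtain b where b: "\<And>p. p \<in> P \<times> P \<Longrightarrow> b p \<in> M"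
    "\<And>p Y. p \<in> P \<times> P \<Longrightarrow> Y \<in> M \<Longrightarrow> \<exists>c. fst p \<cdot> Y \<cdot> snd p = op_scaleC c (b p)"
    by (metis (lifting) bchoice)
  show ?thesis
    unfolding finite_dimensional_def
  proof (intro exI[of _ "b ` (P \<times> P)"] conjI ballI)
    show "finite (b ` (P \<times> P))" using fin by simp
    show "b ` (P \<times> P) \<subseteq> M" using b(1) by blast
    fix A assume "A \<in> M"
    then have "\<forall>p\<in>P \<times> P. \<exists>c. fst p \<cdot> A \<cdot> snd p = op_scaleC c (b p)" using b(2) by blast
    then obtain c where c: "\<And>p. p \<in> P \<times> P \<Longrightarrow> fst p \<cdot> A \<cdot> snd p = op_scaleC (c p) (b p)"
      by (metis (lifting) bchoice)
    have "A = \<Sum>P \<cdot> A \<cdot> \<Sum>P" by (simp add: assms(3))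
    also have "\<dots> = (\<Sum>E\<in>P. \<Sum>F\<in>P. E \<cdot> A \<cdot> F)"
      by (simp add: op_sum_left op_sum_right) (rule sum.swap)
    also have "\<dots> = (\<Sum>p\<in>P \<times> P. fst p \<cdot> A \<cdot> snd p)"
      by (simp add: sum.cartesian_product case_prod_beta)
    also have "\<dots> = (\<Sum>p\<in>P \<times> P. op_scaleC (c p) (b p))"
      by (intro sum.cong c refl)
    also have "\<dots> = (\<Sum>y\<in>b ` (P \<times> P). op_scaleC (\<Sum>p\<in>{p\<in>P \<times> P. b p = y}. c p) y)"
      by (rule op_scaleC_sum_image) (simp add: fin)
    finally show "\<exists>c. A = (\<Sum>y\<in>b ` (P \<times> P). op_scaleC (c y) y)"
      by (rule exI[of _ "\<lambda>y. \<Sum>p\<in>{p\<in>P \<times> P. b p = y}. c p"])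
  qed
qed

section \<open>The trace gap forced by the weak Dixmier property\<close>

text \<open>
  Otherwise \<open>E P E = r E\<close> with \<open>r \<noteq> 0\<close>, and \<open>P E P / r\<close> is a projection below \<open>P\<close> that has the same trace
  as \<open>E\<close>, although \<open>P\<close> has less.
\<close>

lemma minimal_orthogonal_small:
  assumes E: "minimal_projection M E" and P: "projection_in M P" and less: "tr P < tr E"
  shows "E \<cdot> P = 0"
proof -
  note ED = projectionD[OF minimal_projectionD(1)[OF E]] and PD = projectionD[OF P]
  obtain r where r: "E \<cdot> P \<cdot> E = r *\<^sub>R E"
    using minimal_compress_selfadjoint[OF E PD(1,2)] by blast
  have r_form: "r * (norm (E x))\<^sup>2 = (norm (P (E x)))\<^sup>2" for x
  proof -
    have "inner ((E \<cdot> P \<cdot> E) x) x = inner (P (E x)) (E x)"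
      by (simp add: is_adjoint_inner[OF ED(2)])
    then show ?thesis by (simp add: r blinfun.scaleR_left ED(6) PD(6))
  qed
  have "r = 0"
  proof (rule ccontr)
    assume "r \<noteq> 0"
    define Q where "Q = (1/r) *\<^sub>R (P \<cdot> E \<cdot> P)"
    have "P \<cdot> E \<cdot> P \<cdot> (P \<cdot> E \<cdot> P) = P \<cdot> (E \<cdot> P \<cdot> E) \<cdot> P"
      by (simp add: op_assoc PD)
    also have "\<dots> = r *\<^sub>R (P \<cdot> E \<cdot> P)" unfolding r by (simp add: op_simps)
    finally have "Q \<cdot> Q = Q" using \<open>r \<noteq> 0\<close> by (simp add: Q_def op_simps)
    moreover have "is_adjoint (P \<cdot> E \<cdot> P) (P \<cdot> E \<cdot> P)"
      using is_adjoint_compose[OF is_adjoint_compose[OF PD(2) ED(2)] PD(2)] by (simp add: op_assoc)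
    ultimately have Q: "projection_in M Q"
      unfolding projection_in_def
      by (auto simp: Q_def intro: closed_intros is_adjoint_scaleR PD ED)
    have "P \<cdot> Q = Q" by (simp add: Q_def op_simps PD)
    from projection_diff[OF P Q this] have "tr Q \<le> tr P"
      using trace_projection(2)[of "P - Q"] by (simp add: tr_simps PD projectionD(1)[OF Q])
    moreover have "tr Q = tr E"
    proof -
      have "\<tau> (P \<cdot> E \<cdot> P) = \<tau> (P \<cdot> (E \<cdot> P))" by (simp add: op_assoc)
      also have "\<dots> = \<tau> (E \<cdot> P \<cdot> P)" by (intro trace_commute closed_intros PD ED)
      also have "\<dots> = \<tau> (E \<cdot> (E \<cdot> P))" by (simp add: op_assoc PD ED)
      also have "\<dots> = \<tau> (E \<cdot> P \<cdot> E)" by (intro trace_commute closed_intros PD ED)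
      finally have "tr (P \<cdot> E \<cdot> P) = r * tr E" by (simp add: tr_def r trace_scaleR ED)
      then show ?thesis
        using \<open>r \<noteq> 0\<close> by (simp add: Q_def tr_simps closed_intros PD ED)
    qed
    ultimately show False using less by simp
  qed
  then have "P (E x) = 0" for x using r_form[of x] by simp
  then have "P \<cdot> E = 0" by (intro blinfun_eqI) simp
  then show ?thesis using projection_sub_commute(3)[OF P minimal_projectionD(1)[OF E]] by blast
qed

text \<open>
  All positive moments of \<open>S\<close> agree, so \<open>(S - S^2)^2 = S^2 - 2 S^3 + S^4\<close> has trace zero.
\<close>

lemma equi_measurable_projection:
  assumes F: "projection_in M F" and S: "S \<in> M" "positive_op S" "equi_measurable \<tau> S F"
  shows "projection_in M S" "\<tau> S = \<tau> F"
proof -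
  have adj: "is_adjoint S S" by (rule positive_selfadjoint[OF S(1,2)])
  have pow: "\<tau> (op_pow S (Suc n)) = \<tau> F" for n
  proof -
    have "op_pow F (Suc n) = F" by (induction n) (use projectionD(3)[OF F] in auto)
    then show ?thesis using S(3) unfolding equi_measurable_def by metis
  qed
  show "\<tau> S = \<tau> F" using pow[of 0] by simp
  define D where "D = S - S \<cdot> S"
  have D: "D \<in> M" "is_adjoint D D"
    unfolding D_def by (intro closed_intros S is_adjoint_intros adj)+
  have "D \<cdot> D = S \<cdot> S - 2 *\<^sub>R (S \<cdot> (S \<cdot> S)) + S \<cdot> (S \<cdot> (S \<cdot> S))"
    by (simp add: D_def op_simps scaleR_2)
  then have "\<tau> (D \<cdot> D) = 0"
    using pow[of 1] pow[of 2] pow[of 3] S(1)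
    by (simp add: trace_add trace_diff trace_scaleR closed_intros numeral_eq_Suc)
  then have "D = 0"
    using trace_adjoint_square(3)[OF D(1) D(1) D(2)] by (simp add: tr_def)
  then show "projection_in M S" using S adj by (simp add: projection_in_def D_def)
qed

text \<open>
  If \<open>\<tau> F < \<tau> E\<close>, every positive operator equi-measurable with \<open>F\<close> is annihilated by \<open>E\<close>, and so is the closed convex
  hull of these operators; the nonzero scalar \<open>\<tau> F\<close> is not.
\<close>

lemma weak_Dixmier_trace_gap:
  assumes wD: "weak_Dixmier_property M \<tau>" and E: "minimal_projection M E"
    and F: "projection_in M F" "F \<noteq> 0"
  shows "tr E \<le> tr F"
proof (rule ccontr)
  assume "\<not> tr E \<le> tr F"
  let ?X = "{S \<in> M. positive_op S \<and> equi_measurable \<tau> S F}"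
  let ?Z = "{X. E \<cdot> X = 0}"
  have "?X \<subseteq> ?Z"
  proof clarify
    fix S assume "S \<in> M" "positive_op S" "equi_measurable \<tau> S F"
    from equi_measurable_projection[OF F(1) this] show "E \<cdot> S = 0"
      using minimal_orthogonal_small[OF E] \<open>\<not> tr E \<le> tr F\<close> by (simp add: tr_def)
  qed
  moreover have "convex ?Z"
    by (rule convexI) (simp add: op_simps)
  moreover have "closed ?Z"
    by (intro closed_Collect_eq continuous_intros bounded_linear.continuous_on
        bounded_bilinear.bounded_linear_right[OF bounded_bilinear_blinfun_compose])
  ultimately have "closure (convex hull ?X) \<subseteq> ?Z"
    by (intro closure_minimal hull_minimal)
  moreover have "positive_op F"
    using projectionD(2,6)[OF F(1)] by (simp add: positive_op_iff)
  ultimately have "op_scaleC (\<tau> F) id_blinfun \<in> ?Z"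
    using wD projectionD(1)[OF F(1)] unfolding weak_Dixmier_property_def by blast
  then have "op_scaleC (\<tau> F) E = 0"
    using op_scaleC_right[OF linear, of E] projectionD(1)[OF minimal_projectionD(1)[OF E]] by simp
  then have "tr F *\<^sub>R E = 0"
    by (simp add: trace_projection(1)[OF F(1)] op_scaleC_of_real)
  then show False
    using trace_projection(3)[OF F(1)] F(2) minimal_projectionD(2)[OF E] by auto
qed

theorem weak_Dixmier_not_diffuse:
  assumes wD: "weak_Dixmier_property M \<tau>" and nd: "\<not> diffuse M"
  shows "finite_dimensional M"
    "minimal_projection M E \<Longrightarrow> minimal_projection M F \<Longrightarrow> \<tau> E = \<tau> F"
proof -
  note gap = weak_Dixmier_trace_gap[OF wD]
  show "\<tau> E = \<tau> F" if "minimal_projection M E" "minimal_projection M F" for E F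
    using gap[OF that(1), of F] gap[OF that(2), of E] minimal_projectionD[OF that(1)]
      minimal_projectionD[OF that(2)] trace_projection(1) by (metis order_antisym)
  obtain E where E: "minimal_projection M E" using nd by (auto simp: diffuse_def)
  have pos: "tr E > 0"
    using trace_projection(2,3)[OF minimal_projectionD(1)[OF E]] minimal_projectionD(2)[OF E]
    by fastforce
  have bound: "card P \<le> nat \<lfloor>1 / tr E\<rfloor>" if P: "orthogonal_projections P" for P
  proof -
    have "real (card P) * tr E = (\<Sum>F\<in>P. tr E)" by simp
    also have "\<dots> \<le> (\<Sum>F\<in>P. tr F)"
      using P gap[OF E] by (intro sum_mono) (auto simp: orthogonal_projections_def)
    also have "\<dots> = tr (\<Sum>P)"
      using P by (intro tr_sum[symmetric]) (auto simp: orthogonal_projections_def projection_in_def)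
    also have "\<dots> \<le> 1" by (rule trace_projection(4)[OF orthogonal_projections_sum(2)[OF P]])
    finally have "real (card P) \<le> 1 / tr E" using pos by (simp add: field_simps)
    then show ?thesis by linarith
  qed
  obtain P where "orthogonal_projections P" "\<And>E. E \<in> P \<Longrightarrow> minimal_projection M E" "\<Sum>P = id_blinfun"
    using minimal_decomposition[OF bound projection_id] by blast
  then show "finite_dimensional M" by (rule finite_dimensionalI)
qed

end

text \<open>
  A pointwise convergent sequence converges in the product topology, of which the strong operator topology
  is the pullback.
\<close>

lemma finite_von_neumann_algebra_tracial:
  fixes M :: "('h::complex_hilbert \<Rightarrow>\<^sub>L 'h) set"
  assumes "finite_von_neumann_algebra M \<tau>"
  shows "tracial_algebra M \<tau>"
proof -
  have vN: "von_neumann_algebra M" and st: "state_on M \<tau>"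
    using assms by (auto simp: finite_von_neumann_algebra_def)
  have closed: "closedin strong_operator_topology M" using vN by (simp add: von_neumann_algebra_def)
  have lim: "A \<in> M" if X: "\<And>n. X n \<in> M" "\<And>x. (\<lambda>n::nat. blinfun_apply (X n) x) \<longlonglongrightarrow> A x"
    for X and A :: "'h \<Rightarrow>\<^sub>L 'h"
  proof (rule ccontr)
    assume "A \<notin> M"
    have "openin strong_operator_topology (- M)"
      using closed by (simp add: closedin_def strong_operator_topology_topspace Compl_eq_Diff_UNIV)
    then obtain U where U: "open U" "- M = blinfun_apply -` U \<inter> UNIV"
      unfolding strong_operator_topology_def by (auto simp: openin_pullback_topology)
    then have "blinfun_apply A \<in> U" using \<open>A \<notin> M\<close> by blast
    moreover have "(\<lambda>n. blinfun_apply (X n)) \<longlonglongrightarrow> blinfun_apply A"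
      using X(2) limitin_componentwise[of "\<lambda>_. euclidean" UNIV "\<lambda>n. blinfun_apply (X n)" "blinfun_apply A" sequentially]
      by (simp add: euclidean_product_topology)
    ultimately have "\<forall>\<^sub>F n in sequentially. blinfun_apply (X n) \<in> U"
      using U(1) by (simp add: topological_tendstoD)
    then obtain n where "blinfun_apply (X n) \<in> U" by (auto simp: eventually_sequentially)
    then show False using U(2) X(1) by blast
  qed
  show ?thesis
    by unfold_locales
      (use vN st assms lim in \<open>auto simp: von_neumann_algebra_def state_on_def
        finite_von_neumann_algebra_def\<close>)
qed

section \<open>Rotating eigenvalues in finite dimension\<close>

lemma sum_rotate:
  fixes f :: "nat \<Rightarrow> 'a::comm_monoid_add"
  shows "(\<Sum>k<n. f ((i + k) mod n)) = (\<Sum>k<n. f k)"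
proof (cases "n = 0")
  case False
  have "bij_betw (\<lambda>k. (i + k) mod n) {..<n} {..<n}"
  \<comment> \<open>The inverse is subtraction of \<open>i\<close> modulo \<open>n\<close>, written with natural numbers.\<close>
  proof (rule bij_betwI[where g = "\<lambda>k. (k + (n - i mod n)) mod n"])
    fix k assume "k \<in> {..<n}"
    have le: "i mod n \<le> n" using False by (simp add: less_imp_le)
    have "((i + k) mod n + (n - i mod n)) mod n = (i mod n + k + (n - i mod n)) mod n"
      by (simp add: mod_add_left_eq mod_add_right_eq) (metis mod_add_left_eq)
    also have "i mod n + k + (n - i mod n) = k + n" using le by linarith
    finally show "((i + k) mod n + (n - i mod n)) mod n = k" using \<open>k \<in> {..<n}\<close> by simp
    have "(i + (k + (n - i mod n)) mod n) mod n = (i mod n + (k + (n - i mod n))) mod n"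
      by (simp add: mod_add_left_eq mod_add_right_eq)
    also have "i mod n + (k + (n - i mod n)) = k + n" using le by linarith
    finally show "(i + (k + (n - i mod n)) mod n) mod n = k" using \<open>k \<in> {..<n}\<close> by simp
  qed (use False in auto)
  then show ?thesis by (rule sum.reindex_bij_betw)
qed simp

lemma average_in_convex_hull:
  fixes S :: "nat \<Rightarrow> 'a::real_vector"
  assumes "n > 0" "\<And>k. k < n \<Longrightarrow> S k \<in> X"
  shows "(1 / real n) *\<^sub>R (\<Sum>k<n. S k) \<in> convex hull X"
  unfolding scaleR_sum_right
  using assms by (intro convex_sum convex_convex_hull) (auto intro: hull_inc)

context star_algebra begin

definition partition_of_unity :: "'i set \<Rightarrow> ('i \<Rightarrow> ('h \<Rightarrow>\<^sub>L 'h)) \<Rightarrow> bool" where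
  "partition_of_unity I e \<longleftrightarrow> finite I \<and> (\<forall>i\<in>I. projection_in M (e i)) \<and>
     (\<forall>i\<in>I. \<forall>j\<in>I. i \<noteq> j \<longrightarrow> e i \<cdot> e j = 0) \<and> (\<Sum>i\<in>I. e i) = id_blinfun"

lemma partition_of_unityD:
  assumes "partition_of_unity I e"
  shows "finite I" "i \<in> I \<Longrightarrow> projection_in M (e i)" "i \<in> I \<Longrightarrow> e i \<in> M"
    "i \<in> I \<Longrightarrow> is_adjoint (e i) (e i)"
    "i \<in> I \<Longrightarrow> j \<in> I \<Longrightarrow> e i \<cdot> e j = (if i = j then e i else 0)"
    "i \<in> I \<Longrightarrow> j \<in> I \<Longrightarrow> e i \<cdot> (e j \<cdot> A) = (if i = j then e i \<cdot> A else 0)"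
    "(\<Sum>i\<in>I. e i) = id_blinfun"
proof -
  show "finite I" "i \<in> I \<Longrightarrow> projection_in M (e i)" "i \<in> I \<Longrightarrow> e i \<in> M"
    "i \<in> I \<Longrightarrow> is_adjoint (e i) (e i)" "(\<Sum>i\<in>I. e i) = id_blinfun"
    and *: "i \<in> I \<Longrightarrow> j \<in> I \<Longrightarrow> e i \<cdot> e j = (if i = j then e i else 0)"
    using assms by (auto simp: partition_of_unity_def projection_in_def)
  then show "i \<in> I \<Longrightarrow> j \<in> I \<Longrightarrow> e i \<cdot> (e j \<cdot> A) = (if i = j then e i \<cdot> A else 0)"
    by (simp flip: op_assoc)
qed

lemma partition_of_unity_expand:
  assumes "partition_of_unity I e"
  shows "A = (\<Sum>i\<in>I. \<Sum>j\<in>I. e i \<cdot> A \<cdot> e j)"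
proof -
  have "A = (\<Sum>i\<in>I. e i) \<cdot> A \<cdot> (\<Sum>j\<in>I. e j)"
    using partition_of_unityD(7)[OF assms] by simp
  also have "\<dots> = (\<Sum>i\<in>I. \<Sum>j\<in>I. e i \<cdot> A \<cdot> e j)"
    by (simp add: op_sum_left op_sum_right) (rule sum.swap)
  finally show ?thesis .
qed

lemma diagonal_compose:
  assumes "partition_of_unity I e"
  shows "(\<Sum>i\<in>I. a i *\<^sub>R e i) \<cdot> (\<Sum>i\<in>I. b i *\<^sub>R e i) = (\<Sum>i\<in>I. (a i * b i) *\<^sub>R e i)"
proof -
  note e = partition_of_unityD[OF assms]
  have "(\<Sum>i\<in>I. a i *\<^sub>R e i) \<cdot> (\<Sum>i\<in>I. b i *\<^sub>R e i)
      = (\<Sum>i\<in>I. \<Sum>j\<in>I. (a i * b j) *\<^sub>R (e i \<cdot> e j))"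
    by (simp add: op_sum_left op_sum_right op_simps scaleR_sum_right mult.commute) (rule sum.swap)
  also have "\<dots> = (\<Sum>i\<in>I. \<Sum>j\<in>I. if j = i then (a i * b i) *\<^sub>R e i else 0)"
    by (intro sum.cong refl) (simp add: e(5))
  also have "\<dots> = (\<Sum>i\<in>I. (a i * b i) *\<^sub>R e i)" using e(1) by simp
  finally show ?thesis .
qed

lemma diagonal_pow:
  assumes "partition_of_unity I e"
  shows "op_pow (\<Sum>i\<in>I. a i *\<^sub>R e i) n = (\<Sum>i\<in>I. (a i ^ n) *\<^sub>R e i)"
  by (induction n) (auto simp: partition_of_unityD(7)[OF assms] diagonal_compose[OF assms])

lemma diagonal_mem:
  assumes "partition_of_unity I e"
  shows "(\<Sum>i\<in>I. a i *\<^sub>R e i) \<in> M"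
  using partition_of_unityD(3)[OF assms] by (intro closed_intros)

lemma diagonal_adjoint:
  assumes "partition_of_unity I e"
  shows "is_adjoint (\<Sum>i\<in>I. a i *\<^sub>R e i) (\<Sum>i\<in>I. a i *\<^sub>R e i)"
  using partition_of_unityD(4)[OF assms] by (intro is_adjoint_intros)

lemma diagonal_form:
  assumes "partition_of_unity I e"
  shows "inner ((\<Sum>i\<in>I. a i *\<^sub>R e i) x) x = (\<Sum>i\<in>I. a i * (norm (e i x))\<^sup>2)"
  using projectionD(6)[OF partition_of_unityD(2)[OF assms]]
  by (simp add: blinfun.sum_left inner_sum_left blinfun.scaleR_left)

lemma diagonal_positive:
  assumes "partition_of_unity I e" "\<And>i. i \<in> I \<Longrightarrow> 0 \<le> a i"
  shows "positive_op (\<Sum>i\<in>I. a i *\<^sub>R e i)"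
  using positive_op_iff[OF diagonal_adjoint[OF assms(1)]] assms(2)
  by (simp add: diagonal_form[OF assms(1)] sum_nonneg)

lemma orthogonal_projections_enumerate:
  assumes "orthogonal_projections P" "\<Sum>P = id_blinfun"
  obtains e and n :: nat where "partition_of_unity {..<n} e" "e ` {..<n} = P"
proof -
  have fin: "finite P" using assms by (simp add: orthogonal_projections_def)
  from ex_bij_betw_nat_finite[OF this] obtain e where e: "bij_betw e {..<card P} P"
    by (auto simp: atLeast0LessThan)
  have inj: "e i \<noteq> e j" if "i < card P" "j < card P" "i \<noteq> j" for i j
    using e that by (auto simp: bij_betw_def inj_on_def)
  have "(\<Sum>i<card P. e i) = \<Sum>P" by (rule sum.reindex_bij_betw[OF e])
  moreover have "e i \<in> P" if "i < card P" for i using bij_betwE[OF e] that by auto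
  ultimately have "partition_of_unity {..<card P} e"
    using assms inj by (auto simp: partition_of_unity_def orthogonal_projections_def)
  then show thesis using that e by (auto simp: bij_betw_def)
qed

text \<open>
  Minimal projections of the commutant of \<open>T\<close> diagonalize \<open>T\<close>, so the general decomposition into minimal
  projections will be applied there.
\<close>

lemma commutant_star_algebra:
  assumes T: "is_adjoint T T"
  shows "star_algebra {A \<in> M. A \<cdot> T = T \<cdot> A}"
proof
  fix A B assume A: "A \<in> {A \<in> M. A \<cdot> T = T \<cdot> A}"
  then show "complex_linear A" using linear by blast
  have A_eq: "A (T x) = T (A x)" for x using A by (intro op_commute_apply) simp
  show "op_scaleC c A \<in> {A \<in> M. A \<cdot> T = T \<cdot> A}" for c
    using A is_adjoint_linear[OF T] by (auto intro: scaleC_closed simp: op_scaleC_simps op_scaleC_right)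
  obtain A' where A': "A' \<in> M" "is_adjoint A A'" using adjoint_exists A by blast
  have "is_adjoint (A \<cdot> T) (T \<cdot> A')" "is_adjoint (T \<cdot> A) (A' \<cdot> T)"
    by (intro is_adjoint_compose A' T)+
  then have "A' \<cdot> T = T \<cdot> A'" using A is_adjoint_unique by auto
  then show "\<exists>B\<in>{A \<in> M. A \<cdot> T = T \<cdot> A}. is_adjoint A B" using A' by blast
  assume B: "B \<in> {A \<in> M. A \<cdot> T = T \<cdot> A}"
  then have B_eq: "B (T x) = T (B x)" for x by (intro op_commute_apply) simp
  show "A + B \<in> {A \<in> M. A \<cdot> T = T \<cdot> A}" "A \<cdot> B \<in> {A \<in> M. A \<cdot> T = T \<cdot> A}"
    using A B by (auto intro: closed_intros intro!: blinfun_eqI simp: A_eq B_eq blinfun.bilinear_simps)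
next
  fix X and A :: "'h \<Rightarrow>\<^sub>L 'h"
  assume X: "\<And>n::nat. X n \<in> {A \<in> M. A \<cdot> T = T \<cdot> A}"
    and lim: "\<And>x. (\<lambda>n. blinfun_apply (X n) x) \<longlonglongrightarrow> A x"
  have "A \<in> M" by (rule limit_closed[of X]) (use X lim in auto)
  moreover have "A \<cdot> T = T \<cdot> A"
  proof (rule blinfun_eqI)
    fix x
    have "X n (T x) = T (X n x)" for n
      using X[of n] by (intro op_commute_apply) simp
    moreover have "(\<lambda>n. T (X n x)) \<longlonglongrightarrow> T (A x)" by (intro tendsto_intros lim)
    ultimately show "(A \<cdot> T) x = (T \<cdot> A) x"
      using LIMSEQ_unique[OF lim[of "T x"]] by simp
  qed
  ultimately show "A \<in> {A \<in> M. A \<cdot> T = T \<cdot> A}" by simp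
qed simp

text \<open>
  Decompose \<open>1\<close> into minimal projections \<open>e i\<close> of the commutant of \<open>T\<close>.  As \<open>T\<close> itself lies in this commutant,
  \<open>e i T\<close> is a multiple of \<open>e i\<close>; hence every projection of \<open>M\<close> below \<open>e i\<close> commutes with \<open>T\<close>, and \<open>e i\<close> is
  minimal in \<open>M\<close> as well.
\<close>

lemma minimal_diagonalization:
  assumes bound: "\<And>P. orthogonal_projections P \<Longrightarrow> card P \<le> K" and T: "T \<in> M" "is_adjoint T T"
  obtains e r and n :: nat where "partition_of_unity {..<n} e"
    "\<And>i. i < n \<Longrightarrow> minimal_projection M (e i)" "T = (\<Sum>i<n. r i *\<^sub>R e i)"
proof -
  define C where "C = {A \<in> M. A \<cdot> T = T \<cdot> A}"
  interpret C: star_algebra C unfolding C_def by (rule commutant_star_algebra[OF T(2)])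
  have proj: "projection_in C E \<longleftrightarrow> projection_in M E \<and> E \<cdot> T = T \<cdot> E" for E
    by (auto simp: C_def projection_in_def)
  have orth: "orthogonal_projections P" if "C.orthogonal_projections P" for P
    using that by (auto simp: orthogonal_projections_def C.orthogonal_projections_def proj)
  obtain P where P: "C.orthogonal_projections P" "\<And>E. E \<in> P \<Longrightarrow> minimal_projection C E"
    "\<Sum>P = id_blinfun"
    using C.minimal_decomposition[OF bound[OF orth] C.projection_id] by blast
  obtain e and n :: nat where e: "partition_of_unity {..<n} e" "e ` {..<n} = P"
    using orthogonal_projections_enumerate[OF orth[OF P(1)] P(3)] by blast
  have "T \<in> C" using T by (simp add: C_def)
  have minC: "minimal_projection C (e i)" if "i < n" for i using P(2) e(2) that by auto
  note eD = partition_of_unityD[OF e(1)]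
  have comm: "e i \<cdot> T = T \<cdot> e i" if "i < n" for i
    using C.minimal_projectionD(1)[OF minC[OF that]] proj by blast
  have "\<exists>r. \<forall>i\<in>{..<n}. e i \<cdot> T = r i *\<^sub>R e i"
  proof (rule bchoice, rule ballI)
    fix i assume "i \<in> {..<n}"
    then obtain r where "e i \<cdot> T \<cdot> e i = r *\<^sub>R e i"
      using C.minimal_compress_selfadjoint[OF minC \<open>T \<in> C\<close> T(2)] by auto
    moreover have "e i \<cdot> T \<cdot> e i = e i \<cdot> T"
      using \<open>i \<in> {..<n}\<close> comm[of i] by (simp add: op_assoc eD(5) flip: comm)
        (simp add: eD(6))
    ultimately show "\<exists>r. e i \<cdot> T = r *\<^sub>R e i" by auto
  qed
  then obtain r where r: "\<And>i. i < n \<Longrightarrow> e i \<cdot> T = r i *\<^sub>R e i" by auto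
  show thesis
  proof (rule that[OF e(1)])
    have "T = (\<Sum>i<n. e i) \<cdot> T" using eD(7) by simp
    then show "T = (\<Sum>i<n. r i *\<^sub>R e i)" by (simp add: op_sum_left r)
    fix i assume i: "i < n"
    show "minimal_projection M (e i)"
      unfolding minimal_projection_def
    proof (intro conjI allI impI)
      show "projection_in M (e i)" "e i \<noteq> 0"
        using eD(2) i C.minimal_projectionD(2)[OF minC[OF i]] by auto
      fix F assume "projection_in M F \<and> op_le F (e i)"
      then have F: "projection_in M F" "e i \<cdot> F = F"
        using op_le_projection_iff eD(2) i by auto
      have Fe: "F \<cdot> e i = F" using projection_sub_commute(1)[OF _ F] eD(2) i by simp
      have "F \<cdot> T = F \<cdot> (e i \<cdot> T)" by (simp add: Fe flip: op_assoc)
      also have "\<dots> = r i *\<^sub>R F" by (simp add: r[OF i] op_simps Fe)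
      also have "\<dots> = (e i \<cdot> T) \<cdot> F" by (simp add: r[OF i] op_simps F(2))
      also have "\<dots> = T \<cdot> F" unfolding comm[OF i] by (simp add: op_assoc F(2))
      finally have "projection_in C F" using F(1) by (simp add: proj)
      then show "F = 0 \<or> F = e i" by (rule C.minimal_projectionD(3)[OF minC[OF i] _ F(2)])
    qed
  qed
qed

end

context tracial_algebra begin

lemma trace_diagonal:
  assumes "partition_of_unity I e"
  shows "\<tau> (\<Sum>i\<in>I. a i *\<^sub>R e i) = (\<Sum>i\<in>I. of_real (a i) * \<tau> (e i))"
  using partition_of_unityD(3)[OF assms] by (simp add: trace_sum trace_scaleR scaleR_closed)

lemma trace_partition:
  assumes "partition_of_unity I e"
  shows "(\<Sum>i\<in>I. \<tau> (e i)) = 1"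
  using trace_diagonal[OF assms, of "\<lambda>_. 1"] partition_of_unityD(7)[OF assms]
  by (simp add: trace_id)

lemma equal_trace_minimal_partition:
  assumes e: "partition_of_unity {..<n} e" "\<And>i. i < n \<Longrightarrow> minimal_projection M (e i)"
    and eq: "\<And>E F. minimal_projection M E \<Longrightarrow> minimal_projection M F \<Longrightarrow> \<tau> E = \<tau> F"
  shows "n > 0" "i < n \<Longrightarrow> \<tau> (e i) = 1 / of_nat n"
proof -
  show "n > 0"
  proof (rule ccontr)
    assume "\<not> n > 0"
    then show False using trace_partition[OF e(1)] by simp
  qed
  assume "i < n"
  then have "(\<Sum>j<n. \<tau> (e j)) = (\<Sum>j<n. \<tau> (e i))"
    using eq e(2) by (intro sum.cong) auto
  then show "\<tau> (e i) = 1 / of_nat n"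
    using trace_partition[OF e(1)] \<open>n > 0\<close> by (simp add: field_simps)
qed

text \<open>
  Permuting the eigenvalues of \<open>T\<close> keeps all moments because the eigenprojections have the same trace.  Over
  all cyclic shifts each eigenprojection meets each eigenvalue exactly once.
\<close>

theorem weak_Dixmier_equal_minimal_traces:
  assumes fd: "finite_dimensional M"
    and eq: "\<And>E F. minimal_projection M E \<Longrightarrow> minimal_projection M F \<Longrightarrow> \<tau> E = \<tau> F"
  shows "weak_Dixmier_property M \<tau>"
  unfolding weak_Dixmier_property_def
proof (intro ballI impI)
  fix T assume T: "T \<in> M" "positive_op T"
  obtain K where K: "\<And>P. orthogonal_projections P \<Longrightarrow> card P \<le> K"
    using finite_dimensional_bound[OF fd] by blast
  obtain e r and n :: nat where e: "partition_of_unity {..<n} e"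
    "\<And>i. i < n \<Longrightarrow> minimal_projection M (e i)" "T = (\<Sum>i<n. r i *\<^sub>R e i)"
    using minimal_diagonalization[OF K T(1) positive_selfadjoint[OF T]] by blast
  note eD = partition_of_unityD[OF e(1)]
  have "n > 0" and tau_e: "\<And>i. i < n \<Longrightarrow> \<tau> (e i) = 1 / of_nat n"
    using equal_trace_minimal_partition[OF e(1,2) eq] by blast+
  have r_nonneg: "r i \<ge> 0" if i: "i < n" for i
  proof -
    obtain x where x: "e i x \<noteq> 0"
      using minimal_projectionD(2)[OF e(2)[OF i]] by (metis blinfun_eqI blinfun.zero_left)
    have ej: "e j (e i x) = (if j = i then e i x else 0)" if "j < n" for j
      using eD(5)[of j i] i that by (simp flip: blinfun_apply_blinfun_compose)
    have "0 \<le> inner (T (e i x)) (e i x)"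
      using T(2) positive_op_iff[OF positive_selfadjoint[OF T]] by blast
    also have "\<dots> = (\<Sum>j<n. if j = i then r i * (norm (e i x))\<^sup>2 else 0)"
      unfolding e(3) diagonal_form[OF e(1)] by (intro sum.cong) (auto simp: ej)
    also have "\<dots> = r i * (norm (e i x))\<^sup>2" using i by simp
    finally show ?thesis using x by (simp add: zero_le_mult_iff)
  qed
  \<comment> \<open>\<open>S k\<close> gives \<open>e i\<close> the eigenvalue with index \<open>i + k\<close> modulo \<open>n\<close>.\<close>
  define S where "S k = (\<Sum>i<n. r ((i + k) mod n) *\<^sub>R e i)" for k
  have tau_S: "\<tau> (op_pow (S k) m) = (\<Sum>i<n. of_real (r i ^ m)) / of_nat n" for k m
  proof -
    have "\<tau> (op_pow (S k) m) = (\<Sum>i<n. of_real (r ((i + k) mod n) ^ m) * \<tau> (e i))"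
      unfolding S_def diagonal_pow[OF e(1)] by (rule trace_diagonal[OF e(1)])
    also have "\<dots> = (\<Sum>i<n. of_real (r ((k + i) mod n) ^ m) / of_nat n)"
      by (intro sum.cong) (auto simp: tau_e add.commute)
    also have "\<dots> = (\<Sum>i<n. of_real (r i ^ m) / of_nat n)"
      by (rule sum_rotate[of "\<lambda>i. of_real (r i ^ m) / of_nat n"])
    finally show ?thesis by (simp add: sum_divide_distrib)
  qed
  have T_S0: "T = S 0" by (simp add: S_def e(3))
  have mem: "S k \<in> {S \<in> M. positive_op S \<and> equi_measurable \<tau> S T}" for k
  proof -
    have "positive_op (S k)"
      unfolding S_def by (rule diagonal_positive[OF e(1)]) (use r_nonneg \<open>n > 0\<close> in simp)
    moreover have "equi_measurable \<tau> (S k) T"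
      unfolding equi_measurable_def T_S0 by (simp only: tau_S) simp
    ultimately show ?thesis by (simp add: S_def diagonal_mem[OF e(1)])
  qed
  have "(\<Sum>k<n. S k) = (\<Sum>i<n. \<Sum>k<n. r ((i + k) mod n) *\<^sub>R e i)"
    unfolding S_def by (rule sum.swap)
  also have "\<dots> = (\<Sum>i<n. (\<Sum>k<n. r k) *\<^sub>R e i)"
    by (simp only: scaleR_left.sum[symmetric] sum_rotate)
  also have "\<dots> = (\<Sum>k<n. r k) *\<^sub>R id_blinfun"
    by (simp only: scaleR_right.sum[symmetric] eD(7))
  finally have avg: "(1 / real n) *\<^sub>R (\<Sum>k<n. S k) = ((\<Sum>k<n. r k) / n) *\<^sub>R id_blinfun" by simp
  have "\<tau> T = of_real ((\<Sum>k<n. r k) / n)"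
    using tau_S[of 0 1] by (simp add: T_S0)
  then have "op_scaleC (\<tau> T) id_blinfun = (1 / real n) *\<^sub>R (\<Sum>k<n. S k)"
    by (simp only: avg op_scaleC_of_real)
  also have "\<dots> \<in> convex hull {S \<in> M. positive_op S \<and> equi_measurable \<tau> S T}"
    by (rule average_in_convex_hull[OF \<open>n > 0\<close> mem])
  finally show "op_scaleC (\<tau> T) id_blinfun
      \<in> closure (convex hull {S \<in> M. positive_op S \<and> equi_measurable \<tau> S T})"
    using closure_subset by blast
qed

end

section \<open>Matrix units\<close>

context tracial_algebra begin

lemma trace_adjoint:
  assumes A: "A \<in> M" "is_adjoint A B"
  shows "\<tau> B = cnj (\<tau> A)"
proof -
  obtain H K where HK: "H \<in> M" "K \<in> M" "is_adjoint H H" "is_adjoint K K" "A = H + op_scaleC \<i> K"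
    using cartesian_decomposition[OF A(1)] by blast
  have "is_adjoint A (H + op_scaleC (cnj \<i>) K)"
    unfolding HK(5) by (intro is_adjoint_add is_adjoint_scaleC HK)
  then have "B = H + op_scaleC (cnj \<i>) K" using A(2) is_adjoint_unique by blast
  then show ?thesis
    using trace_selfadjoint(1)[OF HK(1,3)] trace_selfadjoint(1)[OF HK(2,4)]
    by (simp add: HK(5) trace_add trace_scaleC closed_intros HK)
qed

text \<open>
  Call \<open>i\<close> and \<open>j\<close> linked if the corner \<open>e i M e j\<close> is nonzero.  This is an equivalence relation, and \<open>r i\<close> is
  the least index linked to \<open>i\<close>.  With partial isometries \<open>v i\<close> from \<open>e (r i)\<close> to \<open>e i\<close> the matrix units are
  \<open>u i j = v i (v j)\<^sup>*\<close> for linked indices and \<open>0\<close> otherwise; going through one representative per class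
  makes them multiplicative.  The last property reads off matrix entries by means of the trace.
\<close>

lemma matrix_units:
  assumes e: "partition_of_unity {..<n} e" and min: "\<And>i. i < n \<Longrightarrow> minimal_projection M (e i)"
    and tau: "\<And>i. i < n \<Longrightarrow> \<tau> (e i) = 1 / of_nat n"
  obtains u and r :: "nat \<Rightarrow> nat" where
    "\<And>i j. i < n \<Longrightarrow> j < n \<Longrightarrow> u i j \<in> M"
    "\<And>i j. i < n \<Longrightarrow> j < n \<Longrightarrow> is_adjoint (u i j) (u j i)"
    "\<And>i. i < n \<Longrightarrow> u i i = e i"
    "\<And>i j. i < n \<Longrightarrow> j < n \<Longrightarrow> r i \<noteq> r j \<Longrightarrow> u i j = 0"
    "\<And>i j k l. i < n \<Longrightarrow> j < n \<Longrightarrow> k < n \<Longrightarrow> l < n \<Longrightarrow>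
       u i j \<cdot> u k l = (if j = k \<and> r i = r j \<and> r k = r l then u i l else 0)"
    "\<And>Y i j. Y \<in> M \<Longrightarrow> i < n \<Longrightarrow> j < n \<Longrightarrow>
       e i \<cdot> Y \<cdot> e j = op_scaleC (of_nat n * \<tau> (Y \<cdot> u j i)) (u i j)"
proof -
  note eD = partition_of_unityD[OF e]
  define linked where "linked i j \<longleftrightarrow> (\<exists>X\<in>M. e i \<cdot> X \<cdot> e j \<noteq> 0)" for i j
  have linked_refl: "linked i i" if "i < n" for i
    unfolding linked_def using that minimal_projectionD(2)[OF min[OF that]]
    by (intro bexI[OF _ id_closed]) (simp add: eD(5))
  have linked_sym: "linked j i" if ij: "linked i j" "i < n" "j < n" for i j
  proof -
    obtain X where X: "X \<in> M" "e i \<cdot> X \<cdot> e j \<noteq> 0" using ij by (auto simp: linked_def)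
    obtain X' where X': "X' \<in> M" "is_adjoint X X'" using adjoint_exists X by blast
    have "is_adjoint (e j \<cdot> X' \<cdot> e i) (e i \<cdot> (X \<cdot> e j))"
      using ij by (intro is_adjoint_compose is_adjoint_sym[OF X'(2)] eD) auto
    then have "e j \<cdot> X' \<cdot> e i \<noteq> 0" using X(2) is_adjoint_unique[OF is_adjoint_zero] by (metis op_assoc)
    then show ?thesis using X'(1) by (auto simp: linked_def)
  qed
  have linked_trans: "linked i k" if ij: "linked i j" and jk: "linked j k" and n: "i < n" "j < n" "k < n" for i j k
  proof -
    obtain X where X: "X \<in> M" "e i \<cdot> X \<cdot> e j \<noteq> 0" using ij by (auto simp: linked_def)
    obtain Y where Y: "Y \<in> M" "e j \<cdot> Y \<cdot> e k \<noteq> 0" using jk by (auto simp: linked_def)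
    obtain v v' where v: "v \<in> M" "v' \<cdot> v = e j" "e i \<cdot> v = v"
      using minimal_partial_isometry[OF min[OF n(1)] min[OF n(2)] X] by metis
    have "e i \<cdot> (v \<cdot> Y) \<cdot> e k \<noteq> 0"
    proof
      assume "e i \<cdot> (v \<cdot> Y) \<cdot> e k = 0"
      then have "v \<cdot> (Y \<cdot> e k) = 0" using v(3) by (metis op_assoc)
      then have "v' \<cdot> v \<cdot> (Y \<cdot> e k) = 0" by (simp add: op_assoc)
      then show False using Y(2) by (simp add: v(2) op_assoc)
    qed
    then show ?thesis using v(1) Y(1) by (auto simp: linked_def intro: compose_closed)
  qed
  define r where "r i = (LEAST j. j < n \<and> linked i j)" for i
  have r: "r i < n \<and> linked i (r i)" if "i < n" for i
    unfolding r_def by (rule LeastI[of _ i]) (use that linked_refl in simp)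
  have r_eq: "r i = r j" if "linked i j" "i < n" "j < n" for i j
  proof -
    have "k < n \<and> linked i k \<longleftrightarrow> k < n \<and> linked j k" for k
      using that linked_sym linked_trans by blast
    then show ?thesis by (simp add: r_def)
  qed
  have "\<forall>i\<in>{..<n}. \<exists>p. fst p \<in> M \<and> snd p \<in> M \<and> is_adjoint (fst p) (snd p) \<and>
      snd p \<cdot> fst p = e (r i) \<and> fst p \<cdot> snd p = e i \<and> e i \<cdot> fst p = fst p \<and> fst p \<cdot> e (r i) = fst p"
  proof
    fix i assume "i \<in> {..<n}"
    then have i: "i < n" by simp
    with r obtain X where X: "X \<in> M" "e i \<cdot> X \<cdot> e (r i) \<noteq> 0" by (auto simp: linked_def)
    show "\<exists>p. fst p \<in> M \<and> snd p \<in> M \<and> is_adjoint (fst p) (snd p) \<and>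
      snd p \<cdot> fst p = e (r i) \<and> fst p \<cdot> snd p = e i \<and> e i \<cdot> fst p = fst p \<and> fst p \<cdot> e (r i) = fst p"
      using minimal_partial_isometry[OF min[OF i] min X] r[OF i] by (metis fst_conv snd_conv)
  qed
  then obtain p where p: "\<And>i. i < n \<Longrightarrow> fst (p i) \<in> M \<and> snd (p i) \<in> M \<and> is_adjoint (fst (p i)) (snd (p i)) \<and>
      snd (p i) \<cdot> fst (p i) = e (r i) \<and> fst (p i) \<cdot> snd (p i) = e i \<and> e i \<cdot> fst (p i) = fst (p i) \<and>
      fst (p i) \<cdot> e (r i) = fst (p i)"
    by (metis (no_types, lifting) bchoice lessThan_iff)
  define v v' where "v i = fst (p i)" and "v' i = snd (p i)" for i
  have v: "v i \<in> M" "v' i \<in> M" "is_adjoint (v i) (v' i)" "v' i \<cdot> v i = e (r i)" "v i \<cdot> v' i = e i"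
    "e i \<cdot> v i = v i" "v i \<cdot> e (r i) = v i" if "i < n" for i
    using p[OF that] by (auto simp: v_def v'_def)
  have v': "v' i \<cdot> e i = v' i" "e (r i) \<cdot> v' i = v' i" if i: "i < n" for i
  proof -
    have "is_adjoint (e i \<cdot> v i) (v' i \<cdot> e i)" "is_adjoint (v i \<cdot> e (r i)) (e (r i) \<cdot> v' i)"
      using i r[OF i] by (intro is_adjoint_compose v eD; simp)+
    then show "v' i \<cdot> e i = v' i" "e (r i) \<cdot> v' i = v' i"
      using v[OF i] is_adjoint_unique by metis+
  qed
  have v'v: "v' j \<cdot> v k = (if j = k then e (r j) else 0)" if "j < n" "k < n" for j k
  proof (cases "j = k")
    case False
    have "v' j \<cdot> v k = (v' j \<cdot> e j) \<cdot> (e k \<cdot> v k)" using that by (simp add: v v')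
    also have "\<dots> = v' j \<cdot> (e j \<cdot> (e k \<cdot> v k))" by (simp only: op_assoc)
    also have "\<dots> = 0" by (subst eD(6)) (use that False in auto)
    finally show ?thesis using False by simp
  qed (use that v in simp)
  define u where "u i j = (if r i = r j then v i \<cdot> v' j else 0)" for i j
  have u_M: "u i j \<in> M" if "i < n" "j < n" for i j
    using that by (auto simp: u_def intro: compose_closed v)
  have u_adj: "is_adjoint (u i j) (u j i)" if "i < n" "j < n" for i j
    using that by (auto simp: u_def intro!: is_adjoint_compose v is_adjoint_sym[OF v(3)])
  have u_id: "u i i = e i" if "i < n" for i using v(5)[OF that] by (simp add: u_def)
  have u_0: "u i j = 0" if "r i \<noteq> r j" for i j using that by (simp add: u_def)
  have u_u: "u i j \<cdot> u k l = (if j = k \<and> r i = r j \<and> r k = r l then u i l else 0)"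
    if "i < n" "j < n" "k < n" "l < n" for i j k l
  proof (cases "r i = r j \<and> r k = r l")
    case True
    have "u i j \<cdot> u k l = v i \<cdot> ((v' j \<cdot> v k) \<cdot> v' l)" using True by (simp add: u_def op_assoc)
    also have "\<dots> = (if j = k then u i l else 0)"
      unfolding v'v[OF that(2,3)] using True v'(2)[OF that(4)] by (auto simp: u_def)
    finally show ?thesis using True by auto
  qed (auto simp: u_0)
  have u_trace: "\<tau> (u i i) = 1 / of_nat n" if "i < n" for i using u_id tau that by simp
  have coeff: "e i \<cdot> Y \<cdot> e j = op_scaleC (of_nat n * \<tau> (Y \<cdot> u j i)) (u i j)"
    if Y: "Y \<in> M" and ij: "i < n" "j < n" for Y i j
  proof (cases "r i = r j")
    case False
    then have "\<not> linked i j" using r_eq ij by blast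
    then have "e i \<cdot> Y \<cdot> e j = 0" using Y by (auto simp: linked_def)
    then show ?thesis using False by (simp add: u_0 op_scaleC_simps)
  next
    case True
    have lin: "complex_linear (v i)" using linear v ij by blast
    have "v' i \<cdot> Y \<cdot> v j \<in> M" by (intro closed_intros v Y ij)
    from minimal_compress[OF min this, of "r i"] r[OF ij(1)] obtain c where
      c: "e (r i) \<cdot> (v' i \<cdot> Y \<cdot> v j) \<cdot> e (r i) = op_scaleC c (e (r i))" by blast
    have "e (r i) \<cdot> (v' i \<cdot> Y \<cdot> v j) \<cdot> e (r i) = (e (r i) \<cdot> v' i) \<cdot> Y \<cdot> (v j \<cdot> e (r j))"
      using True by (simp add: op_assoc)
    then have c': "v' i \<cdot> Y \<cdot> v j = op_scaleC c (e (r i))"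
      using ij by (simp add: c v v')
    have "e i \<cdot> Y \<cdot> e j = v i \<cdot> (v' i \<cdot> Y \<cdot> v j) \<cdot> v' j"
      unfolding v(5)[OF ij(1), symmetric] v(5)[OF ij(2), symmetric] by (simp only: op_assoc)
    also have "\<dots> = op_scaleC c (u i j)"
      unfolding c' using True v'(2)[OF ij(2)]
      by (simp add: op_scaleC_right[OF lin] op_scaleC_simps u_def op_assoc)
    finally have eq: "e i \<cdot> Y \<cdot> e j = op_scaleC c (u i j)" .
    have uji: "u j i = e j \<cdot> u j i \<cdot> e i"
      using ij by (simp add: u_id[symmetric] u_u) (simp add: u_0)
    have "\<tau> (Y \<cdot> u j i) = \<tau> ((Y \<cdot> e j \<cdot> u j i) \<cdot> e i)"
      by (subst uji) (simp only: op_assoc)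
    also have "\<dots> = \<tau> (e i \<cdot> (Y \<cdot> e j \<cdot> u j i))"
      using ij by (intro trace_commute closed_intros Y eD u_M) auto
    also have "\<dots> = \<tau> ((e i \<cdot> Y \<cdot> e j) \<cdot> u j i)" by (simp only: op_assoc)
    also have "\<dots> = c * \<tau> (e i)"
      using ij True by (simp add: eq op_scaleC_simps u_u trace_scaleC u_id eD)
    finally show ?thesis using eq tau[OF ij(1)] ij by simp
  qed
  show thesis by (rule that[OF u_M u_adj u_id u_0 u_u coeff])
qed

text \<open>
  A minimal projection has a nonzero corner with some member of the partition, and a nonzero corner between
  minimal projections forces equal traces.
\<close>

lemma minimal_traces_const:
  assumes e: "partition_of_unity {..<n} e" "\<And>i. i < n \<Longrightarrow> minimal_projection M (e i)"
    and tau: "\<And>i. i < n \<Longrightarrow> \<tau> (e i) = t" and E: "minimal_projection M E"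
  shows "\<tau> E = t"
proof -
  have "\<exists>i<n. E \<cdot> e i \<noteq> 0"
  proof (rule ccontr)
    assume *: "\<not> (\<exists>i<n. E \<cdot> e i \<noteq> 0)"
    have "E = E \<cdot> (\<Sum>i<n. e i)" using partition_of_unityD(7)[OF e(1)] by simp
    also have "\<dots> = 0" unfolding op_sum_right using * by (intro sum.neutral) auto
    finally show False using minimal_projectionD(2)[OF E] by simp
  qed
  then obtain i where i: "i < n" "E \<cdot> e i \<noteq> 0" by blast
  then show ?thesis
    using minimal_trace_eq[OF E e(2)[OF i(1)] id_closed] tau[OF i(1)] by simp
qed

lemma finite_dimensional_unit_partition:
  assumes fd: "finite_dimensional M"
    and eq: "\<And>E F. minimal_projection M E \<Longrightarrow> minimal_projection M F \<Longrightarrow> \<tau> E = \<tau> F"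
  obtains e and n :: nat where "n > 0" "partition_of_unity {..<n} e"
    "\<And>i. i < n \<Longrightarrow> minimal_projection M (e i)" "\<And>i. i < n \<Longrightarrow> \<tau> (e i) = 1 / of_nat n"
proof -
  obtain K where K: "\<And>P. orthogonal_projections P \<Longrightarrow> card P \<le> K"
    using finite_dimensional_bound[OF fd] by blast
  obtain e and n :: nat where e: "partition_of_unity {..<n} e"
    "\<And>i. i < n \<Longrightarrow> minimal_projection M (e i)"
    using minimal_diagonalization[OF K id_closed is_adjoint_id] by blast
  show thesis by (rule that[OF _ e]) (use equal_trace_minimal_partition[OF e eq] in auto)
qed

end

section \<open>Projections of prescribed trace in diffuse algebras\<close>

lemma (in star_algebra) projection_norm_le: "projection_in M E \<Longrightarrow> norm (E x) \<le> norm x"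
proof -
  assume E: "projection_in M E"
  have "(norm (E x))\<^sup>2 = inner (E x) x" using projectionD(6)[OF E] by simp
  also have "\<dots> \<le> norm (E x) * norm x" by (rule norm_cauchy_schwarz)
  finally show ?thesis
    by (cases "E x = 0") (auto simp: power2_eq_square)
qed

context tracial_algebra begin

text \<open>
  The strong limit of an increasing sequence of projections is its least upper bound among the self-adjoint
  elements, so that normality applies to it.
\<close>

lemma increasing_projections_limit:
  assumes normal: "normal_on M \<tau>" and Q: "\<And>n. projection_in M (Q n)"
    and inc: "\<And>n. Q (Suc n) \<cdot> Q n = Q n"
  obtains R where "projection_in M R" "\<And>n. R \<cdot> Q n = Q n"
    "\<And>P. (\<And>n. P \<cdot> Q n = Q n) \<Longrightarrow> P \<cdot> R = R" "(\<lambda>n. tr (Q n)) \<longlonglongrightarrow> tr R"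
proof -
  note QD = projectionD[OF Q]
  have mono: "Q m \<cdot> Q n = Q n" if "n \<le> m" for n m
    using that
  proof (induction rule: dec_induct)
    case (step k)
    have "Q (Suc k) \<cdot> (Q k \<cdot> Q n) = Q k \<cdot> Q n" by (simp only: inc flip: op_assoc)
    then show ?case using step by simp
  qed (rule QD(3))
  have mono': "Q n \<cdot> Q m = Q n" if "n \<le> m" for n m
    using projection_sub_commute(1)[OF Q Q mono[OF that]] .
  have diff: "(norm (Q m x - Q n x))\<^sup>2 \<le> (norm (Q m x))\<^sup>2 - (norm (Q n x))\<^sup>2" if "n \<le> m" for n m x
  proof -
    have "projection_in M (Q m - Q n)" by (rule projection_diff[OF Q Q mono[OF that]])
    from projectionD(6)[OF this, of x] show ?thesis
      by (simp add: blinfun.diff_left inner_diff_left QD(6))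
  qed
  have bound: "norm (Q n) \<le> 1" for n
    by (rule norm_blinfun_bound) (use projection_norm_le[OF Q] in auto)
  have "Cauchy (\<lambda>n. Q n x)" for x
    by (rule Cauchy_increasing_norms[OF diff projection_norm_le[OF Q]])
  from strong_limit[of Q 1, OF QD(1) bound this]
  obtain R where R: "R \<in> M" "\<And>x. (\<lambda>n. Q n x) \<longlonglongrightarrow> R x" by blast
  have R_adj: "is_adjoint R R"
  proof (rule is_adjointI_inner[OF linear[OF R(1)]])
    fix x y
    have "(\<lambda>n. inner (Q n x) y) \<longlonglongrightarrow> inner (R x) y" "(\<lambda>n. inner x (Q n y)) \<longlonglongrightarrow> inner x (R y)"
      by (intro tendsto_intros R(2))+
    then show "inner (R x) y = inner x (R y)"
      using LIMSEQ_unique unfolding is_adjoint_inner[OF QD(2)] by blast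
  qed
  have "R \<cdot> R = R"
  proof (rule blinfun_eqI)
    fix x
    have "(\<lambda>n. Q n (Q n x)) \<longlonglongrightarrow> R (R x)"
      by (rule strong_limit_apply[OF R(2) bound R(2)])
    then have "(\<lambda>n. Q n x) \<longlonglongrightarrow> R (R x)"
      unfolding QD(5) .
    from LIMSEQ_unique[OF this R(2)] show "(R \<cdot> R) x = R x" by simp
  qed
  then have R_proj: "projection_in M R" using R(1) R_adj by (simp add: projection_in_def)
  have RQ: "R \<cdot> Q n = Q n" for n
  proof (rule blinfun_eqI)
    fix x
    have "\<forall>\<^sub>F m in sequentially. Q m (Q n x) = Q n x"
    proof (rule eventually_sequentiallyI)
      show "Q m (Q n x) = Q n x" if "n \<le> m" for m
        using blinfun_apply_blinfun_compose[of "Q m" "Q n" x] unfolding mono[OF that] by simp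
    qed
    then have "(\<lambda>m. Q m (Q n x)) \<longlonglongrightarrow> Q n x" by (rule tendsto_eventually)
    from LIMSEQ_unique[OF R(2) this] show "(R \<cdot> Q n) x = Q n x" by simp
  qed
  have least: "P \<cdot> R = R" if P: "\<And>n. P \<cdot> Q n = Q n" for P
  proof (rule blinfun_eqI)
    fix x
    have "P (Q n x) = Q n x" for n
      using blinfun_apply_blinfun_compose[of P "Q n" x] unfolding P by simp
    then have "(\<lambda>n. Q n x) \<longlonglongrightarrow> P (R x)"
      using blinfun.tendsto[OF tendsto_const R(2), of P x] by simp
    from LIMSEQ_unique[OF this R(2)] show "(P \<cdot> R) x = R x" by simp
  qed
  have le: "op_le (Q n) (Q m)" if "n \<le> m" for n m
    using op_le_projection_iff[OF Q Q] mono[OF that] by blast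
  have "is_op_sup M (range Q) R"
    unfolding is_op_sup_def
  proof (intro conjI ballI impI R R_adj)
    show "op_le A R" if "A \<in> range Q" for A
      using that op_le_projection_iff[OF R_proj Q] RQ by auto
    fix B assume B: "B \<in> M" "is_adjoint B B \<and> (\<forall>A\<in>range Q. op_le A B)"
    have "inner (R x) x \<le> inner (B x) x" for x
    proof (rule LIMSEQ_le_const2)
      show "(\<lambda>n. inner (Q n x) x) \<longlonglongrightarrow> inner (R x) x" by (intro tendsto_intros R(2))
      have "positive_op (B - Q n)" for n using B(2) by (auto simp: op_le_def)
      then have "inner (Q n x) x \<le> inner (B x) x" for n
        using positive_op_iff[OF is_adjoint_diff[OF _ QD(2)]] B(2)
        by (simp add: blinfun.diff_left inner_diff_left)
      then show "\<exists>N. \<forall>n\<ge>N. inner (Q n x) x \<le> inner (B x) x" by blast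
    qed
    then show "op_le R B"
      using positive_op_iff[OF is_adjoint_diff[OF _ R_adj]] B(2)
      by (simp add: op_le_def blinfun.diff_left inner_diff_left)
  qed
  moreover have "\<forall>A\<in>range Q. \<forall>B\<in>range Q. \<exists>C\<in>range Q. op_le A C \<and> op_le B C"
  proof clarify
    fix i j
    show "\<exists>C\<in>range Q. op_le (Q i) C \<and> op_le (Q j) C"
      using le[of i "max i j"] le[of j "max i j"] by auto
  qed
  moreover have "range Q \<subseteq> {A \<in> M. is_adjoint A A}" using QD(1,2) by blast
  ultimately have "Re (\<tau> R) = (SUP A\<in>range Q. Re (\<tau> A))"
    using normal unfolding normal_on_def by blast
  then have "tr R = (SUP n. tr (Q n))"
    by (simp add: tr_def image_image)
  moreover have "(\<lambda>n. tr (Q n)) \<longlonglongrightarrow> (SUP n. tr (Q n))"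
  proof (rule LIMSEQ_incseq_SUP)
    show "bdd_above (range (\<lambda>n. tr (Q n)))"
      by (rule bdd_aboveI2[of _ _ 1]) (rule trace_projection(4)[OF Q])
    show "incseq (\<lambda>n. tr (Q n))"
    proof (rule incseq_SucI)
      fix n
      have "projection_in M (Q (Suc n) - Q n)" by (rule projection_diff[OF Q Q inc])
      from trace_projection(2)[OF this] show "tr (Q n) \<le> tr (Q (Suc n))"
        by (simp add: tr_simps QD(1))
    qed
  qed
  ultimately show thesis using that[OF R_proj RQ least] by simp
qed

text \<open>
  A projection that is not minimal splits into two nonzero parts, one of which has at most half the trace.
\<close>

lemma small_subprojection:
  assumes df: "diffuse M" and P: "projection_in M P" "P \<noteq> 0" and "0 < \<epsilon>"
  obtains Q where "projection_in M Q" "P \<cdot> Q = Q" "0 < tr Q" "tr Q \<le> \<epsilon>"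
proof -
  have pos: "0 < tr Q" if "projection_in M Q" "Q \<noteq> 0" for Q
    using trace_projection(2,3)[OF that(1)] that(2) by fastforce
  have "\<exists>Q. projection_in M Q \<and> P \<cdot> Q = Q \<and> Q \<noteq> 0 \<and> tr Q \<le> (1/2) ^ n" for n
  proof (induction n)
    case 0
    show ?case using P trace_projection(4)[OF P(1)] projectionD(3)[OF P(1)] by auto
  next
    case (Suc n)
    then obtain Q where Q: "projection_in M Q" "P \<cdot> Q = Q" "Q \<noteq> 0" "tr Q \<le> (1/2) ^ n" by blast
    have "\<not> minimal_projection M Q" using df by (simp add: diffuse_def)
    then obtain G where G: "projection_in M G" "Q \<cdot> G = G" "G \<noteq> 0" "G \<noteq> Q"
      using Q(1,3) op_le_projection_iff[OF Q(1)] by (auto simp: minimal_projection_def)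
    have G': "projection_in M (Q - G)" by (rule projection_diff[OF Q(1) G(1,2)])
    have PG: "P \<cdot> G = G" using Q(2) G(2) op_assoc[of P Q G] by simp
    have sum: "tr G + tr (Q - G) = tr Q"
      by (simp add: tr_simps projectionD(1)[OF G(1)] projectionD(1)[OF Q(1)])
    show ?case
    proof (cases "tr G \<le> tr (Q - G)")
      case True
      then show ?thesis using G PG sum Q(4) by (intro exI[of _ G]) auto
    next
      case False
      then show ?thesis using G' G(4) Q(2,4) PG sum
        by (intro exI[of _ "Q - G"]) (auto simp: op_simps)
    qed
  qed
  moreover obtain n where "(1/2::real) ^ n < \<epsilon>"
    using real_arch_pow_inv[OF \<open>0 < \<epsilon>\<close>, of "1/2"] by auto
  ultimately show thesis using that pos by (meson less_imp_le order_trans)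
qed

text \<open>
  A greedy exhaustion: each step adds a subprojection whose trace is at least half of what is attainable
  without exceeding \<open>t\<close>.  If the limit had trace less than \<open>t\<close>, a small projection in the remainder would be a
  candidate at every step, and the increments, which tend to zero, would dominate half its trace.
\<close>

lemma subprojection_of_trace:
  assumes normal: "normal_on M \<tau>" and df: "diffuse M"
    and P: "projection_in M P" and t: "0 \<le> t" "t \<le> tr P"
  obtains Q where "projection_in M Q" "P \<cdot> Q = Q" "tr Q = t"
proof -
  define ok where "ok Q \<longleftrightarrow> projection_in M Q \<and> P \<cdot> Q = Q \<and> tr Q \<le> t" for Q
  \<comment> \<open>\<open>cand Q\<close> are the projections that can still be added to \<open>Q\<close>.\<close>
  define cand where "cand Q = {R. projection_in M R \<and> P \<cdot> R = R \<and> Q \<cdot> R = 0 \<and> tr Q + tr R \<le> t}" for Q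
  define greedy where "greedy Q Q' \<longleftrightarrow> Q' \<cdot> Q = Q \<and> (\<forall>R\<in>cand Q. tr R \<le> 2 * (tr Q' - tr Q))" for Q Q'
  have step: "\<exists>Q'. ok Q' \<and> greedy Q Q'" if Q: "ok Q" for Q
  proof -
    \<comment> \<open>The supremum may not be attained; a candidate reaching half of it suffices.\<close>
    define s where "s = (SUP R\<in>cand Q. tr R)"
    have "0 \<in> cand Q" using Q by (simp add: cand_def ok_def tr_simps)
    have bdd: "bdd_above (tr ` cand Q)"
      by (rule bdd_aboveI2[of _ _ 1]) (use trace_projection(4) in \<open>auto simp: cand_def\<close>)
    have up: "tr R \<le> s" if "R \<in> cand Q" for R
      unfolding s_def using that bdd by (rule cSUP_upper)
    have s0: "0 \<le> s" using up[OF \<open>0 \<in> cand Q\<close>] by (simp add: tr_simps)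
    have "\<exists>R\<in>cand Q. s \<le> 2 * tr R"
    proof (cases "s = 0")
      case True
      then show ?thesis using \<open>0 \<in> cand Q\<close> by (intro bexI[of _ 0]) (auto simp: tr_simps)
    next
      case False
      then have "s / 2 < (SUP R\<in>cand Q. tr R)" using s0 by (simp flip: s_def)
      then obtain R where "R \<in> cand Q" "s / 2 < tr R"
        using less_cSUP_iff[OF _ bdd] \<open>0 \<in> cand Q\<close> by blast
      then show ?thesis by (intro bexI[of _ R]) auto
    qed
    then obtain R where R: "R \<in> cand Q" "s \<le> 2 * tr R" by blast
    have R': "projection_in M R" "P \<cdot> R = R" "Q \<cdot> R = 0" "tr Q + tr R \<le> t"
      using R(1) by (auto simp: cand_def)
    have Q': "projection_in M Q" "P \<cdot> Q = Q" using Q by (auto simp: ok_def)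
    have trs: "tr (Q + R) = tr Q + tr R"
      by (rule tr_simps) (use R'(1) Q'(1) in \<open>auto simp: projection_in_def\<close>)
    have "ok (Q + R)"
      unfolding ok_def using projection_add[OF Q'(1) R'(1,3)] Q'(2) R'(2,4) trs by (simp add: op_simps)
    moreover have "greedy Q (Q + R)"
      unfolding greedy_def
    proof (intro conjI ballI)
      show "(Q + R) \<cdot> Q = Q"
        using projectionD(3)[OF Q'(1)] projection_sub_commute(3)[OF Q'(1) R'(1,3)] by (simp add: op_simps)
      show "tr S \<le> 2 * (tr (Q + R) - tr Q)" if "S \<in> cand Q" for S
        using up[OF that] R(2) trs by simp
    qed
    ultimately show ?thesis by blast
  qed
  have "ok 0" using t by (simp add: ok_def tr_simps)
  then have "\<exists>Q. \<forall>n. ok (Q n) \<and> greedy (Q n) (Q (Suc n))"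
    using step by (intro dependent_nat_choice) auto
  then obtain Q where Q: "\<And>n. ok (Q n)" "\<And>n. greedy (Q n) (Q (Suc n))" by blast
  have QP: "projection_in M (Q n)" "P \<cdot> Q n = Q n" "tr (Q n) \<le> t" for n
    using Q(1)[of n] by (auto simp: ok_def)
  have inc: "Q (Suc n) \<cdot> Q n = Q n" for n using Q(2)[of n] by (simp add: greedy_def)
  obtain R where R: "projection_in M R" "\<And>n. R \<cdot> Q n = Q n"
    "\<And>P. (\<And>n. P \<cdot> Q n = Q n) \<Longrightarrow> P \<cdot> R = R" "(\<lambda>n. tr (Q n)) \<longlonglongrightarrow> tr R"
    using increasing_projections_limit[of Q, OF normal QP(1) inc] by blast
  have PR: "P \<cdot> R = R" by (rule R(3)[OF QP(2)])
  have QR: "Q n \<cdot> R = Q n" for n by (rule projection_sub_commute(1)[OF R(1) QP(1) R(2)])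
  have "tr R \<le> t" by (rule LIMSEQ_le_const2[OF R(4)]) (use QP(3) in blast)
  moreover have "\<not> tr R < t"
  proof
    assume less: "tr R < t"
    have PRp: "projection_in M (P - R)" by (rule projection_diff[OF P R(1) PR])
    have "P - R \<noteq> 0" using less t by auto
    then obtain S where S: "projection_in M S" "(P - R) \<cdot> S = S" "0 < tr S" "tr S \<le> t - tr R"
      using small_subprojection[OF df PRp] less by (metis diff_gt_0_iff_gt)
    have RS: "R \<cdot> S = 0"
    proof -
      have "R \<cdot> P = R" by (rule projection_sub_commute(1)[OF P R(1) PR])
      then have "R \<cdot> (P - R) = 0" by (simp add: op_simps projectionD(3)[OF R(1)])
      then show ?thesis using S(2) op_assoc[of R "P - R" S] by simp
    qed
    then have PS: "P \<cdot> S = S" using S(2) by (simp add: op_simps)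
    have trR: "tr (Q n) \<le> tr R" for n
    proof -
      have "projection_in M (R - Q n)" by (rule projection_diff[OF R(1) QP(1) R(2)])
      from trace_projection(2)[OF this] show ?thesis
        by (simp add: tr_simps projectionD(1)[OF R(1)] projectionD(1)[OF QP(1)])
    qed
    have "S \<in> cand (Q n)" for n
    proof -
      have "Q n \<cdot> S = 0" using RS QR[of n] op_assoc[of "Q n" R S] by simp
      then show ?thesis using S(1,4) PS trR[of n] by (simp add: cand_def)
    qed
    then have "tr S \<le> 2 * (tr (Q (Suc n)) - tr (Q n))" for n
      using Q(2)[of n] by (simp add: greedy_def)
    moreover have "(\<lambda>n. 2 * (tr (Q (Suc n)) - tr (Q n))) \<longlonglongrightarrow> 2 * (tr R - tr R)"
      by (intro tendsto_intros R(4) LIMSEQ_Suc[OF R(4)])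
    ultimately have "tr S \<le> 2 * (tr R - tr R)"
      by (intro LIMSEQ_le_const[of _ _ "tr S"]) auto
    then show False using S(3) by simp
  qed
  ultimately show thesis using that[OF R(1) PR] by simp
qed

lemma equal_trace_partition:
  assumes normal: "normal_on M \<tau>" and df: "diffuse M" and "n > 0"
  obtains G where "partition_of_unity {..<n} G" "\<And>i. i < n \<Longrightarrow> tr (G i) = 1 / real n"
proof -
  have "\<exists>G. (\<forall>i<k. projection_in M (G i) \<and> tr (G i) = s \<and> P \<cdot> G i = G i) \<and>
      (\<forall>i<k. \<forall>j<k. i \<noteq> j \<longrightarrow> G i \<cdot> G j = 0) \<and> (\<Sum>i<k. G i) = P"
    if "projection_in M P" "tr P = real k * s" "0 \<le> s" for P k s
    using that
  proof (induction k arbitrary: P)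
    case 0
    then show ?case using trace_projection(3)[OF 0(1)] by simp
  next
    case (Suc k)
    have "tr P = s + real k * s" using Suc.prems(2) by (simp add: algebra_simps)
    then have "s \<le> tr P" using Suc.prems(3) by simp
    then obtain Q where Q: "projection_in M Q" "P \<cdot> Q = Q" "tr Q = s"
      using subprojection_of_trace[OF normal df Suc.prems(1,3)] by metis
    have PQ: "projection_in M (P - Q)" by (rule projection_diff[OF Suc.prems(1) Q(1,2)])
    have "tr (P - Q) = real k * s"
      using Suc.prems Q by (simp add: tr_simps projection_in_def algebra_simps)
    from Suc.IH[OF PQ this Suc.prems(3)] obtain G where G:
      "\<And>i. i < k \<Longrightarrow> projection_in M (G i) \<and> tr (G i) = s \<and> (P - Q) \<cdot> G i = G i"
      "\<And>i j. i < k \<Longrightarrow> j < k \<Longrightarrow> i \<noteq> j \<Longrightarrow> G i \<cdot> G j = 0" "(\<Sum>i<k. G i) = P - Q" by blast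
    have QG: "Q \<cdot> G i = 0" if "i < k" for i
    proof -
      have "Q \<cdot> (P - Q) = 0"
        using projection_sub_commute(1)[OF Suc.prems(1) Q(1,2)] projectionD(3)[OF Q(1)] by (simp add: op_simps)
      then show ?thesis using G(1)[OF that] op_assoc[of Q "P - Q" "G i"] by simp
    qed
    have GQ: "G i \<cdot> Q = 0" if "i < k" for i
      using projection_sub_commute(3)[OF Q(1) _ QG[OF that]] G(1)[OF that] by blast
    have PG: "P \<cdot> G i = G i" if "i < k" for i
      using G(1)[OF that] QG[OF that] by (simp add: op_simps)
    show ?case
      by (rule exI[of _ "G(k := Q)"])
        (use G Q QG GQ PG in \<open>auto simp: less_Suc_eq\<close>)
  qed
  from this[OF projection_id, of n "1 / real n"] \<open>n > 0\<close>
  obtain G where "\<forall>i<n. projection_in M (G i) \<and> tr (G i) = 1 / real n"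
    "\<forall>i<n. \<forall>j<n. i \<noteq> j \<longrightarrow> G i \<cdot> G j = 0" "(\<Sum>i<n. G i) = id_blinfun"
    by (auto simp: tr_simps)
  then show thesis using that[of G] by (auto simp: partition_of_unity_def)
qed

end

section \<open>Binary trees of projections\<close>

text \<open>
  Nodes of the infinite binary tree are words; the head is the most recent branching, and the tail is the
  parent.
\<close>

definition words :: "nat \<Rightarrow> bool list set" where
  "words m = {w. length w = m}"

lemma words_0 [simp]: "words 0 = {[]}"
  by (auto simp: words_def)

lemma words_Suc: "words (Suc m) = (#) True ` words m \<union> (#) False ` words m"
  by (auto simp: words_def length_Suc_conv image_iff)

lemma finite_words [simp]: "finite (words m)"
  by (induction m) (auto simp: words_Suc)

lemma sum_words_Suc: "(\<Sum>w\<in>words (Suc m). f w) = (\<Sum>w\<in>words m. f (True # w) + f (False # w))"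
proof -
  have "(\<Sum>w\<in>words (Suc m). f w) = (\<Sum>w\<in>(#) True ` words m. f w) + (\<Sum>w\<in>(#) False ` words m. f w)"
    unfolding words_Suc by (rule sum.union_disjoint) auto
  also have "\<dots> = (\<Sum>w\<in>words m. f (True # w)) + (\<Sum>w\<in>words m. f (False # w))"
    by (simp add: sum.reindex inj_on_def)
  finally show ?thesis by (simp add: sum.distrib)
qed

text \<open>
  The left end point of the dyadic interval of a node, where \<open>True\<close> selects the upper half.
\<close>

primrec binary_value :: "bool list \<Rightarrow> real" where
  "binary_value [] = 0"
| "binary_value (b # w) = binary_value w + (if b then 1 / 2 ^ Suc (length w) else 0)"

lemma binary_value_bounds: "0 \<le> binary_value w" "binary_value w + 1 / 2 ^ length w \<le> 1"
proof -
  show "0 \<le> binary_value w" by (induction w) auto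
  show "binary_value w + 1 / 2 ^ length w \<le> 1"
    by (induction w) (auto simp: field_simps)
qed

primrec split_tree :: "(bool list \<Rightarrow> 'a \<Rightarrow> 'a::minus) \<Rightarrow> 'a \<Rightarrow> bool list \<Rightarrow> 'a" where
  "split_tree s a [] = a"
| "split_tree s a (b # w) =
    (if b then s w (split_tree s a w) else split_tree s a w - s w (split_tree s a w))"

lemma geometric_limit:
  fixes f :: "nat \<Rightarrow> 'a::banach"
  assumes step: "\<And>m. norm (f (Suc m) - f m) \<le> 1 / 2 ^ Suc m"
  obtains L where "f \<longlonglongrightarrow> L" "\<And>m. norm (L - f m) \<le> 1 / 2 ^ m"
proof -
  have bound: "norm (f (m + j) - f m) \<le> 1 / 2 ^ m - 1 / 2 ^ (m + j)" for m j
  proof (induction j)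
    case (Suc j)
    have "norm (f (m + Suc j) - f m) \<le> norm (f (m + Suc j) - f (m + j)) + norm (f (m + j) - f m)"
      using norm_triangle_ineq[of "f (m + Suc j) - f (m + j)" "f (m + j) - f m"] by simp
    also have "\<dots> \<le> 1 / 2 ^ Suc (m + j) + (1 / 2 ^ m - 1 / 2 ^ (m + j))"
      using step[of "m + j"] Suc by simp
    also have "\<dots> = 1 / 2 ^ m - 1 / 2 ^ (m + Suc j)" by (simp add: field_simps)
    finally show ?case .
  qed simp
  have le: "norm (f k - f m) \<le> 1 / 2 ^ m" if "m \<le> k" for m k
  proof -
    have "norm (f k - f m) \<le> 1 / 2 ^ m - 1 / 2 ^ k" using bound[of m "k - m"] that by simp
    also have "\<dots> \<le> 1 / 2 ^ m" by simp
    finally show ?thesis .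
  qed
  have "Cauchy f"
  proof (rule CauchyI')
    fix e :: real assume "0 < e"
    then obtain N where N: "(1/2::real) ^ N < e" using real_arch_pow_inv[of e "1/2"] by auto
    have "dist (f m) (f n) < e" if "N \<le> m" "m < n" for m n
    proof -
      have "dist (f m) (f n) \<le> 1 / 2 ^ m" using le[of m n] that by (simp add: dist_norm norm_minus_commute)
      also have "\<dots> \<le> 1 / 2 ^ N" using that(1) by (simp add: frac_le power_increasing)
      also have "\<dots> < e" using N by (simp add: power_one_over)
      finally show ?thesis .
    qed
    then show "\<exists>M. \<forall>m\<ge>M. \<forall>n>m. dist (f m) (f n) < e" by blast
  qed
  then obtain L where L: "f \<longlonglongrightarrow> L" by (auto simp: Cauchy_convergent_iff convergent_def)
  show thesis
  proof (rule that[OF L])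
    fix m
    show "norm (L - f m) \<le> 1 / 2 ^ m"
    proof (rule LIMSEQ_le_const2)
      show "(\<lambda>k. norm (f k - f m)) \<longlonglongrightarrow> norm (L - f m)" by (intro tendsto_intros L)
    qed (use le in blast)
  qed
qed

context star_algebra begin

definition projection_tree :: "(bool list \<Rightarrow> ('h \<Rightarrow>\<^sub>L 'h)) \<Rightarrow> bool" where
  "projection_tree p \<longleftrightarrow> (\<forall>w. projection_in M (p w) \<and> p w \<cdot> p (True # w) = p (True # w) \<and>
     p (False # w) = p w - p (True # w))"

lemma projection_treeD:
  assumes "projection_tree p"
  shows "projection_in M (p w)" "p w \<cdot> p (b # w) = p (b # w)" "p (b # w) \<cdot> p w = p (b # w)"
    "p (False # w) = p w - p (True # w)"
proof -
  show *: "projection_in M (p w)" for w using assms by (simp add: projection_tree_def)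
  show F: "p (False # w) = p w - p (True # w)" using assms by (simp add: projection_tree_def)
  have T: "p w \<cdot> p (True # w) = p (True # w)" using assms by (simp add: projection_tree_def)
  show "p w \<cdot> p (b # w) = p (b # w)"
    by (cases b) (simp_all add: T F op_simps projectionD(3)[OF *])
  then show "p (b # w) \<cdot> p w = p (b # w)" by (rule projection_sub_commute(1)[OF * *])
qed

lemma projection_tree_orthogonal:
  assumes p: "projection_tree p"
  shows "length u = length v \<Longrightarrow> u \<noteq> v \<Longrightarrow> p u \<cdot> p v = 0"
proof (induction u v rule: list_induct2')
  case (4 b u c v)
  note pD = projection_treeD[OF p]
  show ?case
  proof (cases "u = v")
    case True
    have "p (True # u) \<cdot> p (False # u) = 0"
      by (simp add: pD(4) op_simps pD(3) projectionD(3)[OF pD(1)])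
    moreover from this have "p (False # u) \<cdot> p (True # u) = 0"
      by (rule projection_sub_commute(3)[OF pD(1) pD(1)])
    ultimately show ?thesis using 4 True by (cases b; cases c) auto
  next
    case False
    have "p (b # u) \<cdot> p (c # v) = (p (b # u) \<cdot> p u) \<cdot> (p v \<cdot> p (c # v))"
      by (simp only: pD(2,3))
    also have "\<dots> = p (b # u) \<cdot> ((p u \<cdot> p v) \<cdot> p (c # v))" by (simp only: op_assoc)
    finally show ?thesis using 4 False by simp
  qed
qed auto

lemma projection_tree_sum:
  assumes "projection_tree p"
  shows "(\<Sum>w\<in>words m. p w) = p []"
  by (induction m) (auto simp: sum_words_Suc projection_treeD(4)[OF assms])

lemma projection_tree_partition:
  assumes "projection_tree p" "p [] = id_blinfun"
  shows "partition_of_unity (words m) p"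
  unfolding partition_of_unity_def
  using projection_tree_sum[OF assms(1)] projection_treeD(1)[OF assms(1)]
    projection_tree_orthogonal[OF assms(1)] assms(2)
  by (auto simp: words_def) (metis finite_words words_def)

lemma projection_tree_below_root:
  assumes "projection_tree p"
  shows "p [] \<cdot> p w = p w"
proof (induction w)
  case (Cons b w)
  have "p [] \<cdot> p (b # w) = (p [] \<cdot> p w) \<cdot> p (b # w)"
    by (simp only: op_assoc projection_treeD(2)[OF assms])
  then show ?case by (simp add: Cons projection_treeD(2)[OF assms])
qed (rule projectionD(3)[OF projection_treeD(1)[OF assms]])

lemma diagonal_norm_le:
  assumes e: "partition_of_unity I e" and a: "\<And>i. i \<in> I \<Longrightarrow> \<bar>a i\<bar> \<le> c" and "0 \<le> c"
  shows "norm (\<Sum>i\<in>I. a i *\<^sub>R e i) \<le> c"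
proof (rule norm_selfadjoint_le[OF diagonal_adjoint[OF e] _ \<open>0 \<le> c\<close>])
  fix x
  have "(norm x)\<^sup>2 = (\<Sum>i\<in>I. (norm (e i x))\<^sup>2)"
    using diagonal_form[OF e, of "\<lambda>_. 1" x] partition_of_unityD(7)[OF e] by (simp add: power2_norm_eq_inner)
  moreover have "\<bar>inner ((\<Sum>i\<in>I. a i *\<^sub>R e i) x) x\<bar> \<le> (\<Sum>i\<in>I. c * (norm (e i x))\<^sup>2)"
    unfolding diagonal_form[OF e]
    by (rule order_trans[OF sum_abs]) (auto intro!: sum_mono mult_right_mono a simp: abs_mult)
  ultimately show "\<bar>inner ((\<Sum>i\<in>I. a i *\<^sub>R e i) x) x\<bar> \<le> c * (norm x)\<^sup>2"
    by (simp add: sum_distrib_left)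
qed

text \<open>
  The step operator of level \<open>m\<close>: on the part of a node it takes the lower end of the dyadic interval.
\<close>

definition level_sum :: "(bool list \<Rightarrow> ('h \<Rightarrow>\<^sub>L 'h)) \<Rightarrow> nat \<Rightarrow> ('h \<Rightarrow>\<^sub>L 'h)" where
  "level_sum p m = (\<Sum>w\<in>words m. binary_value w *\<^sub>R p w)"

text \<open>
  Passing to the next level adds \<open>1 / 2^(m+1)\<close> on the upper halves and changes nothing on the lower ones.
\<close>

lemma level_sum_step:
  assumes p: "projection_tree p" "p [] = id_blinfun"
  shows "norm (level_sum p (Suc m) - level_sum p m) \<le> 1 / 2 ^ Suc m"
proof -
  have "level_sum p (Suc m) - level_sum p m
      = (\<Sum>w\<in>words (Suc m). (if hd w then 1 / 2 ^ Suc m else 0) *\<^sub>R p w)"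
    unfolding level_sum_def sum_words_Suc sum_subtractf[symmetric]
    by (intro sum.cong)
      (auto simp: words_def projection_treeD(4)[OF p(1)] algebra_simps)
  also have "norm \<dots> \<le> 1 / 2 ^ Suc m"
    by (rule diagonal_norm_le[OF projection_tree_partition[OF p]]) auto
  finally show ?thesis .
qed

lemma tree_operator:
  assumes p: "projection_tree p" "p [] = id_blinfun"
  obtains S where "S \<in> M" "positive_op S" "\<And>m. norm (S - level_sum p m) \<le> 1 / 2 ^ m"
proof -
  obtain S where S: "level_sum p \<longlonglongrightarrow> S" "\<And>m. norm (S - level_sum p m) \<le> 1 / 2 ^ m"
    using geometric_limit[of "level_sum p", OF level_sum_step[OF p]] by blast
  note e = projection_tree_partition[OF p]
  have mem: "level_sum p m \<in> M" and pos: "positive_op (level_sum p m)" for m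
    unfolding level_sum_def
    by (rule diagonal_mem[OF e] diagonal_positive[OF e binary_value_bounds(1)])+
  have SM: "S \<in> M" by (rule norm_limit_closed[OF mem S(1)])
  have adj: "is_adjoint S S"
  proof (rule is_adjointI_inner[OF linear[OF SM]])
    fix x y
    have lim: "(\<lambda>n. inner (level_sum p n x) y) \<longlonglongrightarrow> inner (S x) y"
      "(\<lambda>n. inner x (level_sum p n y)) \<longlonglongrightarrow> inner x (S y)"
      by (intro tendsto_intros S(1))+
    have "inner (level_sum p n x) y = inner x (level_sum p n y)" for n
      by (rule is_adjoint_inner[OF positive_selfadjoint[OF mem pos]])
    with lim show "inner (S x) y = inner x (S y)" using LIMSEQ_unique by simp
  qed
  have "0 \<le> inner (S x) x" for x
  proof (rule LIMSEQ_le_const)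
    show "(\<lambda>n. inner (level_sum p n x) x) \<longlonglongrightarrow> inner (S x) x" by (intro tendsto_intros S(1))
    show "\<exists>N. \<forall>n\<ge>N. 0 \<le> inner (level_sum p n x) x"
      using pos positive_op_iff[OF positive_selfadjoint[OF mem pos]] by blast
  qed
  then have "positive_op S" using positive_op_iff[OF adj] by blast
  then show thesis using that SM S(2) by blast
qed

text \<open>
  Each node is bisected by the spectral projection of \<open>T\<close> at the midpoint of its dyadic interval.  This
  projection commutes with everything that commutes with \<open>T\<close>, in particular with the node, which is how
  the invariant survives: a node commutes with \<open>T\<close>, and on it \<open>T\<close> takes values in its dyadic interval.
\<close>

lemma spectral_tree:
  assumes T: "T \<in> M" "is_adjoint T T" and bounds: "\<And>x. 0 \<le> inner (T x) x" "\<And>x. inner (T x) x \<le> (norm x)\<^sup>2"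
  obtains p where "projection_tree p" "p [] = id_blinfun" "\<And>m. norm (T - level_sum p m) \<le> 1 / 2 ^ m"
proof -
  have "\<forall>l. \<exists>E. projection_in M E \<and> (\<forall>B. B \<cdot> T = T \<cdot> B \<longrightarrow> B \<cdot> E = E \<cdot> B) \<and>
      (\<forall>x. l * (norm (E x))\<^sup>2 \<le> inner (T (E x)) (E x)) \<and>
      (\<forall>x. inner (T (x - E x)) (x - E x) \<le> l * (norm (x - E x))\<^sup>2)"
  proof
    fix l
    have R: "T - l *\<^sub>R id_blinfun \<in> M" "is_adjoint (T - l *\<^sub>R id_blinfun) (T - l *\<^sub>R id_blinfun)"
      by (intro closed_intros T is_adjoint_intros)+
    obtain E where E: "projection_in M E"
      "\<And>B. B \<cdot> (T - l *\<^sub>R id_blinfun) = (T - l *\<^sub>R id_blinfun) \<cdot> B \<Longrightarrow> B \<cdot> E = E \<cdot> B"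
      "\<And>x. 0 \<le> inner ((T - l *\<^sub>R id_blinfun) (E x)) (E x)"
      "\<And>x. inner ((T - l *\<^sub>R id_blinfun) (x - E x)) (x - E x) \<le> 0"
      using spectral_split[OF R] by metis
    have form: "inner ((T - l *\<^sub>R id_blinfun) y) y = inner (T y) y - l * (norm y)\<^sup>2" for y
      by (simp add: blinfun.diff_left blinfun.scaleR_left inner_diff_left power2_norm_eq_inner)
    show "\<exists>E. projection_in M E \<and> (\<forall>B. B \<cdot> T = T \<cdot> B \<longrightarrow> B \<cdot> E = E \<cdot> B) \<and>
      (\<forall>x. l * (norm (E x))\<^sup>2 \<le> inner (T (E x)) (E x)) \<and>
      (\<forall>x. inner (T (x - E x)) (x - E x) \<le> l * (norm (x - E x))\<^sup>2)"
    proof (intro exI[of _ E] conjI allI impI)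
      show "B \<cdot> E = E \<cdot> B" if "B \<cdot> T = T \<cdot> B" for B
        by (rule E(2)) (simp add: op_simps that)
      show "l * (norm (E x))\<^sup>2 \<le> inner (T (E x)) (E x)" for x using E(3)[of x] by (simp add: form)
      show "inner (T (x - E x)) (x - E x) \<le> l * (norm (x - E x))\<^sup>2" for x
        using E(4)[of x] by (simp add: form)
    qed (rule E(1))
  qed
  then obtain G where G: "\<And>l. projection_in M (G l)"
    "\<And>l B. B \<cdot> T = T \<cdot> B \<Longrightarrow> B \<cdot> G l = G l \<cdot> B"
    "\<And>l x. l * (norm (G l x))\<^sup>2 \<le> inner (T (G l x)) (G l x)"
    "\<And>l x. inner (T (x - G l x)) (x - G l x) \<le> l * (norm (x - G l x))\<^sup>2"
    by metis
  define mid where "mid w = binary_value w + 1 / 2 ^ Suc (length w)" for w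
  define p where "p = split_tree (\<lambda>w P. P \<cdot> G (mid w)) id_blinfun"
  have p_simps: "p [] = id_blinfun" "p (True # w) = p w \<cdot> G (mid w)"
    "p (False # w) = p w - p w \<cdot> G (mid w)" for w
    by (simp_all add: p_def)
  have inv: "projection_in M (p w) \<and> p w \<cdot> T = T \<cdot> p w \<and>
      (\<forall>x. binary_value w * (norm (p w x))\<^sup>2 \<le> inner (T (p w x)) (p w x)) \<and>
      (\<forall>x. inner (T (p w x)) (p w x) \<le> (binary_value w + 1 / 2 ^ length w) * (norm (p w x))\<^sup>2)" for w
  proof (induction w)
    case Nil
    show ?case using bounds by (simp add: p_simps)
  next
    case (Cons b w)
    then have P: "projection_in M (p w)" "p w \<cdot> T = T \<cdot> p w"
      and lo: "\<And>x. binary_value w * (norm (p w x))\<^sup>2 \<le> inner (T (p w x)) (p w x)"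
      and hi: "\<And>x. inner (T (p w x)) (p w x) \<le> (binary_value w + 1 / 2 ^ length w) * (norm (p w x))\<^sup>2"
      by auto
    let ?G = "G (mid w)"
    have PG: "p w \<cdot> ?G = ?G \<cdot> p w" by (rule G(2)[OF P(2)])
    have GT: "T \<cdot> ?G = ?G \<cdot> T" by (rule G(2)) simp
    have Q: "projection_in M (p w \<cdot> ?G)" by (rule projection_compose[OF P(1) G(1) PG])
    have QT: "p w \<cdot> ?G \<cdot> T = T \<cdot> (p w \<cdot> ?G)"
    proof -
      have "p w \<cdot> ?G \<cdot> T = (p w \<cdot> T) \<cdot> ?G" by (simp only: op_assoc GT)
      then show ?thesis by (simp only: op_assoc P(2))
    qed
    have PGx: "p w (?G x) = ?G (p w x)" for x by (rule op_commute_apply[OF PG])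
    show ?case
    proof (cases b)
      case True
      show ?thesis
      proof (intro conjI allI)
        fix x
        show "binary_value (b # w) * (norm (p (b # w) x))\<^sup>2 \<le> inner (T (p (b # w) x)) (p (b # w) x)"
        proof -
          have "p (b # w) x = ?G (p w x)" "binary_value (b # w) = mid w"
            using True PGx by (simp_all add: p_simps mid_def)
          then show ?thesis using G(3)[of "mid w" "p w x"] by (simp only:)
        qed
        have "binary_value (b # w) + 1 / 2 ^ length (b # w) = binary_value w + 1 / 2 ^ length w"
          using True by (simp add: field_simps)
        then show "inner (T (p (b # w) x)) (p (b # w) x)
            \<le> (binary_value (b # w) + 1 / 2 ^ length (b # w)) * (norm (p (b # w) x))\<^sup>2"
          using hi[of "?G x"] True by (simp only: p_simps) simp
      qed (use Q QT True in \<open>simp_all add: p_simps\<close>)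
    next
      case False
      have px: "p (b # w) x = p w (x - ?G x)" "p (b # w) x = p w x - ?G (p w x)" for x
        using False by (simp_all add: p_simps blinfun.bilinear_simps PGx)
      have bv: "binary_value (b # w) + 1 / 2 ^ length (b # w) = mid w" "binary_value (b # w) = binary_value w"
        using False by (simp_all add: mid_def)
      show ?thesis
      proof (intro conjI allI)
        show "projection_in M (p (b # w))"
          using projection_diff[OF P(1) Q projectionD(4)[OF P(1)]] False by (simp add: p_simps)
        show "p (b # w) \<cdot> T = T \<cdot> p (b # w)"
          using False QT P(2) by (simp add: p_simps bounded_bilinear.diff_left[OF bounded_bilinear_blinfun_compose]
            bounded_bilinear.diff_right[OF bounded_bilinear_blinfun_compose])
        fix x
        show "binary_value (b # w) * (norm (p (b # w) x))\<^sup>2 \<le> inner (T (p (b # w) x)) (p (b # w) x)"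
          using lo[of "x - ?G x"] by (simp only: px(1) bv)
        show "inner (T (p (b # w) x)) (p (b # w) x)
            \<le> (binary_value (b # w) + 1 / 2 ^ length (b # w)) * (norm (p (b # w) x))\<^sup>2"
          using G(4)[of "p w x" "mid w"] by (simp only: px(2) bv(1))
      qed
    qed
  qed
  have tree: "projection_tree p"
    unfolding projection_tree_def
  proof (intro allI conjI)
    fix w
    show "projection_in M (p w)" using inv by blast
    then show "p w \<cdot> p (True # w) = p (True # w)" by (simp add: p_simps projectionD(4))
    show "p (False # w) = p w - p (True # w)" by (simp add: p_simps)
  qed
  have "norm (T - level_sum p m) \<le> 1 / 2 ^ m" for m
  proof (rule norm_selfadjoint_le)
    note e = projection_tree_partition[OF tree p_simps(1), of m]
    show "is_adjoint (T - level_sum p m) (T - level_sum p m)"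
      unfolding level_sum_def by (intro is_adjoint_diff T diagonal_adjoint[OF e])
    fix x
    have nx: "(norm x)\<^sup>2 = (\<Sum>w\<in>words m. (norm (p w x))\<^sup>2)"
      using diagonal_form[OF e, of "\<lambda>_. 1" x] partition_of_unityD(7)[OF e] by (simp add: power2_norm_eq_inner)
    have "inner (T x) x = inner ((\<Sum>w\<in>words m. p w) (T x)) x"
      using partition_of_unityD(7)[OF e] by simp
    also have "\<dots> = (\<Sum>w\<in>words m. inner (p w (T x)) x)"
      by (simp add: blinfun.sum_left inner_sum_left)
    also have "\<dots> = (\<Sum>w\<in>words m. inner (T (p w x)) (p w x))"
    proof (intro sum.cong refl)
      fix w
      have P: "projection_in M (p w)" "p w \<cdot> T = T \<cdot> p w" using inv by blast+
      have "inner (p w (T x)) x = inner (p w (p w (T x))) x" by (simp add: projectionD(5)[OF P(1)])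
      also have "\<dots> = inner (p w (T x)) (p w x)"
        by (rule is_adjoint_inner[OF projectionD(2)[OF P(1)]])
      also have "\<dots> = inner (T (p w x)) (p w x)"
        by (simp only: op_commute_apply[OF P(2)])
      finally show "inner (p w (T x)) x = inner (T (p w x)) (p w x)" .
    qed
    finally have Tx: "inner (T x) x = (\<Sum>w\<in>words m. inner (T (p w x)) (p w x))" .
    have form: "inner ((T - level_sum p m) x) x
        = (\<Sum>w\<in>words m. inner (T (p w x)) (p w x) - binary_value w * (norm (p w x))\<^sup>2)"
      unfolding blinfun.diff_left inner_diff_left Tx level_sum_def diagonal_form[OF e] sum_subtractf ..
    have "0 \<le> inner ((T - level_sum p m) x) x"
      unfolding form using inv by (intro sum_nonneg) simp
    moreover have "inner ((T - level_sum p m) x) x \<le> (\<Sum>w\<in>words m. (1 / 2 ^ m) * (norm (p w x))\<^sup>2)"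
      unfolding form
    proof (rule sum_mono)
      fix w assume "w \<in> words m"
      then have "length w = m" by (simp add: words_def)
      then have "inner (T (p w x)) (p w x) \<le> (binary_value w + 1 / 2 ^ m) * (norm (p w x))\<^sup>2"
        using inv[of w] by blast
      then show "inner (T (p w x)) (p w x) - binary_value w * (norm (p w x))\<^sup>2 \<le> (1 / 2 ^ m) * (norm (p w x))\<^sup>2"
        by (simp add: distrib_right)
    qed
    ultimately show "\<bar>inner ((T - level_sum p m) x) x\<bar> \<le> 1 / 2 ^ m * (norm x)\<^sup>2"
      by (simp add: nx sum_distrib_left)
  qed simp
  then show thesis by (rule that[OF tree p_simps(1)])
qed

end

context tracial_algebra begin

lemma trace_tendsto:
  assumes X: "\<And>m. X m \<in> M" "\<And>m. is_adjoint (X m) (X m)" and A: "A \<in> M" "is_adjoint A A"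
    and lim: "X \<longlonglongrightarrow> A"
  shows "(\<lambda>m. \<tau> (X m)) \<longlonglongrightarrow> \<tau> A"
proof -
  have "(\<lambda>m. tr (X m) - tr A) \<longlonglongrightarrow> 0"
  proof (rule Lim_null_comparison)
    show "\<forall>\<^sub>F m in sequentially. norm (tr (X m) - tr A) \<le> norm (X m - A)"
    proof (intro always_eventually allI)
      fix m
      have "\<bar>tr (X m - A)\<bar> \<le> norm (X m - A)"
        by (rule trace_selfadjoint) (intro closed_intros is_adjoint_diff X A)+
      then show "norm (tr (X m) - tr A) \<le> norm (X m - A)" by (simp add: tr_simps X A)
    qed
    show "(\<lambda>m. norm (X m - A)) \<longlonglongrightarrow> 0" using lim by (simp add: LIM_zero tendsto_norm_zero)
  qed
  then have "(\<lambda>m. tr (X m)) \<longlonglongrightarrow> tr A" by (rule LIM_zero_cancel)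
  then have "(\<lambda>m. complex_of_real (tr (X m))) \<longlonglongrightarrow> of_real (tr A)" by (rule tendsto_of_real)
  then show ?thesis by (simp add: trace_selfadjoint(1) X A)
qed

lemma level_sum_limit:
  assumes "\<And>m. norm (S - level_sum p m) \<le> 1 / 2 ^ m"
  shows "level_sum p \<longlonglongrightarrow> S"
proof -
  have "(\<lambda>m. (1/2::real) ^ m) \<longlonglongrightarrow> 0" by (rule LIMSEQ_realpow_zero) auto
  then have "(\<lambda>m. level_sum p m - S) \<longlonglongrightarrow> 0"
    by (rule Lim_null_comparison[rotated])
      (use assms in \<open>auto simp: norm_minus_commute power_one_over\<close>)
  then show ?thesis by (rule LIM_zero_cancel)
qed

text \<open>
  The moments of a step operator are determined by the traces of its nodes, and they pass to the norm limit.
\<close>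

lemma tree_moments:
  assumes p: "projection_tree p" "p [] = id_blinfun" and S: "S \<in> M" "is_adjoint S S"
    and approx: "\<And>m. norm (S - level_sum p m) \<le> 1 / 2 ^ m"
  shows "(\<lambda>m. \<Sum>w\<in>words m. of_real (binary_value w ^ k) * \<tau> (p w)) \<longlonglongrightarrow> \<tau> (op_pow S k)"
proof -
  note e = projection_tree_partition[OF p]
  have "(\<lambda>m. \<tau> (op_pow (level_sum p m) k)) \<longlonglongrightarrow> \<tau> (op_pow S k)"
    by (intro trace_tendsto tendsto_op_pow level_sum_limit approx pow_closed is_adjoint_pow S)
      (auto simp: level_sum_def intro: diagonal_mem[OF e] diagonal_adjoint[OF e])
  then show ?thesis by (simp add: level_sum_def diagonal_pow[OF e] trace_diagonal[OF e])
qed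

lemma tree_equi_measurable:
  assumes p: "projection_tree p" "p [] = id_blinfun" "S \<in> M" "is_adjoint S S"
    "\<And>m. norm (S - level_sum p m) \<le> 1 / 2 ^ m"
    and q: "projection_tree q" "q [] = id_blinfun" "T \<in> M" "is_adjoint T T"
    "\<And>m. norm (T - level_sum q m) \<le> 1 / 2 ^ m"
    and tr_eq: "\<And>w. \<tau> (p w) = \<tau> (q w)"
  shows "equi_measurable \<tau> S T"
  unfolding equi_measurable_def
proof
  fix k
  show "\<tau> (op_pow S k) = \<tau> (op_pow T k)"
    using tree_moments[OF p, of k] tree_moments[OF q, of k] LIMSEQ_unique unfolding tr_eq by blast
qed

text \<open>
  Diffuseness and normality provide the upper child of a node with the trace that is asked for; the lower
  child is what remains.
\<close>

lemma tree_of_traces: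
  assumes normal: "normal_on M \<tau>" and df: "diffuse M"
    and P: "projection_in M P" "tr P = t []"
    and t: "\<And>w. 0 \<le> t w" "\<And>w. t (True # w) + t (False # w) = t w"
  obtains p where "projection_tree p" "p [] = P" "\<And>w. tr (p w) = t w"
proof -
  have "\<forall>Q s. \<exists>R. projection_in M Q \<and> 0 \<le> s \<and> s \<le> tr Q \<longrightarrow> projection_in M R \<and> Q \<cdot> R = R \<and> tr R = s"
    using subprojection_of_trace[OF normal df] by metis
  then obtain sub where sub: "\<And>Q s. projection_in M Q \<Longrightarrow> 0 \<le> s \<Longrightarrow> s \<le> tr Q \<Longrightarrow>
      projection_in M (sub Q s) \<and> Q \<cdot> sub Q s = sub Q s \<and> tr (sub Q s) = s"
    by metis
  define p where "p = split_tree (\<lambda>w Q. sub Q (t (True # w))) P"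
  have p_simps: "p [] = P" "p (True # w) = sub (p w) (t (True # w))"
    "p (False # w) = p w - p (True # w)" for w
    by (simp_all add: p_def)
  have inv: "projection_in M (p w) \<and> tr (p w) = t w" for w
  proof (induction w)
    case (Cons b w)
    then have w: "projection_in M (p w)" "tr (p w) = t w" by auto
    have "t (True # w) \<le> tr (p w)" using t(1)[of "False # w"] t(2)[of w] w by linarith
    then have T: "projection_in M (p (True # w))" "p w \<cdot> p (True # w) = p (True # w)"
      "tr (p (True # w)) = t (True # w)"
      using sub[OF w(1) t(1)] by (auto simp: p_simps(2))
    show ?case
    proof (cases b)
      case False
      have "tr (p (False # w)) = t w - t (True # w)"
        using w T by (simp add: p_simps(3) tr_simps projection_in_def)
      then show ?thesis
        using projection_diff[OF w(1) T(1,2)] False t(2)[of w] by (simp add: p_simps(3))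
    qed (use T in simp)
  qed (simp add: p_simps(1) P)
  have "projection_tree p"
    unfolding projection_tree_def
  proof (intro allI conjI)
    fix w
    show "projection_in M (p w)" using inv by blast
    have "t (True # w) \<le> tr (p w)" using t(1)[of "False # w"] t(2)[of w] inv[of w] by linarith
    then show "p w \<cdot> p (True # w) = p (True # w)"
      using sub[of "p w" "t (True # w)"] inv[of w] t(1) by (simp add: p_simps(2))
  qed (rule p_simps)
  then show thesis using that inv p_simps(1) by blast
qed

end

section \<open>Rotation in the diffuse case\<close>

text \<open>
  The length of the part of \<open>(-\<infinity>, x]\<close> inside the cell \<open>[l/n, (l+1)/n]\<close>, in a form whose sum over the cells
  telescopes.
\<close>

definition cell_length :: "nat \<Rightarrow> nat \<Rightarrow> real \<Rightarrow> real" where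
  "cell_length n l x = min x (real (Suc l) / real n) - min x (real l / real n)"

lemma cell_edges:
  obtains a h where "real l / real n = a" "real (Suc l) / real n = a + h" "1 / real n = h" "0 \<le> a" "0 \<le> h"
  by (rule that[OF refl _ refl]) (simp_all add: add_divide_distrib)

lemma cell_length_diff_bounds:
  assumes "x \<le> y"
  shows "0 \<le> cell_length n l y - cell_length n l x"
    "cell_length n l y - cell_length n l x \<le> 1 / real n"
proof -
  obtain a h where ah: "real l / real n = a" "real (Suc l) / real n = a + h" "1 / real n = h" "0 \<le> a" "0 \<le> h"
    by (rule cell_edges)
  show "0 \<le> cell_length n l y - cell_length n l x"
    "cell_length n l y - cell_length n l x \<le> 1 / real n"
    unfolding cell_length_def ah(1-3) using assms ah(4,5) by (auto simp: min_def)
qed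

lemma cell_length_unit:
  assumes "l < n"
  shows "cell_length n l 1 - cell_length n l 0 = 1 / real n"
proof -
  obtain a h where ah: "real l / real n = a" "real (Suc l) / real n = a + h" "1 / real n = h" "0 \<le> a" "0 \<le> h"
    by (rule cell_edges)
  have "real (Suc l) / real n \<le> 1" using assms by (simp add: field_simps)
  then show ?thesis
    unfolding cell_length_def ah(1-3) using ah(4,5) by (auto simp: min_def)
qed

lemma cell_length_sum:
  assumes "n > 0" "0 \<le> x" "x \<le> 1"
  shows "(\<Sum>l<n. cell_length n l x) = x"
  unfolding cell_length_def
  using sum_lessThan_telescope[of "\<lambda>l. min x (real l / real n)" n] assms by simp

text \<open>
  If an interval covers a cell only partly, one of its two end points is interior to the cell, and a point
  is interior to at most one cell.
\<close>

lemma cut_cells: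
  assumes "n > 0" "x \<le> y"
  shows "card {l. l < n \<and> cell_length n l y - cell_length n l x \<notin> {0, 1 / real n}} \<le> 2"
proof -
  let ?in = "\<lambda>z l. real l / real n < z \<and> z < real (Suc l) / real n"
  have sub: "{l. l < n \<and> cell_length n l y - cell_length n l x \<notin> {0, 1 / real n}}
      \<subseteq> {l. ?in x l} \<union> {l. ?in y l}"
  proof (rule subsetI)
    fix l assume "l \<in> {l. l < n \<and> cell_length n l y - cell_length n l x \<notin> {0, 1 / real n}}"
    then have l: "cell_length n l y - cell_length n l x \<notin> {0, 1 / real n}" by simp
    obtain a h where ah: "real l / real n = a" "real (Suc l) / real n = a + h" "1 / real n = h" "0 \<le> a" "0 \<le> h"
      by (rule cell_edges)
    have "?in x l \<or> ?in y l"
      using l assms ah(4,5) unfolding cell_length_def ah(1-3) by (auto simp: min_def split: if_splits)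
    then show "l \<in> {l. ?in x l} \<union> {l. ?in y l}" by blast
  qed
  have single: "{l. ?in z l} \<subseteq> {nat \<lfloor>z * real n\<rfloor>}" for z
  proof clarify
    fix l assume "real l / real n < z" "z < real (Suc l) / real n"
    then have "real l < z * real n" "z * real n < real l + 1"
      using assms(1) by (auto simp: field_simps)
    then have "\<lfloor>z * real n\<rfloor> = int l" by linarith
    then show "l = nat \<lfloor>z * real n\<rfloor>" by simp
  qed
  have "{l. l < n \<and> cell_length n l y - cell_length n l x \<notin> {0, 1 / real n}}
      \<subseteq> {nat \<lfloor>x * real n\<rfloor>, nat \<lfloor>y * real n\<rfloor>}"
    using sub single[of x] single[of y] by blast
  then have "card {l. l < n \<and> cell_length n l y - cell_length n l x \<notin> {0, 1 / real n}}
      \<le> card {nat \<lfloor>x * real n\<rfloor>, nat \<lfloor>y * real n\<rfloor>}"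
    by (intro card_mono) auto
  also have "\<dots> \<le> 2" by (simp add: card_insert_if)
  finally show ?thesis .
qed

text \<open>
  Lays the nodes of a level out as consecutive intervals of lengths \<open>t w\<close>, such that the intervals of the
  children subdivide that of the parent.
\<close>

primrec left_end :: "(bool list \<Rightarrow> real) \<Rightarrow> bool list \<Rightarrow> real" where
  "left_end t [] = 0"
| "left_end t (b # w) = left_end t w + (if b then 0 else t (True # w))"

lemma left_end_bounds:
  assumes t: "\<And>w. 0 \<le> t w" "\<And>w. t (True # w) + t (False # w) = t w" "t [] = 1"
  shows "0 \<le> left_end t w" "left_end t w + t w \<le> 1"
proof -
  show "0 \<le> left_end t w" using t(1) by (induction w) auto
  show "left_end t w + t w \<le> 1"
  proof (induction w)
    case (Cons b w)
    then show ?case using t(1)[of "True # w"] t(1)[of "False # w"] t(2)[of w] by (cases b) auto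
  qed (simp add: t(3))
qed

context star_algebra begin

text \<open>
  Trees that live below orthogonal projections add up to a tree, since nodes in different blocks are
  orthogonal.
\<close>

lemma block_tree:
  assumes G: "partition_of_unity I G"
    and p: "\<And>i. i \<in> I \<Longrightarrow> projection_tree (p i)" "\<And>i. i \<in> I \<Longrightarrow> p i [] = G i"
  shows "projection_tree (\<lambda>w. \<Sum>i\<in>I. p i w)"
proof -
  note GD = partition_of_unityD[OF G]
  note pD = projection_treeD[OF p(1)]
  have cross: "p i u \<cdot> p j v = 0" if "i \<in> I" "j \<in> I" "i \<noteq> j" for i j u v
  proof -
    have pu: "p i u \<cdot> G i = p i u"
      by (rule projection_sub_commute(1)[OF GD(2) pD(1)])
        (use that projection_tree_below_root[OF p(1)] p(2) in auto)
    have pv: "G j \<cdot> p j v = p j v" using that projection_tree_below_root[OF p(1)] p(2) by auto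
    have "p i u \<cdot> p j v = p i u \<cdot> (G i \<cdot> (G j \<cdot> p j v))"
      by (simp only: pu pv flip: op_assoc)
    also have "\<dots> = 0" by (subst GD(6)) (use that in auto)
    finally show ?thesis .
  qed
  have prod: "(\<Sum>i\<in>I. p i u) \<cdot> (\<Sum>i\<in>I. p i v) = (\<Sum>i\<in>I. p i u \<cdot> p i v)" for u v
  proof -
    have "(\<Sum>i\<in>I. p i u) \<cdot> (\<Sum>i\<in>I. p i v) = (\<Sum>i\<in>I. \<Sum>j\<in>I. p i u \<cdot> p j v)"
      by (simp add: op_sum_left op_sum_right) (rule sum.swap)
    also have "\<dots> = (\<Sum>i\<in>I. \<Sum>j\<in>I. if j = i then p i u \<cdot> p i v else 0)"
      by (intro sum.cong refl) (use cross in auto)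
    also have "\<dots> = (\<Sum>i\<in>I. p i u \<cdot> p i v)" using GD(1) by simp
    finally show ?thesis .
  qed
  show ?thesis
    unfolding projection_tree_def
  proof (intro allI conjI)
    fix w
    have "(\<Sum>i\<in>I. p i w) \<cdot> (\<Sum>i\<in>I. p i w) = (\<Sum>i\<in>I. p i w)"
      unfolding prod by (intro sum.cong refl projectionD(3)[OF pD(1)])
    then show "projection_in M (\<Sum>i\<in>I. p i w)"
      using projectionD(1,2)[OF pD(1)] by (auto simp: projection_in_def intro!: sum_closed is_adjoint_sum)
    show "(\<Sum>i\<in>I. p i w) \<cdot> (\<Sum>i\<in>I. p i (True # w)) = (\<Sum>i\<in>I. p i (True # w))"
      unfolding prod by (intro sum.cong refl pD(2))
    show "(\<Sum>i\<in>I. p i (False # w)) = (\<Sum>i\<in>I. p i w) - (\<Sum>i\<in>I. p i (True # w))"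
      unfolding sum_subtractf[symmetric] by (intro sum.cong refl pD(4))
  qed
qed

end

context tracial_algebra begin

lemma trace_tree:
  assumes "projection_tree p"
  shows "tr (p (True # w)) + tr (p (False # w)) = tr (p w)"
  using projection_treeD(4)[OF assms, of w] projectionD(1)[OF projection_treeD(1)[OF assms]]
  by (simp add: tr_simps)

text \<open>
  In block \<open>i\<close> the projection \<open>q i l\<close> has trace \<open>s l\<close> out of \<open>1/n\<close>, and \<open>D i l\<close> compares it with the multiple of
  \<open>G i\<close> that has the same trace.  By faithfulness the difference vanishes when \<open>s l\<close> is \<open>0\<close> or \<open>1/n\<close>, and otherwise it is bounded by
  \<open>G i\<close>.  The blocks are orthogonal, so the bound \<open>2\<close> for each of them is a bound for their sum.
\<close>

lemma block_average_error:
  assumes G: "partition_of_unity {..<n} G" "n > 0" and trG: "\<And>i. i < n \<Longrightarrow> tr (G i) = 1 / real n"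
    and q: "\<And>i l. i < n \<Longrightarrow> l < n \<Longrightarrow> projection_in M (q i l)"
      "\<And>i l. i < n \<Longrightarrow> l < n \<Longrightarrow> G i \<cdot> q i l = q i l"
      "\<And>i l. i < n \<Longrightarrow> l < n \<Longrightarrow> tr (q i l) = s l"
    and s: "\<And>l. l < n \<Longrightarrow> 0 \<le> s l" "\<And>l. l < n \<Longrightarrow> s l \<le> 1 / real n"
      "card {l. l < n \<and> s l \<notin> {0, 1 / real n}} \<le> 2"
  shows "norm ((1 / real n) *\<^sub>R (\<Sum>i<n. \<Sum>l<n. q i l) - (\<Sum>l<n. s l) *\<^sub>R id_blinfun) \<le> 2 / real n"
proof -
  note GD = partition_of_unityD[OF G(1)]
  define D where "D i l = q i l - (real n * s l) *\<^sub>R G i" for i l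
  have eq: "(1 / real n) *\<^sub>R (\<Sum>i<n. \<Sum>l<n. q i l) - (\<Sum>l<n. s l) *\<^sub>R id_blinfun
      = (1 / real n) *\<^sub>R (\<Sum>i<n. \<Sum>l<n. D i l)"
  proof -
    have "(\<Sum>i<n. \<Sum>l<n. (real n * s l) *\<^sub>R G i) = (real n * (\<Sum>l<n. s l)) *\<^sub>R (\<Sum>i<n. G i)"
      by (simp add: scaleR_sum_right sum_distrib_left flip: scaleR_sum_left)
    then show ?thesis
      using G(2) GD(7) by (simp add: D_def sum_subtractf scaleR_diff_right)
  qed
  let ?B = "{l. l < n \<and> s l \<notin> {0, 1 / real n}}"
  have D0: "D i l = 0" if "i < n" "l < n" "l \<notin> ?B" for i l
  proof -
    have "s l = 0 \<or> s l = 1 / real n" using that by auto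
    then show ?thesis
    proof
      assume s: "s l = 0"
      then have "q i l = 0" using trace_projection(3)[OF q(1)] q(3) that by simp
      then show ?thesis by (simp add: D_def s)
    next
      assume s: "s l = 1 / real n"
      have "projection_in M (G i - q i l)" using projection_diff[OF GD(2) q(1,2)] that by simp
      moreover have "tr (G i - q i l) = 0"
        using that s trG q(3) by (simp add: tr_simps GD projectionD(1)[OF q(1)])
      ultimately have "G i - q i l = 0" by (rule trace_projection(3))
      then show ?thesis using G(2) by (simp add: D_def s)
    qed
  qed
  have D_form: "\<bar>inner (D i l x) x\<bar> \<le> (norm (G i x))\<^sup>2" if il: "i < n" "l < n" for i l x
  proof -
    have "projection_in M (G i - q i l)" using projection_diff[OF GD(2) q(1,2)] il by simp
    from projectionD(6)[OF this, of x]
    have "inner (G i x) x - inner (q i l x) x = (norm (G i x - q i l x))\<^sup>2"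
      by (simp add: blinfun.diff_left inner_diff_left)
    then have "inner (q i l x) x \<le> inner (G i x) x"
      using zero_le_power2[of "norm (G i x - q i l x)"] by linarith
    then have "(norm (q i l x))\<^sup>2 \<le> (norm (G i x))\<^sup>2"
      using projectionD(6)[OF q(1)] projectionD(6)[OF GD(2)] il by simp
    moreover have "0 \<le> real n * s l" "real n * s l \<le> 1"
      using s(1,2)[OF il(2)] G(2) by (auto simp: field_simps)
    then have "0 \<le> real n * s l * (norm (G i x))\<^sup>2" "real n * s l * (norm (G i x))\<^sup>2 \<le> (norm (G i x))\<^sup>2"
      by (auto intro: mult_left_le_one_le)
    moreover have "inner (D i l x) x = (norm (q i l x))\<^sup>2 - real n * s l * (norm (G i x))\<^sup>2"
      using projectionD(6)[OF q(1)] projectionD(6)[OF GD(2)] il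
      by (simp add: D_def blinfun.diff_left blinfun.scaleR_left inner_diff_left)
    ultimately show ?thesis using zero_le_power2[of "norm (q i l x)"] unfolding abs_le_iff by linarith
  qed
  have "norm (\<Sum>i<n. \<Sum>l<n. D i l) \<le> 2"
  proof (rule norm_selfadjoint_le)
    show "is_adjoint (\<Sum>i<n. \<Sum>l<n. D i l) (\<Sum>i<n. \<Sum>l<n. D i l)"
      unfolding D_def
      by (intro is_adjoint_sum is_adjoint_diff is_adjoint_scaleR GD projectionD(2)[OF q(1)]) auto
    fix x
    have nx: "(norm x)\<^sup>2 = (\<Sum>i<n. (norm (G i x))\<^sup>2)"
      using diagonal_form[OF G(1), of "\<lambda>_. 1" x] GD(7) by (simp add: power2_norm_eq_inner)
    have "\<bar>inner ((\<Sum>i<n. \<Sum>l<n. D i l) x) x\<bar> \<le> (\<Sum>i<n. \<bar>\<Sum>l<n. inner (D i l x) x\<bar>)"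
      by (simp add: blinfun.sum_left inner_sum_left sum_abs)
    also have "\<dots> \<le> (\<Sum>i<n. 2 * (norm (G i x))\<^sup>2)"
    proof (rule sum_mono)
      fix i assume "i \<in> {..<n}"
      then have i: "i < n" by simp
      have "(\<Sum>l<n. inner (D i l x) x) = (\<Sum>l\<in>?B. inner (D i l x) x)"
        by (rule sum.mono_neutral_right) (auto simp: D0[OF i])
      also have "\<bar>\<dots>\<bar> \<le> (\<Sum>l\<in>?B. (norm (G i x))\<^sup>2)"
        by (rule order_trans[OF sum_abs sum_mono]) (use D_form[OF i] in auto)
      also have "\<dots> \<le> 2 * (norm (G i x))\<^sup>2"
        using s(3) by (simp add: mult_right_mono)
      finally show "\<bar>\<Sum>l<n. inner (D i l x) x\<bar> \<le> 2 * (norm (G i x))\<^sup>2" .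
    qed
    finally show "\<bar>inner ((\<Sum>i<n. \<Sum>l<n. D i l) x) x\<bar> \<le> 2 * (norm x)\<^sup>2"
      by (simp add: nx sum_distrib_left)
  qed simp
  then have "norm ((1 / real n) *\<^sub>R (\<Sum>i<n. \<Sum>l<n. D i l)) \<le> (1 / real n) * 2"
    by (simp add: divide_right_mono)
  then show ?thesis unfolding eq by simp
qed

text \<open>
  Here \<open>c w\<close> and \<open>t w\<close> are the left end and the length of the interval of \<open>w\<close>, \<open>s l w\<close> is the length of its part in
  cell \<open>l\<close>, \<open>q i l\<close> is a tree with these traces below \<open>G i\<close>, and \<open>r k\<close> is the tree that uses cell \<open>i + k\<close> in block \<open>i\<close>.
  The two error terms are the dyadic approximation at level \<open>m\<close>, applied once to the operators \<open>S k\<close> and once to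
  \<open>T\<close>, and the cut cells of the \<open>2^m\<close> intervals of that level.
\<close>

lemma rotation_average:
  assumes normal: "normal_on M \<tau>" and df: "diffuse M"
    and T: "T \<in> M" "is_adjoint T T" and bounds: "\<And>x. 0 \<le> inner (T x) x" "\<And>x. inner (T x) x \<le> (norm x)\<^sup>2"
    and "0 < n"
  obtains S :: "nat \<Rightarrow> ('h \<Rightarrow>\<^sub>L 'h)" where
    "\<And>k. S k \<in> M" "\<And>k. positive_op (S k)" "\<And>k. equi_measurable \<tau> (S k) T"
    "\<And>m. norm ((1 / real n) *\<^sub>R (\<Sum>k<n. S k) - tr T *\<^sub>R id_blinfun) \<le> 2 / 2 ^ m + 2 ^ m * (2 / real n)"
proof -
  obtain p where p: "projection_tree p" "p [] = id_blinfun" "\<And>m. norm (T - level_sum p m) \<le> 1 / 2 ^ m"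
    using spectral_tree[OF T bounds] by blast
  obtain G where G: "partition_of_unity {..<n} G" "\<And>i. i < n \<Longrightarrow> tr (G i) = 1 / real n"
    using equal_trace_partition[OF normal df \<open>0 < n\<close>] by blast
  note GD = partition_of_unityD[OF G(1)]
  note pD = projection_treeD[OF p(1)]
  define t where "t w = tr (p w)" for w
  have t: "0 \<le> t w" "t (True # w) + t (False # w) = t w" "t [] = 1" for w
    using trace_projection(2)[OF pD(1)] trace_tree[OF p(1)] p(2) by (simp_all add: t_def tr_simps)
  define c where "c = left_end t"
  have c: "0 \<le> c w" "c w + t w \<le> 1" for w
    unfolding c_def by (rule left_end_bounds[of t, OF t])+
  define s where "s l w = cell_length n l (c w + t w) - cell_length n l (c w)" for l w
  have s_bounds: "0 \<le> s l w" "s l w \<le> 1 / real n" for l w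
    unfolding s_def using t(1)[of w] by (intro cell_length_diff_bounds; simp)+
  have s_split: "s l (True # w) + s l (False # w) = s l w" for l w
  proof -
    have "c w + t (True # w) + t (False # w) = c w + t w" using t(2)[of w] by simp
    moreover have "c (True # w) = c w" "c (False # w) = c w + t (True # w)" by (simp_all add: c_def)
    ultimately show ?thesis by (simp only: s_def)
  qed
  have s_sum: "(\<Sum>l<n. s l w) = t w" for w
    using c[of w] t(1)[of w] \<open>0 < n\<close> by (simp add: s_def sum_subtractf cell_length_sum)
  \<comment> \<open>The root is all of \<open>[0,1]\<close>, so its part in each cell has the trace of a block.\<close>
  have s_root: "s l [] = 1 / real n" if "l < n" for l
    using cell_length_unit[OF that] by (simp add: s_def c_def t(3))
  have "\<forall>x\<in>{..<n} \<times> {..<n}. \<exists>q. projection_tree q \<and> q [] = G (fst x) \<and> (\<forall>w. tr (q w) = s (snd x) w)"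
  proof
    fix x assume x: "x \<in> {..<n} \<times> {..<n}"
    then have "projection_in M (G (fst x))" "tr (G (fst x)) = s (snd x) []"
      using GD(2) G(2) s_root by auto
    from tree_of_traces[OF normal df this s_bounds(1) s_split]
    show "\<exists>q. projection_tree q \<and> q [] = G (fst x) \<and> (\<forall>w. tr (q w) = s (snd x) w)" by metis
  qed
  from bchoice[OF this] obtain q' where
    q': "\<forall>x\<in>{..<n} \<times> {..<n}. projection_tree (q' x) \<and> q' x [] = G (fst x) \<and> (\<forall>w. tr (q' x w) = s (snd x) w)"
    by blast
  define q where "q i l = q' (i, l)" for i l
  have q: "projection_tree (q i l)" "q i l [] = G i" "tr (q i l w) = s l w" if "i < n" "l < n" for i l w
    using q' that by (auto simp: q_def)
  define r where "r k w = (\<Sum>i<n. q i ((i + k) mod n) w)" for k w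
  have r_tree: "projection_tree (r k)" for k
    unfolding r_def by (rule block_tree[OF G(1)]) (use q \<open>0 < n\<close> in auto)
  have r_root: "r k [] = id_blinfun" for k
    using GD(7) q(2) \<open>0 < n\<close> by (simp add: r_def)
  have r_trace: "tr (r k w) = t w" for k w
  proof -
    have "tr (r k w) = (\<Sum>i<n. tr (q i ((i + k) mod n) w))"
      unfolding r_def by (rule tr_sum)
        (use projectionD(1)[OF projection_treeD(1)[OF q(1)]] \<open>0 < n\<close> in auto)
    also have "\<dots> = (\<Sum>i<n. s ((k + i) mod n) w)"
      using q(3) \<open>0 < n\<close> by (intro sum.cong) (auto simp: add.commute)
    also have "\<dots> = t w" by (simp only: sum_rotate[of "\<lambda>l. s l w"] s_sum)
    finally show ?thesis .
  qed
  have "\<forall>k. \<exists>S. S \<in> M \<and> positive_op S \<and> (\<forall>m. norm (S - level_sum (r k) m) \<le> 1 / 2 ^ m)"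
    using tree_operator[OF r_tree r_root] by metis
  then obtain S where S: "\<And>k. S k \<in> M" "\<And>k. positive_op (S k)"
    "\<And>k m. norm (S k - level_sum (r k) m) \<le> 1 / 2 ^ m"
    by metis
  show thesis
  proof (rule that[of S, OF S(1,2)])
    fix k
    show "equi_measurable \<tau> (S k) T"
    proof (rule tree_equi_measurable[OF r_tree r_root S(1) positive_selfadjoint[OF S(1,2)] S(3) p(1,2) T p(3)])
      show "\<tau> (r k w) = \<tau> (p w)" for w
        using trace_projection(1)[OF projection_treeD(1)[OF r_tree]] trace_projection(1)[OF pD(1)]
          r_trace[of k w] by (simp add: t_def)
    qed
  next
    fix m
    let ?A = "(1 / real n) *\<^sub>R (\<Sum>k<n. S k)"
    let ?L = "(1 / real n) *\<^sub>R (\<Sum>k<n. level_sum (r k) m)"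
    have "norm (?A - ?L) \<le> 1 / 2 ^ m"
    proof -
      have "?A - ?L = (1 / real n) *\<^sub>R (\<Sum>k<n. S k - level_sum (r k) m)"
        by (simp add: sum_subtractf scaleR_diff_right)
      also have "norm \<dots> \<le> (1 / real n) * (\<Sum>k<n. 1 / 2 ^ m)"
        unfolding norm_scaleR by (intro mult_mono sum_norm_le S(3)) (auto simp: sum_nonneg)
      also have "\<dots> = 1 / 2 ^ m" using \<open>0 < n\<close> by simp
      finally show ?thesis .
    qed
    moreover have "norm (?L - tr (level_sum p m) *\<^sub>R id_blinfun) \<le> 2 ^ m * (2 / real n)"
    proof -
      have tr_level: "tr (level_sum p m) = (\<Sum>w\<in>words m. binary_value w * (\<Sum>l<n. s l w))"
        unfolding level_sum_def using projectionD(1)[OF pD(1)]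
        by (subst tr_sum) (auto simp: tr_simps s_sum t_def intro: scaleR_closed)
      have rot: "(\<Sum>k<n. r k w) = (\<Sum>i<n. \<Sum>l<n. q i l w)" for w
      proof -
        have "(\<Sum>k<n. q i ((i + k) mod n) w) = (\<Sum>l<n. q i l w)" for i
          by (rule sum_rotate[of "\<lambda>l. q i l w"])
        then show ?thesis unfolding r_def by (subst sum.swap) (simp only:)
      qed
      have "?L = (\<Sum>w\<in>words m. binary_value w *\<^sub>R ((1 / real n) *\<^sub>R (\<Sum>i<n. \<Sum>l<n. q i l w)))"
        unfolding level_sum_def rot[symmetric]
        by (subst sum.swap) (simp add: scaleR_sum_right mult.commute)
      then have "?L - tr (level_sum p m) *\<^sub>R id_blinfun = (\<Sum>w\<in>words m. binary_value w *\<^sub>R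
          ((1 / real n) *\<^sub>R (\<Sum>i<n. \<Sum>l<n. q i l w) - (\<Sum>l<n. s l w) *\<^sub>R id_blinfun))"
        by (simp add: tr_level s_sum scaleR_sum_left sum_subtractf scaleR_diff_right)
      also have "norm \<dots> \<le> (\<Sum>w\<in>words m. 2 / real n)"
      proof (rule sum_norm_le)
        fix w
        let ?X = "(1 / real n) *\<^sub>R (\<Sum>i<n. \<Sum>l<n. q i l w) - (\<Sum>l<n. s l w) *\<^sub>R id_blinfun"
        have "norm ?X \<le> 2 / real n"
        proof (rule block_average_error[OF G(1) \<open>0 < n\<close> G(2)])
          show "projection_in M (q i l w)" "G i \<cdot> q i l w = q i l w" "tr (q i l w) = s l w"
            if "i < n" "l < n" for i l
            using projection_treeD(1)[OF q(1)] projection_tree_below_root[OF q(1)] q(2,3) that by auto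
          show "card {l. l < n \<and> s l w \<notin> {0, 1 / real n}} \<le> 2"
            unfolding s_def by (rule cut_cells[OF \<open>0 < n\<close>]) (use t(1) in simp)
        qed (use s_bounds in auto)
        moreover have "binary_value w \<le> 1"
          using binary_value_bounds(2)[of w] by (rule order_trans[rotated]) simp
        ultimately show "norm (binary_value w *\<^sub>R ?X) \<le> 2 / real n"
          using binary_value_bounds(1)[of w] by (simp add: mult_le_one order_trans[OF mult_left_le_one_le])
      qed
      also have "\<dots> = 2 ^ m * (2 / real n)"
      proof -
        have "card (words m) = 2 ^ m"
          using card_lists_length_eq[of "UNIV :: bool set" m] by (simp add: words_def)
        then show ?thesis by simp
      qed
      finally show ?thesis .
    qed
    moreover have "norm (tr (level_sum p m) *\<^sub>R id_blinfun - tr T *\<^sub>R (id_blinfun :: 'h \<Rightarrow>\<^sub>L 'h)) \<le> 1 / 2 ^ m"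
    proof -
      note e = projection_tree_partition[OF p(1,2), of m]
      have L: "level_sum p m \<in> M" "is_adjoint (level_sum p m) (level_sum p m)"
        unfolding level_sum_def by (rule diagonal_mem[OF e] diagonal_adjoint[OF e])+
      have "\<bar>tr (T - level_sum p m)\<bar> \<le> 1 / 2 ^ m"
        by (rule order_trans[OF trace_selfadjoint(2) p(3)]) (intro diff_closed is_adjoint_diff T L)+
      then have "\<bar>tr (level_sum p m) - tr T\<bar> \<le> 1 / 2 ^ m" by (simp add: tr_simps T L abs_minus_commute)
      moreover have "norm ((tr (level_sum p m) - tr T) *\<^sub>R (id_blinfun :: 'h \<Rightarrow>\<^sub>L 'h)) \<le> \<bar>tr (level_sum p m) - tr T\<bar> * 1"
        unfolding norm_scaleR by (intro mult_left_mono norm_blinfun_id_le) simp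
      ultimately show ?thesis by (simp add: scaleR_diff_left)
    qed
    ultimately have "norm ((?A - ?L) + (?L - tr (level_sum p m) *\<^sub>R id_blinfun)
        + (tr (level_sum p m) *\<^sub>R id_blinfun - tr T *\<^sub>R id_blinfun))
      \<le> 1 / 2 ^ m + 2 ^ m * (2 / real n) + 1 / 2 ^ m"
      by (intro norm_triangle_mono)
    then show "norm (?A - tr T *\<^sub>R id_blinfun) \<le> 2 / 2 ^ m + 2 ^ m * (2 / real n)" by simp
  qed
qed

lemma equi_measurable_scaleR:
  assumes "S \<in> M" "T \<in> M" "equi_measurable \<tau> S T"
  shows "equi_measurable \<tau> (c *\<^sub>R S) (c *\<^sub>R T)"
proof -
  have "op_pow (c *\<^sub>R A) n = c ^ n *\<^sub>R op_pow A n" for A :: "'h \<Rightarrow>\<^sub>L 'h" and n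
    by (induction n) (auto simp: op_simps mult.commute)
  then show ?thesis
    using assms by (simp add: equi_measurable_def trace_scaleR pow_closed)
qed

text \<open>
  After scaling to \<open>0 \<le> T \<le> 1\<close>, first the level \<open>m\<close> and then the number \<open>n\<close> of blocks is taken large enough for both
  error terms of the rotation average.
\<close>

theorem weak_Dixmier_diffuse:
  assumes normal: "normal_on M \<tau>" and df: "diffuse M"
  shows "weak_Dixmier_property M \<tau>"
  unfolding weak_Dixmier_property_def
proof (intro ballI impI)
  fix T assume T: "T \<in> M" "positive_op T"
  let ?X = "{S \<in> M. positive_op S \<and> equi_measurable \<tau> S T}"
  have T_adj: "is_adjoint T T" by (rule positive_selfadjoint[OF T])
  define c where "c = norm T + 1"
  have c: "c > 0" "norm T \<le> c" using norm_ge_zero[of T] unfolding c_def by linarith+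
  define T0 where "T0 = (1 / c) *\<^sub>R T"
  have T0: "T0 \<in> M" "is_adjoint T0 T0" unfolding T0_def by (intro scaleR_closed is_adjoint_scaleR T T_adj)+
  have TT0: "T = c *\<^sub>R T0" using c by (simp add: T0_def)
  have T0_form: "inner (T0 x) x = inner (T x) x / c" for x
    by (simp add: T0_def blinfun.scaleR_left)
  have lower: "0 \<le> inner (T0 x) x" for x
    using T(2) positive_op_iff[OF T_adj] c by (simp add: T0_form)
  have upper: "inner (T0 x) x \<le> (norm x)\<^sup>2" for x
  proof -
    have "inner (T x) x \<le> norm T * (norm x)\<^sup>2" using inner_op_bound[of T x] by simp
    also have "\<dots> \<le> c * (norm x)\<^sup>2" by (intro mult_right_mono c) simp
    finally show ?thesis using c by (simp add: T0_form field_simps)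
  qed
  show "op_scaleC (\<tau> T) id_blinfun \<in> closure (convex hull ?X)"
    unfolding closure_approachable
  proof (intro allI impI)
    fix e :: real assume "0 < e"
    obtain m where m: "(1/2::real) ^ m < e / c / 4"
      using real_arch_pow_inv[of "e / c / 4" "1/2"] \<open>0 < e\<close> c by auto
    obtain n where n: "2 ^ m * 4 / (e / c) < real n" using reals_Archimedean2 by blast
    have ec: "e / c > 0" using \<open>0 < e\<close> c by simp
    have "0 < 2 ^ m * 4 / (e / c)" using \<open>0 < e\<close> c by simp
    then have "0 < real n" using n by linarith
    then have "0 < n" by simp
    obtain S where S: "\<And>k. S k \<in> M" "\<And>k. positive_op (S k)" "\<And>k. equi_measurable \<tau> (S k) T0"
      "\<And>m. norm ((1 / real n) *\<^sub>R (\<Sum>k<n. S k) - tr T0 *\<^sub>R id_blinfun) \<le> 2 / 2 ^ m + 2 ^ m * (2 / real n)"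
      using rotation_average[OF normal df T0 lower upper \<open>0 < n\<close>] by blast
    have "2 ^ m * 4 < real n * (e / c)" using n by (simp only: pos_divide_less_eq[OF ec])
    then have "2 ^ m * (2 / real n) < e / c / 2" using \<open>0 < real n\<close> by (simp add: field_simps)
    moreover have "2 / 2 ^ m < e / c / 2" using m by (simp add: power_one_over field_simps)
    ultimately have small: "norm ((1 / real n) *\<^sub>R (\<Sum>k<n. S k) - tr T0 *\<^sub>R id_blinfun) < e / c"
      using S(4)[of m] by linarith
    have mem: "c *\<^sub>R S k \<in> ?X" for k
    proof -
      have "positive_op (c *\<^sub>R S k)"
        using S(2) c positive_op_iff[OF positive_selfadjoint[OF S(1,2)]]
          positive_op_iff[OF is_adjoint_scaleR[OF positive_selfadjoint[OF S(1,2)]]]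
        by (simp add: blinfun.scaleR_left)
      then show ?thesis
        using equi_measurable_scaleR[OF S(1) T0(1) S(3), of c] by (simp add: TT0 scaleR_closed S(1))
    qed
    show "\<exists>y\<in>convex hull ?X. dist y (op_scaleC (\<tau> T) id_blinfun) < e"
    proof (intro bexI)
      show "(1 / real n) *\<^sub>R (\<Sum>k<n. c *\<^sub>R S k) \<in> convex hull ?X"
        by (rule average_in_convex_hull[OF \<open>0 < n\<close> mem])
      have "op_scaleC (\<tau> T) id_blinfun = c *\<^sub>R (tr T0 *\<^sub>R (id_blinfun :: 'h \<Rightarrow>\<^sub>L 'h))"
        using trace_selfadjoint(1)[OF T(1) T_adj] T0 by (simp add: TT0 op_scaleC_of_real tr_simps flip: of_real_mult)
      moreover have "(1 / real n) *\<^sub>R (\<Sum>k<n. c *\<^sub>R S k) = c *\<^sub>R ((1 / real n) *\<^sub>R (\<Sum>k<n. S k))"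
        by (simp add: scaleR_sum_right mult.commute)
      ultimately have "dist ((1 / real n) *\<^sub>R (\<Sum>k<n. c *\<^sub>R S k)) (op_scaleC (\<tau> T) id_blinfun)
          = c * norm ((1 / real n) *\<^sub>R (\<Sum>k<n. S k) - tr T0 *\<^sub>R id_blinfun)"
        by (simp only: dist_norm norm_scaleR abs_of_pos[OF c(1)] flip: scaleR_diff_right)
      also have "\<dots> < e" using small c by (simp add: field_simps)
      finally show "dist ((1 / real n) *\<^sub>R (\<Sum>k<n. c *\<^sub>R S k)) (op_scaleC (\<tau> T) id_blinfun) < e" .
    qed
  qed
qed

end

section \<open>Realization by matrices\<close>

lemma mat_adjoint_carrier:
  assumes "A \<in> carrier_mat n n"
  shows "mat_adjoint A \<in> carrier_mat n n"
  using assms by (intro carrier_matI) (auto simp: mat_adjoint_def mat_of_rows_def)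

lemma mat_adjoint_index:
  fixes A :: "complex mat"
  assumes "A \<in> carrier_mat n n" "i < n" "j < n"
  shows "mat_adjoint A $$ (i, j) = cnj (A $$ (j, i))"
  using assms by (simp add: mat_adjoint_def mat_of_rows_def)

lemma mult_mat_index:
  fixes A B :: "complex mat"
  assumes "A \<in> carrier_mat n n" "B \<in> carrier_mat n n" "i < n" "k < n"
  shows "(A * B) $$ (i, k) = (\<Sum>j<n. A $$ (i, j) * B $$ (j, k))"
  using assms by (simp add: scalar_prod_def atLeast0LessThan)

lemma square_mat_eqI:
  assumes "A \<in> carrier_mat n n" "B \<in> carrier_mat n n"
    and "\<And>i j. i < n \<Longrightarrow> j < n \<Longrightarrow> A $$ (i, j) = B $$ (i, j)"
  shows "A = B"
  using assms by (intro eq_matI) auto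

lemma matrix_von_neumann_algebra_block:
  "matrix_von_neumann_algebra n
    {A \<in> carrier_mat n n. \<forall>i<n. \<forall>j<n. r i \<noteq> r j \<longrightarrow> A $$ (i, j) = 0}"
    (is "matrix_von_neumann_algebra n ?N")
  unfolding matrix_von_neumann_algebra_def
proof (intro conjI ballI allI impI)
  show "?N \<subseteq> carrier_mat n n" by blast
  show "1\<^sub>m n \<in> ?N" by auto
  fix A assume A: "A \<in> ?N"
  show "c \<cdot>\<^sub>m A \<in> ?N" for c using A by auto
  show "mat_adjoint A \<in> ?N"
    using A mat_adjoint_carrier[of A n] mat_adjoint_index[of A n] by auto
  fix B assume B: "B \<in> ?N"
  show "A + B \<in> ?N" using A B by auto
  have AB: "A \<in> carrier_mat n n" "B \<in> carrier_mat n n" using A B by auto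
  have "(A * B) $$ (i, k) = 0" if "i < n" "k < n" "r i \<noteq> r k" for i k
    unfolding mult_mat_index[OF AB that(1,2)]
  proof (intro sum.neutral ballI)
    fix j assume "j \<in> {..<n}"
    then show "A $$ (i, j) * B $$ (j, k) = 0"
      using A B that by (cases "r i = r j") auto
  qed
  then show "A * B \<in> ?N" using AB by auto
next
  fix X A
  assume A: "A \<in> carrier_mat n n" and "(\<forall>k. X k \<in> ?N) \<and>
    (\<forall>i<n. \<forall>j<n. (\<lambda>k. X k $$ (i, j)) \<longlonglongrightarrow> A $$ (i, j))"
  then have X: "\<And>k. X k \<in> ?N" "\<And>i j. i < n \<Longrightarrow> j < n \<Longrightarrow> (\<lambda>k. X k $$ (i, j)) \<longlonglongrightarrow> A $$ (i, j)"
    by auto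
  have "A $$ (i, j) = 0" if "i < n" "j < n" "r i \<noteq> r j" for i j
  proof -
    have "(\<lambda>k. X k $$ (i, j)) = (\<lambda>k. 0)" using X(1) that by auto
    then show ?thesis using X(2)[OF that(1,2)] by (simp add: LIMSEQ_const_iff)
  qed
  then show "A \<in> ?N" using A by auto
qed

context tracial_algebra begin

text \<open>
  The \<open>(i, j)\<close> entry of \<open>Y\<close> is \<open>n \<tau> (Y (u j i))\<close>, its coefficient at the matrix unit \<open>u i j\<close>.  This is
  linear in \<open>Y\<close> and zero off the blocks, and all matrices that vanish off the blocks arise.
\<close>

theorem matrix_realization:
  assumes n: "n > 0" and e: "partition_of_unity {..<n} e"
    and min: "\<And>i. i < n \<Longrightarrow> minimal_projection M (e i)"
    and tau: "\<And>i. i < n \<Longrightarrow> \<tau> (e i) = 1 / of_nat n"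
  shows "\<exists>N \<Phi>. matrix_von_neumann_algebra n N \<and> {D \<in> carrier_mat n n. diagonal_mat D} \<subseteq> N \<and>
    trace_preserving_isomorphism M \<tau> n N \<Phi>"
proof -
  note eD = partition_of_unityD[OF e]
  obtain u and r :: "nat \<Rightarrow> nat" where u_M: "\<And>i j. i < n \<Longrightarrow> j < n \<Longrightarrow> u i j \<in> M"
    and u_adj: "\<And>i j. i < n \<Longrightarrow> j < n \<Longrightarrow> is_adjoint (u i j) (u j i)"
    and u_id: "\<And>i. i < n \<Longrightarrow> u i i = e i"
    and u_0: "\<And>i j. i < n \<Longrightarrow> j < n \<Longrightarrow> r i \<noteq> r j \<Longrightarrow> u i j = 0"
    and u_u: "\<And>i j k l. i < n \<Longrightarrow> j < n \<Longrightarrow> k < n \<Longrightarrow> l < n \<Longrightarrow>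
       u i j \<cdot> u k l = (if j = k \<and> r i = r j \<and> r k = r l then u i l else 0)"
    and coeff: "\<And>Y i j. Y \<in> M \<Longrightarrow> i < n \<Longrightarrow> j < n \<Longrightarrow>
       e i \<cdot> Y \<cdot> e j = op_scaleC (of_nat n * \<tau> (Y \<cdot> u j i)) (u i j)"
    using matrix_units[OF e min tau] by blast
  define x where "x Y i j = of_nat n * \<tau> (Y \<cdot> u j i)" for Y i j
  define \<Phi> where "\<Phi> Y = mat n n (\<lambda>(i, j). x Y i j)" for Y
  define N where "N = {A \<in> carrier_mat n n. \<forall>i<n. \<forall>j<n. r i \<noteq> r j \<longrightarrow> A $$ (i, j) = (0::complex)}"
  have \<Phi>_carrier: "\<Phi> Y \<in> carrier_mat n n" for Y by (simp add: \<Phi>_def)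
  have \<Phi>_index: "\<Phi> Y $$ (i, j) = x Y i j" if "i < n" "j < n" for Y i j
    using that by (simp add: \<Phi>_def)
  have x_0: "x Y i j = 0" if "i < n" "j < n" "r i \<noteq> r j" for Y i j
    using u_0[of j i] that by (simp add: x_def)
  have expand: "Y = (\<Sum>i<n. \<Sum>j<n. op_scaleC (x Y i j) (u i j))" if "Y \<in> M" for Y
    using partition_of_unity_expand[OF e, of Y] coeff[OF that] by (simp add: x_def)
  have tau_u: "\<tau> (u i k) = (if i = k then 1 / of_nat n else 0)" if "i < n" "k < n" for i k
  proof (cases "i = k")
    case False
    have "u i k = u i i \<cdot> u i k" using u_u[of i i i k] u_0[of i k] that by auto
    then have "\<tau> (u i k) = \<tau> (u i k \<cdot> u i i)" using trace_commute u_M that by metis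
    also have "\<dots> = 0" using u_u[of i k i i] False that by simp
    finally show ?thesis using False by simp
  qed (use u_id tau that in simp)
  have x_comb: "x (\<Sum>i<n. \<Sum>j<n. op_scaleC (a i j) (u i j)) k l = a k l"
    if a: "\<And>i j. i < n \<Longrightarrow> j < n \<Longrightarrow> r i \<noteq> r j \<Longrightarrow> a i j = 0" and kl: "k < n" "l < n" for a k l
  proof -
    have "\<tau> ((\<Sum>i<n. \<Sum>j<n. op_scaleC (a i j) (u i j)) \<cdot> u l k)
        = \<tau> (\<Sum>i<n. \<Sum>j<n. op_scaleC (a i j) (u i j \<cdot> u l k))"
      by (simp add: op_sum_left op_scaleC_simps)
    also have "\<dots> = (\<Sum>i<n. \<Sum>j<n. a i j * \<tau> (u i j \<cdot> u l k))"
      using kl by (subst trace_sum, blast intro: sum_closed scaleC_closed compose_closed u_M)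
        (intro sum.cong refl, subst trace_sum, auto intro: scaleC_closed compose_closed u_M simp: trace_scaleC compose_closed u_M)
    also have "\<dots> = (\<Sum>i<n. \<Sum>j<n. if i = k then if j = l then a k l / of_nat n else 0 else 0)"
    proof (intro sum.cong refl)
      fix i j assume "i \<in> {..<n}" "j \<in> {..<n}"
      then have ij: "i < n" "j < n" by auto
      have "\<tau> (u i j \<cdot> u l k) = (if j = l \<and> r i = r j \<and> r l = r k then if i = k then 1 / of_nat n else 0 else 0)"
        unfolding u_u[OF ij kl(2,1)] using tau_u[OF ij(1) kl(1)] by simp
      then show "a i j * \<tau> (u i j \<cdot> u l k) = (if i = k then if j = l then a k l / of_nat n else 0 else 0)"
        using a[OF ij] by (cases "i = k"; cases "j = l"; cases "r i = r j") simp_all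
    qed
    also have "\<dots> = (\<Sum>i<n. if i = k then (\<Sum>j<n. if j = l then a k l / of_nat n else 0) else 0)"
      by (intro sum.cong) auto
    also have "\<dots> = a k l / of_nat n" using kl by simp
    finally show ?thesis using n by (simp add: x_def)
  qed
  have x_mult: "x (Y \<cdot> Z) i k = (\<Sum>j<n. x Y i j * x Z j k)"
    if Y: "Y \<in> M" and Z: "Z \<in> M" and ik: "i < n" "k < n" for Y Z i k
  proof -
    \<comment> \<open>Inserting \<open>1 = \<Sum> e j\<close> between \<open>Y\<close> and \<open>Z\<close> produces the matrix product.\<close>
    have uki: "u k i = e k \<cdot> u k i" using u_u[of k k k i] u_0[of k i] u_id ik by auto
    have "Z \<cdot> u k i = (\<Sum>j<n. e j) \<cdot> Z \<cdot> (e k \<cdot> u k i)" using eD(7) uki by simp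
    also have "\<dots> = (\<Sum>j<n. (e j \<cdot> Z \<cdot> e k) \<cdot> u k i)" by (simp add: op_sum_left op_assoc)
    also have "\<dots> = (\<Sum>j<n. op_scaleC (x Z j k) (u j k \<cdot> u k i))"
      using coeff[OF Z] ik by (intro sum.cong refl) (simp add: x_def op_scaleC_simps)
    finally have "Y \<cdot> Z \<cdot> u k i = (\<Sum>j<n. op_scaleC (x Z j k) (Y \<cdot> (u j k \<cdot> u k i)))"
      by (simp add: op_assoc op_sum_right op_scaleC_right[OF linear[OF Y]])
    then have "x (Y \<cdot> Z) i k = of_nat n * \<tau> (\<Sum>j<n. op_scaleC (x Z j k) (Y \<cdot> (u j k \<cdot> u k i)))"
      by (simp only: x_def[of "Y \<cdot> Z"])
    also have "\<dots> = (\<Sum>j<n. of_nat n * (x Z j k * \<tau> (Y \<cdot> (u j k \<cdot> u k i))))"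
      using Y ik by (subst trace_sum)
        (auto intro: scaleC_closed compose_closed u_M simp: trace_scaleC compose_closed u_M sum_distrib_left)
    also have "\<dots> = (\<Sum>j<n. x Y i j * x Z j k)"
    proof (intro sum.cong refl)
      fix j assume "j \<in> {..<n}"
      then have j: "j < n" by simp
      show "of_nat n * (x Z j k * \<tau> (Y \<cdot> (u j k \<cdot> u k i))) = x Y i j * x Z j k"
      proof (cases "r j = r k")
        case True
        show ?thesis
        proof (cases "r k = r i")
          case ri: True
          then have "u j k \<cdot> u k i = u j i" using u_u[of j k k i] True j ik by simp
          then show ?thesis by (simp add: x_def[of Y])
        next
          case False
          then show ?thesis using u_0[of k i] x_0[of i j Y] True j ik by simp
        qed
      qed (use x_0[of j k Z] j ik in simp)
    qed
    finally show ?thesis .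
  qed
  have iso: "trace_preserving_isomorphism M \<tau> n N \<Phi>"
    unfolding trace_preserving_isomorphism_def
  proof (intro conjI ballI allI impI)
    show "bij_betw \<Phi> M N"
      unfolding bij_betw_def
    proof
      show "inj_on \<Phi> M"
      proof (rule inj_onI)
        fix Y Z assume YZ: "Y \<in> M" "Z \<in> M" "\<Phi> Y = \<Phi> Z"
        have "x Y i j = x Z i j" if "i < n" "j < n" for i j
          using YZ(3) \<Phi>_index[OF that] by metis
        then show "Y = Z" using expand[OF YZ(1)] expand[OF YZ(2)] by simp
      qed
      show "\<Phi> ` M = N"
      proof
        show "\<Phi> ` M \<subseteq> N" by (auto simp: N_def \<Phi>_carrier \<Phi>_index x_0)
        show "N \<subseteq> \<Phi> ` M"
        proof
          fix A assume A: "A \<in> N"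
          define Y where "Y = (\<Sum>i<n. \<Sum>j<n. op_scaleC (A $$ (i, j)) (u i j))"
          have "Y \<in> M" unfolding Y_def by (intro sum_closed scaleC_closed u_M) auto
          moreover have "\<Phi> Y = A"
          proof (rule square_mat_eqI[OF \<Phi>_carrier])
            show "A \<in> carrier_mat n n" using A by (simp add: N_def)
            show "\<Phi> Y $$ (i, j) = A $$ (i, j)" if "i < n" "j < n" for i j
              unfolding \<Phi>_index[OF that] Y_def by (rule x_comb) (use A that in \<open>auto simp: N_def\<close>)
          qed
          ultimately show "A \<in> \<Phi> ` M" by blast
        qed
      qed
    qed
    show "\<Phi> id_blinfun = 1\<^sub>m n"
      by (rule square_mat_eqI[OF \<Phi>_carrier]) (use n in \<open>auto simp: \<Phi>_index x_def tau_u\<close>)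
    show "\<Phi> (A + B) = \<Phi> A + \<Phi> B" if "A \<in> M" "B \<in> M" for A B
    proof (rule square_mat_eqI[OF \<Phi>_carrier])
      fix i j assume ij: "i < n" "j < n"
      then show "\<Phi> (A + B) $$ (i, j) = (\<Phi> A + \<Phi> B) $$ (i, j)"
        using that \<Phi>_carrier[of A] \<Phi>_carrier[of B]
        by (simp add: \<Phi>_index x_def op_simps trace_add compose_closed u_M distrib_left)
    qed (use \<Phi>_carrier in auto)
    show "\<Phi> (op_scaleC c A) = c \<cdot>\<^sub>m \<Phi> A" if "A \<in> M" for c A
    proof (rule square_mat_eqI[OF \<Phi>_carrier])
      fix i j assume ij: "i < n" "j < n"
      then show "\<Phi> (op_scaleC c A) $$ (i, j) = (c \<cdot>\<^sub>m \<Phi> A) $$ (i, j)"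
        using that \<Phi>_carrier[of A]
        by (simp add: \<Phi>_index x_def op_scaleC_simps trace_scaleC compose_closed u_M)
    qed (use \<Phi>_carrier in auto)
    show "\<Phi> (A \<cdot> B) = \<Phi> A * \<Phi> B" if "A \<in> M" "B \<in> M" for A B
    proof (rule square_mat_eqI[OF \<Phi>_carrier])
      show "\<Phi> (A \<cdot> B) $$ (i, j) = (\<Phi> A * \<Phi> B) $$ (i, j)" if "i < n" "j < n" for i j
        unfolding mult_mat_index[OF \<Phi>_carrier \<Phi>_carrier that]
        using that x_mult[OF \<open>A \<in> M\<close> \<open>B \<in> M\<close>] by (simp add: \<Phi>_index)
    qed (rule mult_carrier_mat[OF \<Phi>_carrier \<Phi>_carrier])
    show "\<Phi> B = mat_adjoint (\<Phi> A)" if AB: "A \<in> M" "B \<in> M" "is_adjoint A B" for A B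
    proof (rule square_mat_eqI[OF \<Phi>_carrier mat_adjoint_carrier[OF \<Phi>_carrier]])
      fix i j assume ij: "i < n" "j < n"
      have "\<tau> (u j i \<cdot> B) = cnj (\<tau> (A \<cdot> u i j))"
        using AB ij by (intro trace_adjoint compose_closed is_adjoint_compose u_M u_adj)
      moreover have "\<tau> (u j i \<cdot> B) = \<tau> (B \<cdot> u j i)"
        using AB ij by (intro trace_commute u_M)
      ultimately show "\<Phi> B $$ (i, j) = mat_adjoint (\<Phi> A) $$ (i, j)"
        using ij by (simp add: mat_adjoint_index[OF \<Phi>_carrier] \<Phi>_index x_def)
    qed
    show "normalized_trace n (\<Phi> A) = \<tau> A" if "A \<in> M" for A
    proof -
      have "normalized_trace n (\<Phi> A) = (\<Sum>i<n. \<tau> (A \<cdot> e i))"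
        using n by (simp add: normalized_trace_def \<Phi>_index x_def u_id flip: sum_distrib_left)
      also have "\<dots> = \<tau> (\<Sum>i<n. A \<cdot> e i)"
        using that eD(3) by (intro trace_sum[symmetric] compose_closed) auto
      also have "\<dots> = \<tau> A" by (simp add: eD(7) flip: op_sum_right)
      finally show ?thesis .
    qed
  qed
  have "matrix_von_neumann_algebra n N"
    unfolding N_def by (rule matrix_von_neumann_algebra_block)
  moreover have "{D \<in> carrier_mat n n. diagonal_mat D} \<subseteq> N"
  proof (intro subsetI)
    fix A :: "complex mat" assume A: "A \<in> {D \<in> carrier_mat n n. diagonal_mat D}"
    have "A $$ (i, j) = 0" if "i < n" "j < n" "r i \<noteq> r j" for i j
    proof -
      have "i \<noteq> j" using that(3) by blast
      moreover have "dim_row A = n" "dim_col A = n" using A by auto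
      ultimately show ?thesis using A that(1,2) by (simp add: diagonal_mat_def)
    qed
    then show "A \<in> N" using A by (simp add: N_def)
  qed
  ultimately show ?thesis using iso by blast
qed

text \<open>
  The diagonal matrix units compress any matrix to a multiple of themselves.  Hence their preimages \<open>d i\<close> are
  minimal projections with sum \<open>1\<close>, and each of them has trace \<open>1/n\<close>.
\<close>

theorem matrix_realization_converse:
  assumes N: "matrix_von_neumann_algebra n N" "{D \<in> carrier_mat n n. diagonal_mat D} \<subseteq> N"
    and iso: "trace_preserving_isomorphism M \<tau> n N \<Phi>"
  shows "finite_dimensional M"
    "minimal_projection M E \<Longrightarrow> \<tau> E = 1 / of_nat n"
proof -
  have bij: "bij_betw \<Phi> M N" and \<Phi>_id: "\<Phi> id_blinfun = 1\<^sub>m n"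
    and \<Phi>_add: "\<And>A B. A \<in> M \<Longrightarrow> B \<in> M \<Longrightarrow> \<Phi> (A + B) = \<Phi> A + \<Phi> B"
    and \<Phi>_scale: "\<And>c A. A \<in> M \<Longrightarrow> \<Phi> (op_scaleC c A) = c \<cdot>\<^sub>m \<Phi> A"
    and \<Phi>_mult: "\<And>A B. A \<in> M \<Longrightarrow> B \<in> M \<Longrightarrow> \<Phi> (A \<cdot> B) = \<Phi> A * \<Phi> B"
    and \<Phi>_adj: "\<And>A B. A \<in> M \<Longrightarrow> B \<in> M \<Longrightarrow> is_adjoint A B \<Longrightarrow> \<Phi> B = mat_adjoint (\<Phi> A)"
    and \<Phi>_trace: "\<And>A. A \<in> M \<Longrightarrow> normalized_trace n (\<Phi> A) = \<tau> A"
    using iso unfolding trace_preserving_isomorphism_def by auto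
  have carrier: "\<Phi> A \<in> carrier_mat n n" if "A \<in> M" for A
    using bij_betwE[OF bij] N(1) that by (auto simp: matrix_von_neumann_algebra_def)
  have eqI: "A = B" if "A \<in> M" "B \<in> M" "\<And>i j. i < n \<Longrightarrow> j < n \<Longrightarrow> \<Phi> A $$ (i, j) = \<Phi> B $$ (i, j)" for A B
    using bij square_mat_eqI[OF carrier carrier, of A B] that by (auto simp: bij_betw_def dest: inj_onD)
  have \<Phi>_0: "\<Phi> 0 $$ (a, b) = 0" if "a < n" "b < n" for a b
    using \<Phi>_scale[OF id_closed, of 0] that by (simp add: op_scaleC_simps \<Phi>_id)
  have \<Phi>_sum: "\<Phi> (\<Sum>i\<in>I. A i) $$ (a, b) = (\<Sum>i\<in>I. \<Phi> (A i) $$ (a, b))"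
    if "finite I" "\<And>i. i \<in> I \<Longrightarrow> A i \<in> M" "a < n" "b < n" for I :: "nat set" and A a b
    using that(1,2)
  proof (induction I rule: finite_induct)
    case (insert i I)
    have "\<Phi> (A i + (\<Sum>i\<in>I. A i)) = \<Phi> (A i) + \<Phi> (\<Sum>i\<in>I. A i)"
      using insert by (intro \<Phi>_add sum_closed) auto
    then show ?case
      using insert carrier[of "A i"] carrier[OF sum_closed, of I A] that(3,4) by simp
  qed (simp add: \<Phi>_0 that)
  define D where "D i = mat n n (\<lambda>(a, b). if a = i \<and> b = i then 1 else (0::complex))" for i
  have D_carrier: "D i \<in> carrier_mat n n" for i by (simp add: D_def)
  have D_index: "D i $$ (a, b) = (if a = i \<and> b = i then 1 else 0)" if "a < n" "b < n" for i a b
    using that by (simp add: D_def)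
  have "\<exists>d. d \<in> M \<and> \<Phi> d = D i" for i
  proof -
    have "D i \<in> N" using N(2) by (auto simp: D_def diagonal_mat_def)
    then show ?thesis using bij by (auto simp: bij_betw_def)
  qed
  then obtain d where d: "\<And>i. d i \<in> M" "\<And>i. \<Phi> (d i) = D i" by metis
  have left: "\<Phi> (d i \<cdot> A) $$ (a, b) = (if a = i then \<Phi> A $$ (i, b) else 0)"
    if "A \<in> M" "i < n" "a < n" "b < n" for i A a b
  proof -
    have "\<Phi> (d i \<cdot> A) $$ (a, b) = (\<Sum>j<n. if j = i then (if a = i then \<Phi> A $$ (i, b) else 0) else 0)"
      unfolding \<Phi>_mult[OF d(1) that(1)] d(2) mult_mat_index[OF D_carrier carrier[OF that(1)] that(3,4)]
      by (intro sum.cong) (auto simp: D_index that)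
    then show ?thesis using that(2) by simp
  qed
  have right: "\<Phi> (A \<cdot> d i) $$ (a, b) = (if b = i then \<Phi> A $$ (a, i) else 0)"
    if "A \<in> M" "i < n" "a < n" "b < n" for i A a b
  proof -
    have "\<Phi> (A \<cdot> d i) $$ (a, b) = (\<Sum>j<n. if j = i then (if b = i then \<Phi> A $$ (a, i) else 0) else 0)"
      unfolding \<Phi>_mult[OF that(1) d(1)] d(2) mult_mat_index[OF carrier[OF that(1)] D_carrier that(3,4)]
      by (intro sum.cong) (auto simp: D_index that)
    then show ?thesis using that(2) by simp
  qed
  have dd: "d i \<cdot> d j = (if i = j then d i else 0)" if "i < n" "j < n" for i j
    by (rule eqI) (use that in \<open>auto simp: left d D_index \<Phi>_0 intro: compose_closed\<close>)
  have d_adj: "is_adjoint (d i) (d i)" for i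
  proof -
    obtain B where B: "B \<in> M" "is_adjoint (d i) B" using adjoint_exists[OF d(1)] by blast
    have "B = d i"
      by (rule eqI[OF B(1) d(1)])
        (auto simp: \<Phi>_adj[OF d(1) B] d mat_adjoint_index[OF D_carrier] D_index)
    then show ?thesis using B by simp
  qed
  have d_proj: "projection_in M (d i)" if "i < n" for i
    using d d_adj dd that by (simp add: projection_in_def)
  have d_sum: "(\<Sum>i<n. d i) = id_blinfun"
  proof (rule eqI)
    fix a b assume ab: "a < n" "b < n"
    have "\<Phi> (\<Sum>i<n. d i) $$ (a, b) = (\<Sum>i<n. if i = a then (if a = b then 1 else 0) else 0)"
      unfolding \<Phi>_sum[OF finite_lessThan d(1) ab] by (intro sum.cong) (auto simp: d D_index ab)
    then show "\<Phi> (\<Sum>i<n. d i) $$ (a, b) = \<Phi> id_blinfun $$ (a, b)" using ab by (simp add: \<Phi>_id)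
  qed (auto intro: sum_closed d)
  have part: "partition_of_unity {..<n} d"
    using d_proj dd d_sum by (simp add: partition_of_unity_def)
  have d_min: "minimal_projection M (d i)" if i: "i < n" for i
    unfolding minimal_projection_def
  proof (intro conjI allI impI d_proj i)
    show "d i \<noteq> 0"
      using d(2)[of i] D_index[of i i i] \<Phi>_0[of i i] i by auto
    fix F assume "projection_in M F \<and> op_le F (d i)"
    then have F: "projection_in M F" "d i \<cdot> F = F" using op_le_projection_iff[OF d_proj[OF i]] by auto
    have FM: "F \<in> M" using F by (simp add: projection_in_def)
    have Fd: "F \<cdot> d i = F" by (rule projection_sub_commute(1)[OF d_proj[OF i] F])
    define f where "f = \<Phi> F $$ (i, i)"
    have F_index: "\<Phi> F $$ (a, b) = (if a = i \<and> b = i then f else 0)" if "a < n" "b < n" for a b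
      using left[OF FM i that] right[OF FM i that] by (auto simp: F(2) Fd f_def)
    have "f = \<Phi> (F \<cdot> F) $$ (i, i)" using F(1) by (simp add: f_def projection_in_def)
    also have "\<dots> = (\<Sum>j<n. if j = i then f * f else 0)"
      unfolding \<Phi>_mult[OF FM FM] mult_mat_index[OF carrier[OF FM] carrier[OF FM] i i]
      by (intro sum.cong) (auto simp: F_index i)
    also have "\<dots> = f * f" using i by simp
    finally have "f = 0 \<or> f = 1" by (metis mult_cancel_left1)
    then show "F = 0 \<or> F = d i"
    proof
      assume "f = 0"
      then have "F = 0" by (intro eqI FM) (auto simp: F_index \<Phi>_0)
      then show ?thesis by blast
    next
      assume "f = 1"
      then have "F = d i" by (intro eqI FM d) (auto simp: F_index d D_index)
      then show ?thesis by blast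
    qed
  qed
  have d_tau: "\<tau> (d i) = 1 / of_nat n" if "i < n" for i
  proof -
    have "(\<Sum>a<n. D i $$ (a, a)) = (\<Sum>a<n. if a = i then 1 else 0)"
      by (intro sum.cong) (auto simp: D_index)
    then show ?thesis using \<Phi>_trace[OF d(1), of i] that by (simp add: d normalized_trace_def)
  qed
  show "\<tau> E = 1 / of_nat n" if "minimal_projection M E" for E
    by (rule minimal_traces_const[OF part d_min d_tau that])
  have inj: "inj_on d {..<n}"
  proof (rule inj_onI)
    fix i j assume ij: "i \<in> {..<n}" "j \<in> {..<n}" "d i = d j"
    show "i = j"
    proof (rule ccontr)
      assume "i \<noteq> j"
      then have "d i \<cdot> d j = 0" using dd[of i j] ij(1,2) by simp
      then have "d i \<cdot> d i = 0" by (simp only: ij(3))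
      then show False using dd[of i i] minimal_projectionD(2)[OF d_min[of i]] ij(1) by simp
    qed
  qed
  have "orthogonal_projections (d ` {..<n})"
    using d_proj dd minimal_projectionD(2)[OF d_min] by (auto simp: orthogonal_projections_def)
  moreover have "\<Sum>(d ` {..<n}) = id_blinfun"
    using sum.reindex[OF inj, of "\<lambda>x. x"] d_sum by simp
  ultimately show "finite_dimensional M"
    using d_min by (intro finite_dimensionalI[of "d ` {..<n}"]) auto
qed

end

theorem theorem3p27:
  fixes M :: "('h::complex_hilbert \<Rightarrow>\<^sub>L 'h) set"
    and \<tau> :: "('h \<Rightarrow>\<^sub>L 'h) \<Rightarrow> complex"
  assumes "finite_von_neumann_algebra M \<tau>"
  shows
    "(weak_Dixmier_property M \<tau> \<longleftrightarrow>
       (finite_dimensional M \<and>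
        (\<forall>E F. minimal_projection M E \<and> minimal_projection M F \<longrightarrow> \<tau> E = \<tau> F)) \<or>
       diffuse M) \<and>
     ((finite_dimensional M \<and>
        (\<forall>E F. minimal_projection M E \<and> minimal_projection M F \<longrightarrow> \<tau> E = \<tau> F)) \<longleftrightarrow>
       (\<exists>n\<ge>1. \<exists>N \<Phi>. matrix_von_neumann_algebra n N \<and>
          {D \<in> carrier_mat n n. diagonal_mat D} \<subseteq> N \<and>
          trace_preserving_isomorphism M \<tau> n N \<Phi>)) \<and>
     (finite_dimensional M \<longrightarrow> atomic M)"
proof -
  interpret tracial_algebra M \<tau>
    by (rule finite_von_neumann_algebra_tracial[OF assms])
  have normal: "normal_on M \<tau>"
    using assms by (simp add: finite_von_neumann_algebra_def)
  define C where "C \<longleftrightarrow> finite_dimensional M \<and>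
    (\<forall>E F. minimal_projection M E \<and> minimal_projection M F \<longrightarrow> \<tau> E = \<tau> F)"
  have "weak_Dixmier_property M \<tau> \<longleftrightarrow> C \<or> diffuse M"
    using weak_Dixmier_not_diffuse weak_Dixmier_equal_minimal_traces weak_Dixmier_diffuse[OF normal]
    unfolding C_def by blast
  moreover have "C \<longleftrightarrow> (\<exists>n\<ge>1. \<exists>N \<Phi>. matrix_von_neumann_algebra n N \<and>
      {D \<in> carrier_mat n n. diagonal_mat D} \<subseteq> N \<and> trace_preserving_isomorphism M \<tau> n N \<Phi>)"
  proof
    assume C
    then obtain e and n :: nat where "n > 0" "partition_of_unity {..<n} e"
      "\<And>i. i < n \<Longrightarrow> minimal_projection M (e i)" "\<And>i. i < n \<Longrightarrow> \<tau> (e i) = 1 / of_nat n"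
      using finite_dimensional_unit_partition unfolding C_def by metis
    then show "\<exists>n\<ge>1. \<exists>N \<Phi>. matrix_von_neumann_algebra n N \<and>
      {D \<in> carrier_mat n n. diagonal_mat D} \<subseteq> N \<and> trace_preserving_isomorphism M \<tau> n N \<Phi>"
      using matrix_realization[of n e] by (intro exI[of _ n] conjI) auto
  next
    assume "\<exists>n\<ge>1. \<exists>N \<Phi>. matrix_von_neumann_algebra n N \<and>
      {D \<in> carrier_mat n n. diagonal_mat D} \<subseteq> N \<and> trace_preserving_isomorphism M \<tau> n N \<Phi>"
    then obtain n N \<Phi> where "matrix_von_neumann_algebra n N"
      "{D \<in> carrier_mat n n. diagonal_mat D} \<subseteq> N" "trace_preserving_isomorphism M \<tau> n N \<Phi>"
      by blast
    from matrix_realization_converse[OF this] show C unfolding C_def by auto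
  qed
  ultimately show ?thesis
    using finite_dimensional_atomic unfolding C_def by blast
qed

end
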